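(* Let $\boldsymbol\sigma=(\sigma_n)_{n\in\mathbb Z}\in\mathcal S_d^{\mathbb Z}$, with $d\ge2$, be a sequence of unimodular substitutions that satisfies the tiling condition with compact Rauzy fractals. Then the sequence $(\mathcal P_n^{\mathrm{gen}})_{n\in\mathbb Z}$ with $$\mathcal P_n^{\mathrm{gen}}=\big\{\operatorname{int}(\widehat{\mathcal R}_n(a,p,b))\bmod\mathbb Z^d:(a,p,b)\in E_n\big\}$$ forms a nonstationary Markov partition for the mapping family $(\mathbb T,f_{\boldsymbol\sigma})$ associated to $\boldsymbol\sigma$. If moreover $\boldsymbol\sigma$ is two-sided primitive, then this nonstationary Markov partition is generating, and it provides a symbolic model of $(\mathbb T,f_{\boldsymbol\sigma})$ as a nonstationary edge shift: if $\mathscr B$ is the Bratteli diagram associated to $\boldsymbol\sigma$, then for each $n\in\mathbb Z$ the map $$\psi_n:X^{(n)}_{\mathscr B}\to\mathbb T_n,\quad (e_k)_{k\in\mathbb Z}\mapsto\mathbf x\ \text{ such that }\ \bigcap_{\ell\in\mathbb N}\overline{\bigcap_{|k|\le\ell}f_{\boldsymbol\sigma}^{-k}\big(\operatorname{int}(\widehat{\mathcal R}_{n+k}(e_k))\big)}=\{\mathbf x\},$$ is well defined, continuous and one-to-one except on the set of the pullbacks of the boundaries of the Rauzy boxes $\widehat{\mathcal R}_k(e)$, $e\in E_k$, $k\in\mathbb Z$; one has $\psi_{n+1}\circ\Sigma=f_{\boldsymbol\sigma}\circ\psi_n$ on $X^{(n)}_{\mathscr B}$; and hence the map $\varphi:X_{\mathscr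 B}\to\mathbb T$ given by $\psi_n$ on $X^{(n)}_{\mathscr B}$ is a measurable conjugacy between $(X_{\mathscr B},\Sigma)$ and $(\mathbb T,f_{\boldsymbol\sigma})$, failing to be one-to-one only on the set of those pullbacks.
   Context: Substitutions. $\mathcal A=\{1,\dots,d\}$, $\mathcal A^*$ is the free monoid of finite words. A substitution is an endomorphism of $\mathcal A^*$ mapping letters to nonempty words; $|w|_a$ is the number of occurrences of $a$ in $w$; $\boldsymbol\ell(w)=(|w|_1,\dots,|w|_d)^\top$; $M_\sigma=(|\sigma(b)|_a)_{a,b}$ is the incidence matrix; $\mathcal S_d$ is the set of substitutions over $\mathcal A$ with $|\det M_\sigma|=1$ (unimodular); $\sigma_{[m,n)}=\sigma_m\circ\cdots\circ\sigma_{n-1}$; $v\preceq w$ means $v$ is a prefix of $w$. $\boldsymbol\sigma$ is primitive if for each $m$ there is $n>m$ with $M_{\sigma_{[m,n)}}$ having only positive entries, and two-sided primitive if moreover for each $n$ there is $m<n$ with $M_{\sigma_{[m,n)}}$ having only positive entries. Eigenvectors. Generalized right (left) eigenvector: $\mathbf u$ (resp. $\mathbf v$) in $\mathbb R_{\ge0}^d\setminus\{\mathbf 0\}$ with $\bigcap_{n\ge0}M_{\sigma_{[0,n)}}\mathbb R^d_{\ge0}=\mathbb R_{\ge0}\mathbf u$ (resp. $\bigcap_{n\ge0}M_{\sigma_{[-n,0)}}^\top\mathbb R^d_{\ge0}=\mathbb R_{\ge0}\mathbf v$). $\mathbf u_n=M_{\sigma_{[0,n)}}^{-1}\mathbf u$,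 $\mathbf v_n=M_{\sigma_{[0,n)}}^\top\mathbf v$ for $n\ge0$; $\mathbf u_n=M_{\sigma_{[n,0)}}\mathbf u$, $\mathbf v_n=(M_{\sigma_{[n,0)}}^\top)^{-1}\mathbf v$ for $n<0$. $\pi_n\mathbf x=\mathbf x-\frac{\langle\mathbf x,\mathbf v_n\rangle}{\langle\mathbf u_n,\mathbf v_n\rangle}\mathbf u_n$, $\tilde\pi_n\mathbf x=\frac{\langle\mathbf x,\mathbf v_n\rangle}{\langle\mathbf u_n,\mathbf v_n\rangle}\mathbf u_n$. Rauzy fractals and boxes. $\mathcal R_n(a)$ is the closure of $\{\pi_n\boldsymbol\ell(p):pa\preceq\sigma_{[n,m)}(b)\text{ for infinitely many }m\ge n,b\in\mathcal A\}$, $\mathcal R_n=\bigcup_a\mathcal R_n(a)$ is the Rauzy fractal; $\widehat{\mathcal R}_n(a)=\tilde\pi_n\llbracket\mathbf e_a\rrbracket-\mathcal R_n(a)$, with $\llbracket\mathbf x\rrbracket$ the closed segment from $\mathbf 0$ to $\mathbf x$. $E_n=\{(a,p,b)\in\mathcal A\times\mathcal A^*\times\mathcal A:pa\preceq\sigma_n(b)\}$, $\mathcal R_n(a,p,b)=\pi_n\boldsymbol\ell(p)+M_{\sigma_n}\mathcal R_{n+1}(b)$, $\widehat{\mathcal R}_n(a,p,b)=\tilde\pi_n\llbracket\mathbf e_a\rrbracket-\mathcal R_n(a,p,b)$. Tiling condition: $\boldsymbol\sigma$ is primitive, admits generalized right and left eigenvectors, and for every $n\in\mathbb Z$ the collection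 $\{\mathbf x+\widehat{\mathcal R}_n(a):\mathbf x\in\mathbb Z^d,a\in\mathcal A\}$ tiles $\mathbb R^d$ (closed sets covering $\mathbb R^d$, distinct tiles intersecting in Lebesgue measure zero). Mapping family. $\mathbb T_n$ is a copy of $\mathbb R^d/\mathbb Z^d$, $\mathbb T=\coprod_{n\in\mathbb Z}\mathbb T_n$, $f_{\boldsymbol\sigma}:\mathbb T\to\mathbb T$, $f_{\boldsymbol\sigma}(\mathbf x)=M_{\sigma_n}^{-1}\mathbf x\in\mathbb T_{n+1}$ for $\mathbf x\in\mathbb T_n$. Sets $\operatorname{int}(\widehat{\mathcal R}_n(e))$ are viewed in $\mathbb T_n$. Markov partitions. A topological partition of a compact space is a finite collection of pairwise disjoint open sets whose closures cover the space. Let $\mathcal P_n=\{R_{n,1},\dots,R_{n,q_n}\}$ be a topological partition of $\mathbb T_n$ for each $n$. $(\mathcal P_n)_{n\in\mathbb Z}$ is a nonstationary Markov partition for $(\mathbb T,f)$ if for any $(i_n)\in\prod_n\{1,\dots,q_n\}$, $n\in\mathbb Z$, $m\ge2$: $R_{k,i_k}\cap f^{-1}(R_{k+1,i_{k+1}})\ne\emptyset$ for all $k\in\{n,\dots,n+m-1\}$ implies $R_{n,i_n}\cap f^{-1}(R_{n+1,i_{n+1}})\cap\cdots\cap f^{-m}(R_{n+m,i_{n+m}})\neq\emptyset$. It is generating if for any $(i_n)$ the set $\bigcap_{n\in\mathbb N}\overline{\bigcap_{|k|<n}f^{-k}(R_{k,i_k})}$ contains at most one point. Edge shift. The Bratteli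 diagram $\mathscr B$ of $\boldsymbol\sigma$ has vertex sets $V_n=\mathcal A$ and edge sets $E_n$, with source $s(a,p,b)=a\in V_n$ and range $r(a,p,b)=b\in V_{n+1}$. $X^{(n)}_{\mathscr B}$ is the set of $(e_k)_{k\in\mathbb Z}$ with $e_k\in E_{n+k}$ and $r(e_k)=s(e_{k+1})$ for all $k$ (product topology); $X_{\mathscr B}=\coprod_nX^{(n)}_{\mathscr B}$; $\Sigma$ is the left shift $X_{\mathscr B}^{(n)}\to X_{\mathscr B}^{(n+1)}$. $(X_{\mathscr B},\Sigma)$ is called the nonstationary edge shift of $\mathscr B$. *)

theory Defs
  imports "HOL-Analysis.Analysis" "HOL-Library.Sublist"
begin

text \<open>The alphabet is a finite type \<open>'d\<close>, so that \<open>d\<close> is \<open>CARD('d)\<close>; words are lists.\<close>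

definition substitution :: "('d list \<Rightarrow> 'd list) \<Rightarrow> bool" where
  "substitution s \<longleftrightarrow> (\<forall>v w. s (v @ w) = s v @ s w) \<and> (\<forall>a. s [a] \<noteq> [])"

definition abelianization :: "'d::finite list \<Rightarrow> real ^ 'd" where
  "abelianization w = (\<chi> a. real (count_list w a))"

definition incidence :: "('d::finite list \<Rightarrow> 'd list) \<Rightarrow> real ^ 'd ^ 'd" where
  "incidence s = (\<chi> a b. real (count_list (s [b]) a))"

definition unimodular_substitution :: "('d::finite list \<Rightarrow> 'd list) \<Rightarrow> bool" where
  "unimodular_substitution s \<longleftrightarrow> substitution s \<and> \<bar>det (incidence s)\<bar> = 1"

text \<open>\<open>block \<sigma> m n\<close> is the composition of \<open>\<sigma> m, \<dots>, \<sigma> (n - 1)\<close>, with \<open>\<sigma> m\<close> outermost;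
  it is the identity if \<open>n \<le> m\<close>.\<close>

definition block :: "(int \<Rightarrow> 'd list \<Rightarrow> 'd list) \<Rightarrow> int \<Rightarrow> int \<Rightarrow> 'd list \<Rightarrow> 'd list" where
  "block \<sigma> m n = foldr (\<lambda>k f. \<sigma> k \<circ> f) [m..n - 1] id"

definition positive_matrix :: "real ^ 'd ^ 'd \<Rightarrow> bool" where
  "positive_matrix A \<longleftrightarrow> (\<forall>i j. A $ i $ j > 0)"

definition primitive :: "(int \<Rightarrow> 'd::finite list \<Rightarrow> 'd list) \<Rightarrow> bool" where
  "primitive \<sigma> \<longleftrightarrow> (\<forall>m. \<exists>n>m. positive_matrix (incidence (block \<sigma> m n)))"

definition two_sided_primitive :: "(int \<Rightarrow> 'd::finite list \<Rightarrow> 'd list) \<Rightarrow> bool" where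
  "two_sided_primitive \<sigma> \<longleftrightarrow>
     primitive \<sigma> \<and> (\<forall>n. \<exists>m<n. positive_matrix (incidence (block \<sigma> m n)))"

definition nonneg_cone :: "(real ^ 'd) set" where
  "nonneg_cone = {x. \<forall>i. 0 \<le> x $ i}"

definition generalized_right_eigenvector ::
    "(int \<Rightarrow> 'd::finite list \<Rightarrow> 'd list) \<Rightarrow> real ^ 'd \<Rightarrow> bool" where
  "generalized_right_eigenvector \<sigma> u \<longleftrightarrow> u \<in> nonneg_cone - {0} \<and>
     (\<Inter>n::nat. (*v) (incidence (block \<sigma> 0 (int n))) ` nonneg_cone) = {t *\<^sub>R u |t. t \<ge> 0}"

definition generalized_left_eigenvector ::
    "(int \<Rightarrow> 'd::finite list \<Rightarrow> 'd list) \<Rightarrow> real ^ 'd \<Rightarrow> bool" where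
  "generalized_left_eigenvector \<sigma> v \<longleftrightarrow> v \<in> nonneg_cone - {0} \<and>
     (\<Inter>n::nat. (*v) (transpose (incidence (block \<sigma> (- int n) 0))) ` nonneg_cone)
       = {t *\<^sub>R v |t. t \<ge> 0}"

definition right_vec ::
    "(int \<Rightarrow> 'd::finite list \<Rightarrow> 'd list) \<Rightarrow> real ^ 'd \<Rightarrow> int \<Rightarrow> real ^ 'd" where
  "right_vec \<sigma> u n =
     (if n \<ge> 0 then matrix_inv (incidence (block \<sigma> 0 n)) *v u
      else incidence (block \<sigma> n 0) *v u)"

definition left_vec ::
    "(int \<Rightarrow> 'd::finite list \<Rightarrow> 'd list) \<Rightarrow> real ^ 'd \<Rightarrow> int \<Rightarrow> real ^ 'd" where
  "left_vec \<sigma> v n =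
     (if n \<ge> 0 then transpose (incidence (block \<sigma> 0 n)) *v v
      else matrix_inv (transpose (incidence (block \<sigma> n 0))) *v v)"

text \<open>\<open>proj_u\<close> projects onto the line of \<open>right_vec \<sigma> u n\<close> and \<open>proj_v\<close> onto the hyperplane
  orthogonal to \<open>left_vec \<sigma> v n\<close>.  Neither changes when \<open>u\<close> or \<open>v\<close> is multiplied by a positive
  scalar, and generalized eigenvectors are unique up to such scalars.\<close>

definition proj_u ::
    "(int \<Rightarrow> 'd::finite list \<Rightarrow> 'd list) \<Rightarrow> real ^ 'd \<Rightarrow> real ^ 'd \<Rightarrow> int \<Rightarrow> real ^ 'd \<Rightarrow> real ^ 'd"
  where
  "proj_u \<sigma> u v n x =
     ((x \<bullet> left_vec \<sigma> v n) / (right_vec \<sigma> u n \<bullet> left_vec \<sigma> v n)) *\<^sub>R right_vec \<sigma> u n"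

definition proj_v ::
    "(int \<Rightarrow> 'd::finite list \<Rightarrow> 'd list) \<Rightarrow> real ^ 'd \<Rightarrow> real ^ 'd \<Rightarrow> int \<Rightarrow> real ^ 'd \<Rightarrow> real ^ 'd"
  where
  "proj_v \<sigma> u v n x = x - proj_u \<sigma> u v n x"

definition subtile ::
    "(int \<Rightarrow> 'd::finite list \<Rightarrow> 'd list) \<Rightarrow> real ^ 'd \<Rightarrow> real ^ 'd \<Rightarrow> int \<Rightarrow> 'd \<Rightarrow> (real ^ 'd) set"
  where
  "subtile \<sigma> u v n a =
     closure {proj_v \<sigma> u v n (abelianization p) |p.
       infinite {(m, b). m \<ge> n \<and> prefix (p @ [a]) (block \<sigma> n m [b])}}"

definition rauzy_fractal ::
    "(int \<Rightarrow> 'd::finite list \<Rightarrow> 'd list) \<Rightarrow> real ^ 'd \<Rightarrow> real ^ 'd \<Rightarrow> int \<Rightarrow> (real ^ 'd) set"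
  where
  "rauzy_fractal \<sigma> u v n = (\<Union>a. subtile \<sigma> u v n a)"

definition box_over ::
    "(int \<Rightarrow> 'd::finite list \<Rightarrow> 'd list) \<Rightarrow> real ^ 'd \<Rightarrow> real ^ 'd \<Rightarrow> int \<Rightarrow> 'd \<Rightarrow> (real ^ 'd) set \<Rightarrow>
      (real ^ 'd) set"
  where
  "box_over \<sigma> u v n a R =
     {x - y |x y. x \<in> proj_u \<sigma> u v n ` closed_segment 0 (axis a 1) \<and> y \<in> R}"

definition rauzy_box ::
    "(int \<Rightarrow> 'd::finite list \<Rightarrow> 'd list) \<Rightarrow> real ^ 'd \<Rightarrow> real ^ 'd \<Rightarrow> int \<Rightarrow> 'd \<Rightarrow> (real ^ 'd) set"
  where
  "rauzy_box \<sigma> u v n a = box_over \<sigma> u v n a (subtile \<sigma> u v n a)"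

type_synonym 'd edge = "'d \<times> 'd list \<times> 'd"

definition edges :: "(int \<Rightarrow> 'd list \<Rightarrow> 'd list) \<Rightarrow> int \<Rightarrow> 'd edge set" where
  "edges \<sigma> n = {(a, p, b). prefix (p @ [a]) (\<sigma> n [b])}"

definition src :: "'d edge \<Rightarrow> 'd" where "src = (\<lambda>(a, p, b). a)"
definition rng :: "'d edge \<Rightarrow> 'd" where "rng = (\<lambda>(a, p, b). b)"

definition edge_subtile ::
    "(int \<Rightarrow> 'd::finite list \<Rightarrow> 'd list) \<Rightarrow> real ^ 'd \<Rightarrow> real ^ 'd \<Rightarrow> int \<Rightarrow> 'd edge \<Rightarrow> (real ^ 'd) set"
  where
  "edge_subtile \<sigma> u v n = (\<lambda>(a, p, b).
     (\<lambda>x. proj_v \<sigma> u v n (abelianization p) + incidence (\<sigma> n) *v x) ` subtile \<sigma> u v (n + 1) b)"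

definition edge_box ::
    "(int \<Rightarrow> 'd::finite list \<Rightarrow> 'd list) \<Rightarrow> real ^ 'd \<Rightarrow> real ^ 'd \<Rightarrow> int \<Rightarrow> 'd edge \<Rightarrow> (real ^ 'd) set"
  where
  "edge_box \<sigma> u v n e = box_over \<sigma> u v n (src e) (edge_subtile \<sigma> u v n e)"

definition int_vecs :: "(real ^ 'd) set" where
  "int_vecs = {x. \<forall>i. x $ i \<in> \<int>}"

text \<open>Tiles are counted with their index: two tiles with different indices are different tiles,
  even if they happen to be the same set.\<close>

definition tiles_space :: "'i set \<Rightarrow> ('i \<Rightarrow> (real ^ 'd) set) \<Rightarrow> bool" where
  "tiles_space I T \<longleftrightarrow>
     (\<forall>i\<in>I. closed (T i)) \<and> (\<Union>i\<in>I. T i) = UNIV \<and>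
     (\<forall>i\<in>I. \<forall>j\<in>I. i \<noteq> j \<longrightarrow> T i \<inter> T j \<in> null_sets lebesgue)"

definition tiling_condition ::
    "(int \<Rightarrow> 'd::finite list \<Rightarrow> 'd list) \<Rightarrow> real ^ 'd \<Rightarrow> real ^ 'd \<Rightarrow> bool" where
  "tiling_condition \<sigma> u v \<longleftrightarrow>
     primitive \<sigma> \<and> generalized_right_eigenvector \<sigma> u \<and> generalized_left_eigenvector \<sigma> v \<and>
     (\<forall>n. tiles_space (int_vecs \<times> UNIV) (\<lambda>(x, a). (+) x ` rauzy_box \<sigma> u v n a))"

lemma int_vecs_0 [simp]: "0 \<in> int_vecs"
  by (simp add: int_vecs_def)

lemma int_vecs_add: "x \<in> int_vecs \<Longrightarrow> y \<in> int_vecs \<Longrightarrow> x + y \<in> int_vecs"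
  by (simp add: int_vecs_def)

lemma int_vecs_minus: "x \<in> int_vecs \<Longrightarrow> - x \<in> int_vecs"
  by (simp add: int_vecs_def)

quotient_type (overloaded) 'd torus = "real ^ ('d::finite)" / "\<lambda>x y. x - y \<in> int_vecs"
  morphisms rep_torus abs_torus
proof (rule equivpI)
  show "reflp (\<lambda>x y :: real ^ 'd. x - y \<in> int_vecs)"
    by (simp add: reflp_def)
  show "symp (\<lambda>x y :: real ^ 'd. x - y \<in> int_vecs)"
    by (rule sympI) (metis int_vecs_minus minus_diff_eq)
  show "transp (\<lambda>x y :: real ^ 'd. x - y \<in> int_vecs)"
    by (rule transpI) (metis int_vecs_add diff_add_cancel add_diff_eq)
qed

instantiation torus :: (finite) topological_space
begin

definition open_torus :: "'a torus set \<Rightarrow> bool" where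
  "open_torus U \<longleftrightarrow> open (abs_torus -` U)"

instance
proof
  show "open (UNIV :: 'a torus set)"
    by (simp add: open_torus_def)
  show "open (S \<inter> T)" if "open S" "open T" for S T :: "'a torus set"
    using that by (simp add: open_torus_def open_Int)
  show "open (\<Union>K)" if "\<forall>S\<in>K. open S" for K :: "'a torus set set"
    using that by (auto simp: open_torus_def vimage_Union intro!: open_UN)
qed

end

lemma abs_torus_eq_iff: "abs_torus x = abs_torus y \<longleftrightarrow> x - y \<in> int_vecs"
  using torus.abs_eq_iff by blast

lemma continuous_abs_torus: "continuous_on UNIV abs_torus"
  by (simp add: continuous_on_open_vimage open_torus_def)

definition torus_haar :: "'d::finite torus measure" where
  "torus_haar = distr (restrict_space lborel {x. \<forall>i. 0 \<le> x $ i \<and> x $ i < 1}) borel abs_torus"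

text \<open>The map induced on the torus by a matrix.  It is given by a choice of representatives, which
  is immaterial when the matrix maps integer vectors to integer vectors (\<open>torus_map_abs\<close>).\<close>

definition torus_map :: "real ^ 'd ^ 'd \<Rightarrow> 'd::finite torus \<Rightarrow> 'd torus" where
  "torus_map A x = abs_torus (A *v rep_torus x)"

lemma torus_map_abs:
  assumes "\<And>x. x \<in> int_vecs \<Longrightarrow> A *v x \<in> int_vecs"
  shows "torus_map A (abs_torus x) = abs_torus (A *v x)"
proof -
  have "abs_torus (rep_torus (abs_torus x)) = abs_torus x"
    by (rule Quotient_abs_rep[OF Quotient_torus])
  then have "A *v (rep_torus (abs_torus x) - x) \<in> int_vecs"
    by (intro assms) (simp add: abs_torus_eq_iff)
  then show ?thesis
    by (simp add: torus_map_def abs_torus_eq_iff matrix_vector_mult_diff_distrib)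
qed

text \<open>All spaces of the families considered here are copies of one space \<open>'x\<close>, so their disjoint
  union is the type \<open>int \<times> 'x\<close>.  Its product topology is the disjoint union topology, because \<open>int\<close>
  is discrete.\<close>

definition level :: "int \<Rightarrow> 'x set \<Rightarrow> (int \<times> 'x) set" where
  "level n S = {n} \<times> S"

definition family_map ::
    "(int \<Rightarrow> 'd::finite list \<Rightarrow> 'd list) \<Rightarrow> int \<times> 'd torus \<Rightarrow> int \<times> 'd torus" where
  "family_map \<sigma> = (\<lambda>(n, x). (n + 1, torus_map (matrix_inv (incidence (\<sigma> n))) x))"

lemma inverse_incidence_int_vecs:
  assumes "unimodular_substitution s" "x \<in> int_vecs"
  shows "matrix_inv (incidence s) *v x \<in> int_vecs"
proof -
  let ?M = "incidence s"
  have d: "\<bar>det ?M\<bar> = 1"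
    using assms by (simp add: unimodular_substitution_def)
  then have inv: "invertible ?M"
    by (simp add: invertible_det_nz)
  have "?M ** matrix_inv ?M = mat 1"
    using someI_ex[OF inv[unfolded invertible_def]] by (simp add: matrix_inv_def)
  then have "?M *v (matrix_inv ?M *v x) = x"
    by (simp add: matrix_vector_mul_assoc)
  moreover have "det ?M \<noteq> 0"
    using d by auto
  ultimately have eq: "matrix_inv ?M *v x =
      (\<chi> k. det (\<chi> i j. if j = k then x $ i else ?M $ i $ j) / det ?M)"
    using cramer by blast
  have "det ?M = 1 \<or> det ?M = - 1"
    using d by linarith
  moreover have "det (\<chi> i j. if j = k then x $ i else ?M $ i $ j) \<in> \<int>" for k
    using assms(2) unfolding det_def
    by (intro Ints_sum Ints_mult Ints_prod) (auto simp: int_vecs_def incidence_def)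
  ultimately show ?thesis
    unfolding eq by (auto simp: int_vecs_def)
qed

lemma family_map_abs:
  assumes "unimodular_substitution (\<sigma> n)"
  shows "family_map \<sigma> (n, abs_torus x) =
    (n + 1, abs_torus (matrix_inv (incidence (\<sigma> n)) *v x))"
  by (simp add: family_map_def torus_map_abs inverse_incidence_int_vecs assms)

definition family_haar :: "(int \<times> 'd::finite torus) measure" where
  "family_haar = count_space UNIV \<Otimes>\<^sub>M torus_haar"

text \<open>\<open>pullback f k S\<close> is the preimage of \<open>S\<close> under the \<open>k\<close>-th power of the bijection \<open>f\<close>; for
  negative \<open>k\<close> it is an image under a power of \<open>f\<close>.\<close>

definition pullback :: "('x \<Rightarrow> 'x) \<Rightarrow> int \<Rightarrow> 'x set \<Rightarrow> 'x set" where
  "pullback f k S = (if k \<ge> 0 then (f ^^ nat k) -` S else (f ^^ nat (- k)) ` S)"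

text \<open>The elements of a partition are indexed by a set \<open>I\<close>, which need not be
  \<open>{1, \<dots>, q}\<close>.\<close>

definition topological_partition :: "'x::topological_space set \<Rightarrow> 'i set \<Rightarrow> ('i \<Rightarrow> 'x set) \<Rightarrow> bool"
  where
  "topological_partition X I R \<longleftrightarrow>
     finite I \<and> (\<forall>i\<in>I. openin (top_of_set X) (R i)) \<and> disjoint_family_on R I \<and>
     X \<subseteq> (\<Union>i\<in>I. closure (R i))"

definition markov_partition ::
    "(int \<times> 'x::topological_space \<Rightarrow> int \<times> 'x) \<Rightarrow> (int \<Rightarrow> 'i set) \<Rightarrow>
      (int \<Rightarrow> 'i \<Rightarrow> (int \<times> 'x) set) \<Rightarrow> bool"
  where
  "markov_partition f I R \<longleftrightarrow>
     (\<forall>n. topological_partition (level n UNIV) (I n) (R n)) \<and>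
     (\<forall>i n m. (\<forall>k. i k \<in> I k) \<longrightarrow> m \<ge> 2 \<longrightarrow>
        (\<forall>k\<in>{n..n + m - 1}. R k (i k) \<inter> pullback f 1 (R (k + 1) (i (k + 1))) \<noteq> {}) \<longrightarrow>
        (\<Inter>j\<in>{0..m}. pullback f j (R (n + j) (i (n + j)))) \<noteq> {})"

definition generating ::
    "(int \<times> 'x::topological_space \<Rightarrow> int \<times> 'x) \<Rightarrow> (int \<Rightarrow> 'i set) \<Rightarrow>
      (int \<Rightarrow> 'i \<Rightarrow> (int \<times> 'x) set) \<Rightarrow> bool"
  where
  "generating f I R \<longleftrightarrow>
     (\<forall>i. (\<forall>k. i k \<in> I k) \<longrightarrow>
        (\<forall>x y. {x, y} \<subseteq> (\<Inter>n::nat. closure (\<Inter>k\<in>{k. \<bar>k\<bar> < int n}. pullback f k (R k (i k))))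
           \<longrightarrow> x = y))"

definition open_box ::
    "(int \<Rightarrow> 'd::finite list \<Rightarrow> 'd list) \<Rightarrow> real ^ 'd \<Rightarrow> real ^ 'd \<Rightarrow> int \<Rightarrow> 'd edge \<Rightarrow>
      (int \<times> 'd torus) set"
  where
  "open_box \<sigma> u v n e = level n (abs_torus ` interior (edge_box \<sigma> u v n e))"

definition box_boundary ::
    "(int \<Rightarrow> 'd::finite list \<Rightarrow> 'd list) \<Rightarrow> real ^ 'd \<Rightarrow> real ^ 'd \<Rightarrow> int \<Rightarrow> 'd edge \<Rightarrow>
      (int \<times> 'd torus) set"
  where
  "box_boundary \<sigma> u v n e = level n (abs_torus ` frontier (edge_box \<sigma> u v n e))"

definition boundary_pullbacks ::
    "(int \<Rightarrow> 'd::finite list \<Rightarrow> 'd list) \<Rightarrow> real ^ 'd \<Rightarrow> real ^ 'd \<Rightarrow> (int \<times> 'd torus) set" where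
  "boundary_pullbacks \<sigma> u v =
     (\<Union>j. \<Union>k. \<Union>e\<in>edges \<sigma> k. pullback (family_map \<sigma>) j (box_boundary \<sigma> u v k e))"

definition paths :: "(int \<Rightarrow> 'd list \<Rightarrow> 'd list) \<Rightarrow> int \<Rightarrow> (int \<Rightarrow> 'd edge) set" where
  "paths \<sigma> n = {e. \<forall>k. e k \<in> edges \<sigma> (n + k) \<and> rng (e k) = src (e (k + 1))}"

definition path_topology :: "(int \<Rightarrow> 'd list \<Rightarrow> 'd list) \<Rightarrow> int \<Rightarrow> (int \<Rightarrow> 'd edge) topology" where
  "path_topology \<sigma> n =
     subtopology (product_topology (\<lambda>k. discrete_topology (edges \<sigma> (n + k))) UNIV) (paths \<sigma> n)"

definition edge_shift_topology ::
    "(int \<Rightarrow> 'd list \<Rightarrow> 'd list) \<Rightarrow> (int \<times> (int \<Rightarrow> 'd edge)) topology" where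
  "edge_shift_topology \<sigma> = sum_topology (path_topology \<sigma>) UNIV"

definition left_shift :: "(int \<Rightarrow> 'd edge) \<Rightarrow> int \<Rightarrow> 'd edge" where
  "left_shift e = (\<lambda>k. e (k + 1))"

definition edge_shift :: "int \<times> (int \<Rightarrow> 'd edge) \<Rightarrow> int \<times> (int \<Rightarrow> 'd edge)" where
  "edge_shift = (\<lambda>(n, e). (n + 1, left_shift e))"

definition cylinder_limit ::
    "(int \<Rightarrow> 'd::finite list \<Rightarrow> 'd list) \<Rightarrow> real ^ 'd \<Rightarrow> real ^ 'd \<Rightarrow> int \<Rightarrow> (int \<Rightarrow> 'd edge) \<Rightarrow>
      (int \<times> 'd torus) set"
  where
  "cylinder_limit \<sigma> u v n e =
     (\<Inter>l::nat. closure (\<Inter>k\<in>{k. \<bar>k\<bar> \<le> int l}.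
        pullback (family_map \<sigma>) k (open_box \<sigma> u v (n + k) (e k))))"

definition coding ::
    "(int \<Rightarrow> 'd::finite list \<Rightarrow> 'd list) \<Rightarrow> real ^ 'd \<Rightarrow> real ^ 'd \<Rightarrow> int \<Rightarrow> (int \<Rightarrow> 'd edge) \<Rightarrow>
      int \<times> 'd torus"
  where
  "coding \<sigma> u v n e = (THE x. cylinder_limit \<sigma> u v n e = {x})"

definition full_coding ::
    "(int \<Rightarrow> 'd::finite list \<Rightarrow> 'd list) \<Rightarrow> real ^ 'd \<Rightarrow> real ^ 'd \<Rightarrow>
      int \<times> (int \<Rightarrow> 'd edge) \<Rightarrow> int \<times> 'd torus"
  where
  "full_coding \<sigma> u v = (\<lambda>(n, e). coding \<sigma> u v n e)"

definition measure_preserving :: "'a measure \<Rightarrow> 'b measure \<Rightarrow> ('a \<Rightarrow> 'b) \<Rightarrow> bool" where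
  "measure_preserving M N f \<longleftrightarrow> f \<in> M \<rightarrow>\<^sub>M N \<and> distr M N f = N"

definition measurable_conjugacy ::
    "'a measure \<Rightarrow> ('a \<Rightarrow> 'a) \<Rightarrow> 'b measure \<Rightarrow> ('b \<Rightarrow> 'b) \<Rightarrow> ('a \<Rightarrow> 'b) \<Rightarrow> bool" where
  "measurable_conjugacy M S N T h \<longleftrightarrow>
     measure_preserving M M S \<and> measure_preserving N N T \<and> measure_preserving M N h \<and>
     (\<forall>x\<in>space M. h (S x) = T (h x)) \<and>
     (\<exists>A\<in>null_sets M. \<exists>B\<in>null_sets N.
        bij_betw h (space M - A) (space N - B) \<and>
        the_inv_into (space M - A) h \<in> restrict_space N (space N - B) \<rightarrow>\<^sub>M M)"

end

theory Submission
  imports Defs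
begin

text \<open>Let \<open>u\<^sub>n\<close>, \<open>v\<^sub>n\<close> be the right and left eigenvectors.  The box of a letter \<open>a\<close> is the product
  of an interval of heights \<open>\<langle>z, v\<^sub>n\<rangle>\<close> with a cylinder over the subtile of \<open>a\<close>, and an edge
  \<open>(a, p, b)\<close> acts by the affine map \<open>z \<mapsto> M\<^sub>n\<^sup>-\<^sup>1 (z + l(p))\<close>, which cuts the box of \<open>b\<close> at the next level
  into horizontal slabs.  Hence the edge boxes tile as well, a point whose orbit meets the open boxes of
  two consecutive edges lifts uniquely, and along a chain of edges the heights constrain only the
  first box and the cylinder only the last one: this gives the Markov property.

  The partition is generating once the cylinders shrink.  Heights shrink because \<open>v\<^sub>n\<close> tends to 0 as
  \<open>n\<close> tends to \<open>-\<infinity>\<close>, by two-sided primitivity.  Horizontally one needs that the images of the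
  subtiles of level \<open>m\<close> in level \<open>n\<close> tend to 0.  In each coordinate the convex hulls of
  these images, nested by primitivity, have a common limit length.  If they did not all lie at
  nearly the same place, the side of a gap between them on which a letter lies would define a coboundary
  that is bounded on all words; the rational independence of \<open>u\<^sub>n\<close>, itself a consequence of the
  tiling, excludes this.

  Boundaries of boxes are null because they lie in intersections of two tiles, so the coding
  has an inverse almost everywhere, which carries Haar measure to the required measure on paths.\<close>

section \<open>Substitutions, incidence matrices and eigenvectors\<close>

text \<open>The Markov part has only forward primitivity at its disposal. The left vectors may then
  have zero entries and boxes may be flat, so cylinders are shown to have interior points separately
  from boxes, and the one height that has to be positive is read off the assumed nonempty
  intersections. All geometry takes place in \<open>real ^ 'd\<close> rather than on the torus: an
  itinerary fixes the integer translations of a lift of the whole orbit, and upstairs distances and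
  compactness are available. The obstacle to generation is that each Rauzy fractal is compact but
  nothing bounds them uniformly in the level. The limit length of the hulls is not shown to vanish
  directly. Near equality of the lengths makes the lower end of a subtile determine the displacement
  of every prefix up to a small error; a small spread of the lower ends then bounds all
  displacements, and subtiles are closures of sets of displacements.\<close>

lemma abelianization_append: "abelianization (v @ w) = abelianization v + abelianization w"
  by (simp add: abelianization_def vec_eq_iff)

lemma abelianization_Nil [simp]: "abelianization [] = 0"
  by (simp add: abelianization_def vec_eq_iff)

lemma abelianization_single: "abelianization [a] = axis a 1"
  by (auto simp add: abelianization_def vec_eq_iff axis_def)

lemma abelianization_Cons: "abelianization (a # w) = axis a 1 + abelianization w"
  using abelianization_append[of "[a]" w] by (simp add: abelianization_single)

lemma abelianization_int_vecs: "abelianization p \<in> int_vecs"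
  by (simp add: abelianization_def int_vecs_def)

lemma abelianization_nonneg: "0 \<le> abelianization p $ i"
  by (simp add: abelianization_def)

lemma int_vecs_diff: "x \<in> int_vecs \<Longrightarrow> y \<in> int_vecs \<Longrightarrow> x - y \<in> int_vecs"
  by (simp add: int_vecs_def)

lemma incidence_column: "incidence s *v axis b 1 = abelianization (s [b])"
  by (simp add: matrix_vector_mult_basis column_def incidence_def abelianization_def)

lemma incidence_id: "incidence id = mat 1"
  by (auto simp: incidence_def mat_def vec_eq_iff)

lemma substitution_Nil: "substitution s \<Longrightarrow> s [] = []"
  unfolding substitution_def by (metis append_self_conv append_Nil)

lemma substitution_append: "substitution s \<Longrightarrow> s (v @ w) = s v @ s w"
  by (simp add: substitution_def)

lemma substitution_id: "substitution id"
  by (simp add: substitution_def)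

lemma substitution_eq_Nil_iff:
  assumes "substitution s"
  shows "s w = [] \<longleftrightarrow> w = []"
proof (cases w)
  case (Cons a w')
  then have "s w = s [a] @ s w'"
    using substitution_append[OF assms, of "[a]" w'] by simp
  then show ?thesis using assms Cons by (simp add: substitution_def)
qed (simp add: substitution_Nil assms)

lemma substitution_comp: "substitution s \<Longrightarrow> substitution t \<Longrightarrow> substitution (s \<circ> t)"
  using substitution_eq_Nil_iff[of s] by (auto simp: substitution_def)

lemma abelianization_substitution:
  assumes "substitution s"
  shows "abelianization (s w) = incidence s *v abelianization w"
proof (induction w)
  case Nil
  then show ?case using assms by (simp add: substitution_Nil)
next
  case (Cons a w)
  have "s (a # w) = s [a] @ s w"
    using substitution_append[OF assms, of "[a]" w] by simp
  then show ?case using Cons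
    by (simp add: abelianization_append abelianization_Cons incidence_column
        matrix_vector_right_distrib)
qed

lemma incidence_comp:
  assumes "substitution s" "substitution t"
  shows "incidence (s \<circ> t) = incidence s ** incidence t"
proof -
  have "incidence (s \<circ> t) *v axis b 1 = (incidence s ** incidence t) *v axis b 1" for b
    using assms
    by (simp add: incidence_column abelianization_substitution flip: matrix_vector_mul_assoc)
  then have "column b (incidence (s \<circ> t)) = column b (incidence s ** incidence t)" for b
    by (simp add: matrix_vector_mult_basis)
  then show ?thesis
    by (simp add: column_def vec_eq_iff)
qed

lemma incidence_int_vecs:
  assumes "x \<in> int_vecs"
  shows "incidence s *v x \<in> int_vecs"
  using assms by (auto simp: int_vecs_def matrix_vector_mult_def incidence_def intro!: Ints_sum Ints_mult)

lemma incidence_cone: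
  assumes "x \<in> nonneg_cone"
  shows "incidence s *v x \<in> nonneg_cone"
  using assms by (auto simp: nonneg_cone_def matrix_vector_mult_def incidence_def intro!: sum_nonneg)

lemma transpose_incidence_cone:
  assumes "x \<in> nonneg_cone"
  shows "transpose (incidence s) *v x \<in> nonneg_cone"
  using assms by (auto simp: nonneg_cone_def matrix_vector_mult_def incidence_def transpose_def intro!: sum_nonneg)

lemma matrix_inv_mult:
  fixes A :: "'a::semiring_1^'n^'m"
  assumes "invertible A"
  shows "A ** matrix_inv A = mat 1" "matrix_inv A ** A = mat 1"
  using someI_ex[OF assms[unfolded invertible_def]] by (simp_all add: matrix_inv_def)

lemma matrix_inv_vector:
  fixes A :: "real^'n^'n"
  assumes "invertible A"
  shows "A *v (matrix_inv A *v x) = x" "matrix_inv A *v (A *v x) = x"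
  by (simp_all add: matrix_vector_mul_assoc matrix_inv_mult assms)

lemma invertible_transpose: "invertible (transpose A) \<longleftrightarrow> invertible A" for A :: "real^'n^'n"
  by (simp add: invertible_det_nz)

lemma block_refl: "n \<le> m \<Longrightarrow> block \<sigma> m n = id"
  by (simp add: block_def)

lemma block_rec: "m < n \<Longrightarrow> block \<sigma> m n = \<sigma> m \<circ> block \<sigma> (m + 1) n"
  by (simp add: block_def upto_rec1)

lemma block_split:
  assumes "m \<le> n" "n \<le> k"
  shows "block \<sigma> m k = block \<sigma> m n \<circ> block \<sigma> n k"
  using assms
proof (induction m rule: int_le_induct)
  case base
  then show ?case by (simp add: block_refl)
next
  case (step i)
  then show ?case by (simp add: block_rec[of "i - 1"] comp_assoc)
qed

lemma block_single: "block \<sigma> m (m + 1) = \<sigma> m"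
  by (simp add: block_rec block_refl)

lemma block_substitution:
  assumes "\<And>k. substitution (\<sigma> k)"
  shows "substitution (block \<sigma> m n)"
proof (cases "m \<le> n")
  case True
  then show ?thesis
  proof (induction m rule: int_le_induct)
    case base
    then show ?case by (metis block_refl order_refl substitution_id)
  next
    case (step i)
    then have "block \<sigma> (i - 1) n = \<sigma> (i - 1) \<circ> block \<sigma> i n"
      using block_rec[of "i - 1" n] by simp
    then show ?case using step substitution_comp[OF assms] by metis
  qed
qed (metis block_refl linear substitution_id)

locale rauzy_tiling =
  fixes \<sigma> :: "int \<Rightarrow> 'd::finite list \<Rightarrow> 'd list" and u v :: "real ^ 'd"
  assumes two_letters: "CARD('d) \<ge> 2"
    and unimodular: "\<And>n. unimodular_substitution (\<sigma> n)"
    and tiling: "tiling_condition \<sigma> u v"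
    and compact_fractal: "\<And>n. compact (rauzy_fractal \<sigma> u v n)"
begin

abbreviation "M n \<equiv> incidence (\<sigma> n)"
abbreviation "B m n \<equiv> incidence (block \<sigma> m n)"
abbreviation "N n \<equiv> matrix_inv (M n)"
abbreviation "U \<equiv> right_vec \<sigma> u"
abbreviation "W \<equiv> left_vec \<sigma> v"
abbreviation "P \<equiv> proj_v \<sigma> u v"

lemma subst: "substitution (\<sigma> n)"
  using unimodular by (simp add: unimodular_substitution_def)

lemma subst_block: "substitution (block \<sigma> m n)"
  by (simp add: block_substitution subst)

lemma invertible_M: "invertible (M n)"
  using unimodular[of n] by (auto simp: unimodular_substitution_def invertible_det_nz)

lemma B_refl: "n \<le> m \<Longrightarrow> B m n = mat 1"
  by (simp add: block_refl incidence_id)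

lemma B_split: "m \<le> n \<Longrightarrow> n \<le> k \<Longrightarrow> B m k = B m n ** B n k"
  by (metis block_split incidence_comp subst_block)

lemma B_rec: "m < n \<Longrightarrow> B m n = M m ** B (m + 1) n"
  by (metis block_rec incidence_comp subst_block subst)

lemma B_rec': "m \<le> n \<Longrightarrow> B m (n + 1) = B m n ** M n"
  using B_split[of m n "n + 1"] by (simp add: block_single)

lemma invertible_B: "invertible (B m n)"
proof (cases "m \<le> n")
  case True
  then show ?thesis
  proof (induction m rule: int_le_induct)
    case base
    then show ?case by (auto simp: B_refl invertible_def intro!: exI[of _ "mat 1"])
  next
    case (step i)
    then show ?case
      by (simp add: B_rec[of "i - 1"] invertible_mult invertible_M)
  qed
qed (auto simp: B_refl invertible_def intro!: exI[of _ "mat 1"])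

lemma inj_M: "M n *v x = M n *v y \<longleftrightarrow> x = y"
  by (metis matrix_inv_vector(2)[OF invertible_M])

lemma inj_B: "B m n *v x = B m n *v y \<longleftrightarrow> x = y"
  by (metis matrix_inv_vector(2)[OF invertible_B])

lemma N_int_vecs: "x \<in> int_vecs \<Longrightarrow> N n *v x \<in> int_vecs"
  by (rule inverse_incidence_int_vecs[OF unimodular])

lemma prim: "primitive \<sigma>"
  and gre: "generalized_right_eigenvector \<sigma> u"
  and gle: "generalized_left_eigenvector \<sigma> v"
  and tiles: "tiles_space (int_vecs \<times> UNIV) (\<lambda>(x, a). (+) x ` rauzy_box \<sigma> u v n a)"
  using tiling by (auto simp: tiling_condition_def)

section \<open>Eigenvectors and projections at all levels\<close>

lemma B_U0:
  assumes "n \<ge> 0"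
  shows "B 0 n *v U n = u"
  using assms by (simp add: right_vec_def matrix_inv_vector[OF invertible_B])

text \<open>One recursion replaces the definition of \<open>right_vec\<close>, which is split at
  level 0; its iterate is \<open>U_B\<close>. \<open>W_step\<close> and \<open>W_B\<close> do the
  same for the left vectors.\<close>

lemma U_step: "M n *v U (n + 1) = U n"
proof -
  consider "n \<ge> 0" | "n < 0" by linarith
  then show ?thesis
  proof cases
    case 1
    have "B 0 n *v (M n *v U (n + 1)) = B 0 n *v U n"
      using B_U0[of n] B_U0[of "n + 1"] 1 by (simp add: matrix_vector_mul_assoc flip: B_rec')
    then show ?thesis by (simp add: inj_B)
  next
    case 2
    have "U (n + 1) = B (n + 1) 0 *v u"
      using 2 B_U0[of 0] by (cases "n = - 1") (auto simp: right_vec_def B_refl)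
    then show ?thesis using 2 by (simp add: right_vec_def matrix_vector_mul_assoc flip: B_rec)
  qed
qed

lemma transpose_inj: "invertible A \<Longrightarrow> transpose A *v x = transpose A *v y \<longleftrightarrow> x = y" for A :: "real^'n^'n"
  by (metis matrix_inv_vector(2) invertible_transpose)

lemma W_step: "transpose (M n) *v W n = W (n + 1)"
proof -
  have *: "transpose (B n 0) *v W n = v" if "n \<le> 0" for n
    using that matrix_inv_vector(1)[of "transpose (B n 0)" v]
    by (cases "n = 0") (simp_all add: left_vec_def invertible_B invertible_transpose B_refl transpose_mat)
  consider "n \<ge> 0" | "n < 0" by linarith
  then show ?thesis
  proof cases
    case 1
    then show ?thesis
      by (simp add: left_vec_def B_rec' matrix_transpose_mul flip: matrix_vector_mul_assoc)
  next
    case 2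
    have "transpose (B (n + 1) 0) *v (transpose (M n) *v W n) = transpose (B (n + 1) 0) *v W (n + 1)"
      using *[of n] *[of "n + 1"] 2
      by (simp add: B_rec[of n] matrix_transpose_mul flip: matrix_vector_mul_assoc)
    then show ?thesis by (simp only: transpose_inj[OF invertible_B])
  qed
qed

lemma W_M: "(M n *v x) \<bullet> W n = x \<bullet> W (n + 1)"
  by (metis W_step dot_lmul_matrix inner_commute matrix_vector_mul_lid transpose_matrix_vector)

lemma W_N: "(N n *v x) \<bullet> W (n + 1) = x \<bullet> W n"
  by (simp add: matrix_inv_vector[OF invertible_M] flip: W_M)

lemma U_B: "m \<le> n \<Longrightarrow> B m n *v U n = U m"
proof (induction m rule: int_le_induct)
  case base
  then show ?case by (simp add: B_refl)
next
  case (step i)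
  then show ?case using U_step[of "i - 1"]
    by (simp add: B_rec[of "i - 1"] flip: matrix_vector_mul_assoc)
qed

lemma W_B: "m \<le> n \<Longrightarrow> (B m n *v x) \<bullet> W m = x \<bullet> W n"
proof (induction m rule: int_le_induct)
  case base
  then show ?case by (simp add: B_refl)
next
  case (step i)
  then show ?case using W_M[of "i - 1"]
    by (simp add: B_rec[of "i - 1"] flip: matrix_vector_mul_assoc)
qed

lemma N_U: "N n *v U n = U (n + 1)"
  by (metis U_step matrix_inv_vector(2)[OF invertible_M])

text \<open>For levels above 0 nonnegativity cannot be seen from the inverse matrix. It holds
  because \<open>u\<close> lies in every nested cone and injectivity of \<open>B 0 n\<close>
  identifies its preimage in the cone with \<open>U n\<close>.\<close>

lemma U_cone: "U n \<in> nonneg_cone"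
proof -
  have u: "u \<in> (\<Inter>n::nat. (*v) (B 0 (int n)) ` nonneg_cone)"
    using gre unfolding generalized_right_eigenvector_def
    by (auto intro!: exI[of _ "1::real"] simp: set_eq_iff)
  show ?thesis
  proof (cases "n \<ge> 0")
    case True
    obtain x where "x \<in> nonneg_cone" "u = B 0 n *v x"
      using INT_D[OF u, of "nat n"] True by auto
    then show ?thesis
      using B_U0[OF True] inj_B by metis
  next
    case False
    then show ?thesis using gre
      by (auto simp: right_vec_def generalized_right_eigenvector_def intro: incidence_cone)
  qed
qed

lemma W_cone: "W n \<in> nonneg_cone"
proof -
  have v: "v \<in> (\<Inter>n::nat. (*v) (transpose (B (- int n) 0)) ` nonneg_cone)"
    using gle unfolding generalized_left_eigenvector_def
    by (auto intro!: exI[of _ "1::real"] simp: set_eq_iff)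
  show ?thesis
  proof (cases "n < 0")
    case True
    obtain x where x: "x \<in> nonneg_cone" "v = transpose (B n 0) *v x"
      using INT_D[OF v, of "nat (- n)"] True by auto
    have "W n = x"
      using True x matrix_inv_vector(2)[of "transpose (B n 0)" x]
      by (simp add: left_vec_def invertible_B invertible_transpose)
    then show ?thesis
      using x by simp
  next
    case False
    then show ?thesis using gle
      by (auto simp: left_vec_def generalized_left_eigenvector_def
          intro!: transpose_incidence_cone simp del: transpose_matrix_vector)
  qed
qed

lemma W_nonneg: "0 \<le> W n $ a" and U_nonneg: "0 \<le> U n $ a"
  using W_cone[of n] U_cone[of n] by (auto simp: nonneg_cone_def)

lemma U_nonzero: "U n \<noteq> 0"
proof -
  have u: "u \<noteq> 0" using gre by (simp add: generalized_right_eigenvector_def)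
  have "U 0 = u" using B_U0[of 0] by (simp add: B_refl)
  then show ?thesis
    using u U_B[of 0 n] U_B[of n 0] inj_B[of n 0 u 0]
    by (cases "n \<ge> 0") auto
qed

lemma W_nonzero: "W n \<noteq> 0"
proof
  assume *: "W n = 0"
  have v: "v \<noteq> 0" using gle by (simp add: generalized_left_eigenvector_def)
  have 0: "W 0 = v" by (simp add: left_vec_def B_refl transpose_mat)
  have "x \<bullet> W 0 = 0" for x
  proof (cases "n \<le> 0")
    case True
    then show ?thesis using W_B[of n 0 x] * by simp
  next
    case False
    then show ?thesis
      using W_B[of 0 n "matrix_inv (B 0 n) *v x"] * by (simp add: matrix_inv_vector[OF invertible_B])
  qed
  then show False using 0 v by (metis inner_eq_zero_iff)
qed

text \<open>Forward primitivity makes \<open>U n\<close> the image of a nonzero nonnegative vector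
  under a positive matrix. The analogue for \<open>W\<close> uses positive blocks ending at
  \<open>n\<close>, available under two-sided primitivity (\<open>W_pos\<close>).\<close>

lemma U_pos: "0 < U n $ a"
proof -
  obtain m where m: "m > n" "positive_matrix (B n m)"
    using prim by (auto simp: primitive_def)
  obtain b where b: "U m $ b \<noteq> 0"
    using U_nonzero[of m] by (auto simp: vec_eq_iff)
  then have b': "0 < U m $ b" using U_nonneg[of m b] by simp
  have "U n $ a = (\<Sum>i\<in>UNIV. B n m $ a $ i * U m $ i)"
    using U_B[of n m] m by (simp add: matrix_vector_mult_def vec_eq_iff)
  also have "\<dots> > 0"
    using m(2) U_nonneg[of m] b'
    by (intro sum_pos2[of _ b]) (auto simp: positive_matrix_def intro: mult_nonneg_nonneg less_imp_le)
  finally show ?thesis .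
qed

lemma UW_pos: "0 < U n \<bullet> W n"
proof -
  obtain b where b: "W n $ b \<noteq> 0"
    using W_nonzero[of n] by (auto simp: vec_eq_iff)
  then have b': "0 < W n $ b" using W_nonneg[of n b] by simp
  show ?thesis unfolding inner_vec_def
    using b' W_nonneg[of n] U_pos[of n] by (intro sum_pos2[of _ b]) (auto intro: mult_nonneg_nonneg less_imp_le)
qed

lemma UW_const: "U (n + 1) \<bullet> W (n + 1) = U n \<bullet> W n"
  by (metis U_step W_M)

lemma W_abelianization_nonneg: "0 \<le> abelianization p \<bullet> W n"
  by (auto simp: inner_vec_def intro!: sum_nonneg mult_nonneg_nonneg abelianization_nonneg W_nonneg)

lemma axis_W: "axis a 1 \<bullet> W n = W n $ a"
  by (simp add: inner_axis')

lemma W_block: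
  assumes "n \<le> m" "block \<sigma> n m [b] = w"
  shows "W m $ b = abelianization w \<bullet> W n"
  using W_B[OF assms(1), of "axis b 1"] assms(2) by (simp add: incidence_column axis_W)

lemma proj_eq: "P n x = x - ((x \<bullet> W n) / (U n \<bullet> W n)) *\<^sub>R U n"
  by (simp add: proj_v_def proj_u_def)

lemma P_height [simp]: "P n x \<bullet> W n = 0"
  using UW_pos[of n] by (simp add: proj_eq inner_diff_left)

lemma P_add: "P n (x + y) = P n x + P n y"
  by (simp add: proj_eq inner_add_left add_divide_distrib scaleR_left_distrib)

lemma P_diff: "P n (x - y) = P n x - P n y"
  by (simp add: proj_eq inner_diff_left diff_divide_distrib scaleR_left_diff_distrib)

lemma P_scaleR_U [simp]: "P n (t *\<^sub>R U n) = 0"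
  using UW_pos[of n] by (simp add: proj_eq)

lemma P_of_height_0: "x \<bullet> W n = 0 \<Longrightarrow> P n x = x"
  by (simp add: proj_eq)

text \<open>\<open>M n\<close> carries the line of \<open>U (n + 1)\<close> to that of
  \<open>U n\<close> and pulls the functional of \<open>W n\<close> back to that of
  \<open>W (n + 1)\<close>; by \<open>UW_const\<close> the normalizations agree, so it intertwines
  the projections.\<close>

lemma P_M: "M n *v P (n + 1) x = P n (M n *v x)"
  by (simp add: proj_eq matrix_vector_mult_diff_distrib matrix_vector_mult_scaleR U_step W_M UW_const)

lemma P_B: "n \<le> m \<Longrightarrow> B n m *v P m x = P n (B n m *v x)"
proof (induction n rule: int_le_induct)
  case base
  then show ?case by (simp add: B_refl)
next
  case (step i)
  then show ?case using P_M[of "i - 1"]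
    by (simp add: B_rec[of "i - 1"] flip: matrix_vector_mul_assoc)
qed

end

lemma matrix_vector_minus: "A *v (- x) = - (A *v x)" for A :: "real^'n^'m"
  using matrix_vector_mult_scaleR[of A "- 1" x] by simp

section \<open>Boxes as products\<close>

definition edge_label :: "'d edge \<Rightarrow> 'd list" where "edge_label = (\<lambda>(a, p, b). p)"

context rauzy_tiling
begin

abbreviation "R \<equiv> subtile \<sigma> u v"

text \<open>A lift of the family map: \<open>N n\<close> followed by an integer translation, so it
  induces \<open>F\<close> for every word \<open>p\<close> (\<open>F_tau\<close>).\<close>

definition tau :: "int \<Rightarrow> 'd list \<Rightarrow> real ^ 'd \<Rightarrow> real ^ 'd" where
  "tau n p z = N n *v (z + abelianization p)"

definition strip :: "int \<Rightarrow> 'd \<Rightarrow> (real ^ 'd) set" where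
  "strip n a = {z. 0 \<le> z \<bullet> W n \<and> z \<bullet> W n \<le> W n $ a}"

definition open_strip :: "int \<Rightarrow> 'd \<Rightarrow> (real ^ 'd) set" where
  "open_strip n a = {z. 0 < z \<bullet> W n \<and> z \<bullet> W n < W n $ a}"

text \<open>The sign matches the difference \<open>x - y\<close> in \<open>box_over\<close>. The set
  is invariant under translation along \<open>U n\<close>, so it carries no condition on
  heights.\<close>

definition cyl :: "int \<Rightarrow> 'd \<Rightarrow> (real ^ 'd) set" where
  "cyl n a = {z. - P n z \<in> R n a}"

text \<open>Taken as a preimage under \<open>tau\<close> so that transport along an edge is
  immediate; \<open>edge_cyl_eq\<close> recovers the cylinder over
  \<open>edge_subtile\<close>.\<close>

definition edge_cyl :: "int \<Rightarrow> 'd edge \<Rightarrow> (real ^ 'd) set" where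
  "edge_cyl n e = tau n (edge_label e) -` cyl (n + 1) (rng e)"

abbreviation "rbox n a \<equiv> rauzy_box \<sigma> u v n a"
abbreviation "ebox n e \<equiv> edge_box \<sigma> u v n e"

lemma R_compact: "compact (R n a)"
proof -
  have "R n a \<inter> rauzy_fractal \<sigma> u v n = R n a"
    by (auto simp: rauzy_fractal_def)
  moreover have "closed (R n a)" by (simp add: subtile_def)
  ultimately show ?thesis
    using closed_Int_compact[OF _ compact_fractal[of n]] by metis
qed

lemma R_height:
  assumes "y \<in> R n a"
  shows "y \<bullet> W n = 0"
proof -
  have "closed {y. y \<bullet> W n = 0}"
    using closed_hyperplane[of "W n" 0] by (simp add: inner_commute)
  then have "R n a \<subseteq> {y. y \<bullet> W n = 0}"
    unfolding subtile_def by (intro closure_minimal) auto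
  then show ?thesis using assms by auto
qed

text \<open>If \<open>b\<close> follows \<open>q\<close> in a block starting at level
  \<open>m\<close>, then \<open>a\<close> follows \<open>block \<sigma> n m q @ p\<close> in the
  block starting at level \<open>n\<close> with the same end, so infinitely many occurrences
  persist; continuity handles the closure. This is the easy inclusion in the set equation of the
  subtiles.\<close>

lemma R_block:
  assumes "n \<le> m" "prefix (p @ [a]) (block \<sigma> n m [b])" "y \<in> R m b"
  shows "P n (abelianization p) + B n m *v y \<in> R n a"
proof -
  let ?S = "{P m (abelianization q) |q. infinite {(k, c). m \<le> k \<and> prefix (q @ [b]) (block \<sigma> m k [c])}}"
  let ?f = "\<lambda>y. P n (abelianization p) + B n m *v y"
  have "?f ` closure ?S \<subseteq> R n a"
  proof (rule image_closure_subset)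
    show "continuous_on (closure ?S) ?f"
      by (intro continuous_intros matrix_vector_mult_linear_continuous_on)
    show "closed (R n a)" by (simp add: subtile_def)
    show "?f ` ?S \<subseteq> R n a"
    proof clarify
      fix q assume q: "infinite {(k, c). m \<le> k \<and> prefix (q @ [b]) (block \<sigma> m k [c])}"
      let ?r = "block \<sigma> n m q @ p"
      have "prefix (?r @ [a]) (block \<sigma> n k [c])"
        if "m \<le> k" "prefix (q @ [b]) (block \<sigma> m k [c])" for k c
      proof -
        obtain s where "block \<sigma> m k [c] = q @ [b] @ s"
          using \<open>prefix (q @ [b]) _\<close> by (auto elim: prefixE)
        then have "block \<sigma> n k [c] = block \<sigma> n m q @ block \<sigma> n m [b] @ block \<sigma> n m s"
          using block_split[OF \<open>n \<le> m\<close> \<open>m \<le> k\<close>, of \<sigma>]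
          by (simp add: substitution_append[OF subst_block, symmetric])
        then show ?thesis using assms(2) by (auto simp: prefix_def)
      qed
      then have "{(k, c). m \<le> k \<and> prefix (q @ [b]) (block \<sigma> m k [c])}
          \<subseteq> {(k, c). n \<le> k \<and> prefix (?r @ [a]) (block \<sigma> n k [c])}"
        using assms(1) by (auto simp del: append_assoc)
      then have "infinite {(k, c). n \<le> k \<and> prefix (?r @ [a]) (block \<sigma> n k [c])}"
        using q infinite_super by blast
      then have "P n (abelianization ?r) \<in> R n a"
        unfolding subtile_def by (intro subsetD[OF closure_subset]) blast
      then show "P n (abelianization p) + B n m *v P m (abelianization q) \<in> R n a"
        by (simp add: P_B[OF assms(1)] abelianization_append P_add add.commute
            abelianization_substitution[OF subst_block])
    qed
  qed
  then show ?thesis using assms(3) unfolding subtile_def by auto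
qed

lemma cyl_block:
  assumes "n \<le> m" "prefix (p @ [a]) (block \<sigma> n m [b])" "w \<in> cyl m b"
    and "B n m *v w = z + abelianization p"
  shows "z \<in> cyl n a"
proof -
  have "P n (abelianization p) + B n m *v (- P m w) \<in> R n a"
    using assms by (intro R_block) (auto simp: cyl_def)
  moreover have "B n m *v (- P m w) = - P n z - P n (abelianization p)"
    using assms(4) P_B[OF assms(1), of w] by (simp add: P_add matrix_vector_minus)
  ultimately show ?thesis by (simp add: cyl_def)
qed

lemma edges_iff: "e \<in> edges \<sigma> n \<longleftrightarrow> prefix (edge_label e @ [src e]) (\<sigma> n [rng e])"
  by (cases e) (simp add: edges_def edge_label_def src_def rng_def)

lemma M_tau: "M n *v tau n p z = z + abelianization p"
  by (simp add: tau_def matrix_inv_vector[OF invertible_M])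

lemma edge_cyl_subset:
  assumes "e \<in> edges \<sigma> n"
  shows "edge_cyl n e \<subseteq> cyl n (src e)"
proof
  fix z assume "z \<in> edge_cyl n e"
  then show "z \<in> cyl n (src e)"
    using assms unfolding edge_cyl_def edges_iff
    by (intro cyl_block[of n "n + 1" "edge_label e" _ "rng e" "tau n (edge_label e) z"])
      (auto simp: block_single M_tau)
qed

text \<open>Height and projection along \<open>U n\<close> are independent coordinates, and in them
  the Minkowski difference of a vertical segment and a horizontal set is a product.\<close>

lemma box_over_eq:
  assumes "\<And>y. y \<in> S \<Longrightarrow> y \<bullet> W n = 0"
  shows "box_over \<sigma> u v n a S = {z. 0 \<le> z \<bullet> W n \<and> z \<bullet> W n \<le> W n $ a \<and> - P n z \<in> S}"
proof (intro set_eqI iffI)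
  let ?k = "U n \<bullet> W n"
  fix z assume "z \<in> box_over \<sigma> u v n a S"
  then obtain t y where t: "0 \<le> t" "t \<le> 1" and y: "y \<in> S"
    and z: "z = ((t * W n $ a) / ?k) *\<^sub>R U n - y"
    by (auto simp: box_over_def closed_segment_def proj_u_def axis_W)
  have "z \<bullet> W n = t * W n $ a"
    using UW_pos[of n] assms[OF y] by (simp add: z inner_diff_left)
  moreover have "P n z = - y"
    by (simp add: z P_diff P_of_height_0[OF assms[OF y]])
  ultimately show "z \<in> {z. 0 \<le> z \<bullet> W n \<and> z \<bullet> W n \<le> W n $ a \<and> - P n z \<in> S}"
    using t y W_nonneg[of n a] by (simp add: mult_left_le_one_le)
next
  let ?k = "U n \<bullet> W n"
  fix z assume "z \<in> {z. 0 \<le> z \<bullet> W n \<and> z \<bullet> W n \<le> W n $ a \<and> - P n z \<in> S}"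
  then have z: "0 \<le> z \<bullet> W n" "z \<bullet> W n \<le> W n $ a" "- P n z \<in> S" by auto
  \<comment> \<open>A flat box has \<open>W n $ a = 0\<close>; then the height of \<open>z\<close>
    is 0 and the parameter 0 serves in place of the quotient.\<close>
  define t where "t = (if W n $ a = 0 then 0 else (z \<bullet> W n) / W n $ a)"
  have t: "0 \<le> t" "t \<le> 1" "t * W n $ a = z \<bullet> W n"
    using z W_nonneg[of n a] by (auto simp: t_def divide_simps)
  have "z = proj_u \<sigma> u v n (t *\<^sub>R axis a 1) - (- P n z)"
    using t(3) by (simp add: proj_u_def axis_W proj_eq)
  moreover have "t *\<^sub>R axis a 1 \<in> closed_segment 0 (axis a (1::real))"
    using t by (auto simp: closed_segment_def)
  ultimately show "z \<in> box_over \<sigma> u v n a S"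
    using z(3) unfolding box_over_def by blast
qed

lemma box_eq: "rbox n a = strip n a \<inter> cyl n a"
  using box_over_eq[OF R_height] by (auto simp: rauzy_box_def strip_def cyl_def)

lemma edge_subtile_height:
  assumes "y \<in> edge_subtile \<sigma> u v n e"
  shows "y \<bullet> W n = 0"
  using assms by (auto simp: edge_subtile_def inner_add_left W_M R_height split: prod.splits)

lemma P_tau: "M n *v P (n + 1) (tau n p z) = P n z + P n (abelianization p)"
  by (simp add: P_M M_tau P_add)

lemma edge_cyl_eq: "edge_cyl n e = {z. - P n z \<in> edge_subtile \<sigma> u v n e}"
proof -
  obtain a p b where e: "e = (a, p, b)" by (cases e)
  have "- P n z \<in> edge_subtile \<sigma> u v n e \<longleftrightarrow> - P (n + 1) (tau n p z) \<in> R (n + 1) b" for z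
  proof -
    have "- P n z = P n (abelianization p) + M n *v y \<longleftrightarrow> y = - P (n + 1) (tau n p z)" for y
    proof -
      have "M n *v (- P (n + 1) (tau n p z)) = - P n z - P n (abelianization p)"
        using P_tau[of n p z] by (simp add: matrix_vector_minus)
      then show ?thesis using inj_M[of n y "- P (n + 1) (tau n p z)"] by (auto simp: algebra_simps)
    qed
    then show ?thesis by (simp add: edge_subtile_def e image_iff)
  qed
  then show ?thesis by (auto simp: edge_cyl_def cyl_def e edge_label_def rng_def)
qed

lemma edge_box_eq: "ebox n e = strip n (src e) \<inter> edge_cyl n e"
  using box_over_eq[OF edge_subtile_height]
  by (auto simp: edge_box_def strip_def edge_cyl_eq)

lemma edge_box_subset: "e \<in> edges \<sigma> n \<Longrightarrow> ebox n e \<subseteq> rbox n (src e)"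
  using edge_cyl_subset[of e n] by (auto simp: edge_box_eq box_eq)

lemma compact_box_over: "compact S \<Longrightarrow> compact (box_over \<sigma> u v n a S)"
  unfolding box_over_def using UW_pos[of n]
  by (intro compact_differences compact_continuous_image)
    (auto simp: proj_u_def intro!: continuous_intros)

lemma compact_box: "compact (rbox n a)"
  by (simp add: rauzy_box_def compact_box_over R_compact)

lemma compact_edge_box: "compact (ebox n e)"
  unfolding edge_box_def edge_subtile_def
  by (intro compact_box_over)
    (auto split: prod.splits intro!: compact_continuous_image R_compact continuous_intros
      matrix_vector_mult_linear_continuous_on)

lemma interior_strip: "interior (strip n a) = open_strip n a"
proof -
  have "strip n a = {z. W n \<bullet> z \<ge> 0} \<inter> {z. W n \<bullet> z \<le> W n $ a}"
    by (auto simp: strip_def inner_commute)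
  then have "interior (strip n a) = {z. W n \<bullet> z > 0} \<inter> {z. W n \<bullet> z < W n $ a}"
    using W_nonzero[of n] by (simp only: interior_Int interior_halfspace_le interior_halfspace_ge) auto
  then show ?thesis
    by (auto simp: open_strip_def inner_commute)
qed

lemma interior_box: "interior (rbox n a) = open_strip n a \<inter> interior (cyl n a)"
  by (simp add: box_eq interior_strip)

lemma interior_edge_box: "interior (ebox n e) = open_strip n (src e) \<inter> interior (edge_cyl n e)"
  by (simp add: edge_box_eq interior_strip)

lemma continuous_tau: "continuous_on S (tau n p)"
  unfolding tau_def
  by (intro continuous_on_compose2[OF matrix_vector_mult_linear_continuous_on] continuous_intros) auto

lemma tau_eq_iff: "tau n p z = w \<longleftrightarrow> z = M n *v w - abelianization p"
  using inj_M[of n "tau n p z" w] by (auto simp: M_tau algebra_simps)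

lemma interior_edge_cyl: "interior (edge_cyl n e) = tau n (edge_label e) -` interior (cyl (n + 1) (rng e))"
proof
  let ?t = "tau n (edge_label e)" and ?C = "cyl (n + 1) (rng e)"
  have cont: "continuous_on UNIV (\<lambda>w. M n *v w - abelianization (edge_label e))"
    by (intro continuous_intros matrix_vector_mult_linear_continuous_on)
  show "?t -` interior ?C \<subseteq> interior (edge_cyl n e)"
    using open_vimage[OF open_interior continuous_tau] interior_subset[of ?C]
    by (intro interior_maximal) (auto simp: edge_cyl_def)
  have "open ((\<lambda>w. M n *v w - abelianization (edge_label e)) -` interior (edge_cyl n e))"
    by (rule open_vimage[OF open_interior cont])
  moreover have "(\<lambda>w. M n *v w - abelianization (edge_label e)) -` interior (edge_cyl n e) \<subseteq> ?C"
  proof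
    fix w
    assume "w \<in> (\<lambda>w. M n *v w - abelianization (edge_label e)) -` interior (edge_cyl n e)"
    then have "M n *v w - abelianization (edge_label e) \<in> edge_cyl n e"
      using interior_subset by blast
    moreover have "tau n (edge_label e) (M n *v w - abelianization (edge_label e)) = w"
      by (simp add: tau_eq_iff)
    ultimately show "w \<in> ?C" by (simp add: edge_cyl_def)
  qed
  ultimately have "(\<lambda>w. M n *v w - abelianization (edge_label e)) -` interior (edge_cyl n e) \<subseteq> interior ?C"
    by (rule interior_maximal[rotated])
  then show "interior (edge_cyl n e) \<subseteq> ?t -` interior ?C"
    by (auto simp: subset_iff M_tau)
qed

lemma tau_height: "tau n p z \<bullet> W (n + 1) = z \<bullet> W n + abelianization p \<bullet> W n"
  by (simp add: tau_def W_N inner_add_left)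

lemma tau_add: "tau n p (z + x) = tau n p z + N n *v x"
  by (simp add: tau_def matrix_vector_right_distrib algebra_simps)

text \<open>The heights of the letters of the image of \<open>rng e\<close> add up to
  \<open>W (n + 1) $ rng e\<close>, so the slab of one letter, raised by the height of the prefix
  before it, stays inside the box.\<close>

lemma W_edge:
  assumes "e \<in> edges \<sigma> n"
  shows "abelianization (edge_label e) \<bullet> W n + W n $ src e \<le> W (n + 1) $ rng e"
proof -
  obtain s where "\<sigma> n [rng e] = edge_label e @ [src e] @ s"
    using assms by (auto simp: edges_iff prefix_def)
  then show ?thesis
    using W_block[of n "n + 1" "rng e"] W_abelianization_nonneg[of s n]
    by (simp add: block_single abelianization_append abelianization_Cons inner_add_left axis_W)
qed

lemma tau_strip: "e \<in> edges \<sigma> n \<Longrightarrow> z \<in> strip n (src e) \<Longrightarrow> tau n (edge_label e) z \<in> strip (n + 1) (rng e)"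
  and tau_open_strip: "e \<in> edges \<sigma> n \<Longrightarrow> z \<in> open_strip n (src e) \<Longrightarrow> tau n (edge_label e) z \<in> open_strip (n + 1) (rng e)"
  using W_edge[of e n] W_abelianization_nonneg[of "edge_label e" n]
  by (auto simp: strip_def open_strip_def tau_height)

lemma tau_box: "e \<in> edges \<sigma> n \<Longrightarrow> z \<in> ebox n e \<Longrightarrow> tau n (edge_label e) z \<in> rbox (n + 1) (rng e)"
  by (auto simp: edge_box_eq box_eq edge_cyl_def tau_strip)

lemma tau_interior_box:
  "e \<in> edges \<sigma> n \<Longrightarrow> z \<in> interior (ebox n e) \<Longrightarrow> tau n (edge_label e) z \<in> interior (rbox (n + 1) (rng e))"
  by (auto simp: interior_edge_box interior_box interior_edge_cyl tau_open_strip)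

end

section \<open>Lattice tilings\<close>

text \<open>Distinct integer vectors have distance at least 1. Arbitrary subsets are covered so that
  single tiles can be removed from a union of translates without losing closedness.\<close>

lemma int_vecs_subset_closed:
  fixes S :: "(real ^ 'n) set"
  assumes "S \<subseteq> int_vecs"
  shows "closed S"
proof (rule discrete_imp_closed[of 1])
  show "\<forall>x\<in>S. \<forall>y\<in>S. dist y x < 1 \<longrightarrow> y = x"
  proof (intro ballI impI)
    fix x y assume xy: "x \<in> S" "y \<in> S" "dist y x < 1"
    have "y $ i = x $ i" for i
    proof -
      have "y $ i - x $ i \<in> \<int>"
        using xy assms by (intro Ints_diff) (auto simp: int_vecs_def)
      then obtain k where k: "y $ i - x $ i = of_int k" by (auto elim: Ints_cases)
      have "\<bar>(y - x) $ i\<bar> < 1"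
        using component_le_norm_cart[of "y - x" i] xy(3) by (simp add: dist_norm)
      then have "k = 0" using k by simp
      then show ?thesis using k by simp
    qed
    then show "y = x" by (simp add: vec_eq_iff)
  qed
qed simp

lemma countable_int_vecs: "countable (int_vecs :: (real ^ 'n) set)"
proof -
  have "int_vecs \<subseteq> range (\<lambda>f :: int ^ 'n. (\<chi> i. of_int (f $ i)) :: real ^ 'n)"
  proof
    fix x :: "real ^ 'n" assume "x \<in> int_vecs"
    then have "x = (\<chi> i. of_int ((\<chi> i. \<lfloor>x $ i\<rfloor>) $ i))"
      by (auto simp: int_vecs_def vec_eq_iff elim: Ints_cases)
    then show "x \<in> range (\<lambda>f :: int ^ 'n. (\<chi> i. of_int (f $ i)) :: real ^ 'n)" by blast
  qed
  moreover have "countable (UNIV :: (int ^ 'n) set)"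
  proof -
    have "inj (\<lambda>f :: int ^ 'n. \<lambda>i\<in>UNIV. f $ i)"
      by (rule injI) (simp add: vec_eq_iff fun_eq_iff)
    moreover have "countable (PiE UNIV (\<lambda>i :: 'n. UNIV :: int set))"
      by (intro countable_PiE) auto
    ultimately show ?thesis
      by (rule countable_image_inj_on[rotated, of _ UNIV, OF _ countable_subset[rotated]]) auto
  qed
  ultimately show ?thesis
    using countable_subset countable_image by metis
qed

text \<open>For each index the union is the sum of a closed set and a compact set, hence closed;
  finitely many indices remain.\<close>

lemma closed_lattice_union:
  fixes K :: "'e \<Rightarrow> (real ^ 'n) set"
  assumes "finite E" "\<And>e. e \<in> E \<Longrightarrow> compact (K e)" "S \<subseteq> int_vecs \<times> E"
  shows "closed (\<Union>(x, e)\<in>S. (+) x ` K e)"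
proof -
  have "(\<Union>(x, e)\<in>S. (+) x ` K e) = (\<Union>e\<in>E. \<Union>x\<in>{x. (x, e) \<in> S}. \<Union>y\<in>K e. {x + y})"
    using assms(3) by fast
  moreover have "closed (\<Union>x\<in>{x. (x, e) \<in> S}. \<Union>y\<in>K e. {x + y})" if "e \<in> E" for e
    using assms that by (intro closed_compact_sums int_vecs_subset_closed) auto
  ultimately show ?thesis using assms(1) by auto
qed

text \<open>Shared by the tiling by boxes of letters, which is assumed, and the one by edge boxes,
  which is derived from it.\<close>

locale lattice_tiling =
  fixes E :: "'e set" and K :: "'e \<Rightarrow> (real ^ 'n) set"
  assumes finite_E: "finite E"
    and compact_K: "\<And>e. e \<in> E \<Longrightarrow> compact (K e)"
    and cover: "\<And>z. \<exists>x\<in>int_vecs. \<exists>e\<in>E. z - x \<in> K e"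
    and overlap: "\<And>x e x' e'. x \<in> int_vecs \<Longrightarrow> e \<in> E \<Longrightarrow> x' \<in> int_vecs \<Longrightarrow> e' \<in> E \<Longrightarrow>
      (x, e) \<noteq> (x', e') \<Longrightarrow> negligible {z. z - x \<in> K e \<and> z - x' \<in> K e'}"
begin

text \<open>The union of all other tiles is closed and contains the complement of
  \<open>K e\<close>, hence also the closure of this complement. A frontier point therefore lies in
  a second tile, and there are only countably many overlaps.\<close>

lemma negligible_frontier:
  assumes "e \<in> E"
  shows "negligible (frontier (K e))"
proof -
  let ?S = "int_vecs \<times> E - {(0, e)}"
  let ?C = "\<Union>(x, e)\<in>?S. (+) x ` K e"
  have mem: "z \<in> (+) x ` K e' \<longleftrightarrow> z - x \<in> K e'" for x z e'
    by (auto simp: image_iff algebra_simps) (metis add.commute diff_add_cancel)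
  have "closed ?C"
    using finite_E compact_K by (intro closed_lattice_union) auto
  moreover have "- K e \<subseteq> ?C"
  proof
    fix z assume "z \<in> - K e"
    then obtain x e' where "x \<in> int_vecs" "e' \<in> E" "z - x \<in> K e'" "(x, e') \<noteq> (0, e)"
      using cover[of z] by force
    then show "z \<in> ?C" by (auto simp: mem intro!: bexI[of _ "(x, e')"])
  qed
  ultimately have "closure (- K e) \<subseteq> ?C"
    by (rule closure_minimal[rotated])
  then have "frontier (K e) \<subseteq> K e \<inter> ?C"
    using compact_K[OF assms, THEN compact_imp_closed] by (auto simp: frontier_closures)
  also have "\<dots> \<subseteq> (\<Union>(x, e')\<in>?S. {z. z - 0 \<in> K e \<and> z - x \<in> K e'})"
    by (auto simp: mem)
  finally have *: "frontier (K e) \<subseteq> \<dots>" .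
  have "countable ?S"
    using countable_int_vecs countable_finite[OF finite_E]
    by (intro countable_subset[OF Diff_subset] countable_SIGMA)
  then have "negligible (\<Union>(x, e')\<in>?S. {z. z - 0 \<in> K e \<and> z - x \<in> K e'})"
    by (intro negligible_countable_Union countable_image)
      (use assms overlap[of 0 e] in \<open>auto simp del: diff_0_right\<close>)
  then show ?thesis using * negligible_subset by blast
qed

lemma interior_overlap:
  assumes "x \<in> int_vecs" "e \<in> E" "e' \<in> E" "z \<in> interior (K e)" "z + x \<in> interior (K e')"
  shows "x = 0 \<and> e = e'"
proof (rule ccontr)
  assume "\<not> ?thesis"
  then have "negligible {z. z - 0 \<in> K e \<and> z - (- x) \<in> K e'}"
    using assms by (intro overlap) (auto simp: int_vecs_minus)
  moreover have "open (interior (K e) \<inter> (\<lambda>z. z + x) -` interior (K e'))"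
    by (intro open_Int open_interior open_vimage continuous_intros) 
  moreover have "interior (K e) \<inter> (\<lambda>z. z + x) -` interior (K e') \<subseteq> {z. z - 0 \<in> K e \<and> z - (- x) \<in> K e'}"
    using interior_subset by fastforce
  ultimately have "interior (K e) \<inter> (\<lambda>z. z + x) -` interior (K e') = {}"
    using negligible_subset open_not_negligible by blast
  then show False using assms by auto
qed

text \<open>An open set missing all translated interiors would be covered by countably many null
  frontiers.\<close>

lemma interiors_dense:
  assumes "open V" "V \<noteq> {}"
  shows "\<exists>z\<in>V. \<exists>x\<in>int_vecs. \<exists>e\<in>E. z - x \<in> interior (K e)"
proof (rule ccontr)
  assume *: "\<not> ?thesis"
  have "V \<subseteq> (\<Union>x\<in>int_vecs. \<Union>e\<in>E. (+) x ` frontier (K e))"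
  proof
    fix z assume z: "z \<in> V"
    obtain x e where xe: "x \<in> int_vecs" "e \<in> E" "z - x \<in> K e"
      using cover by blast
    then have "z - x \<in> frontier (K e)"
      using * z closure_subset[of "K e"] by (auto simp: frontier_def)
    then have "z \<in> (+) x ` frontier (K e)"
      by (rule image_eqI[rotated]) simp
    then show "z \<in> (\<Union>x\<in>int_vecs. \<Union>e\<in>E. (+) x ` frontier (K e))"
      using xe by blast
  qed
  moreover have "negligible (\<Union>x\<in>int_vecs. \<Union>e\<in>E. (+) x ` frontier (K e))"
    using finite_E negligible_frontier countable_int_vecs
    by (intro negligible_countable_Union countable_image)
      (auto intro!: negligible_countable_Union[OF countable_image] negligible_translation simp: countable_finite)
  ultimately show False
    using negligible_subset open_not_negligible[OF assms] by blast
qed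

lemma ex_interior: "\<exists>e\<in>E. interior (K e) \<noteq> {}"
  using interiors_dense[of UNIV] by auto

end

section \<open>Tilings by edge boxes\<close>

text \<open>A discrete intermediate value argument: last letters are removed until \<open>f\<close>
  drops to \<open>t\<close> or below, and the letter removed at that moment is the one
  sought.\<close>

lemma ex_prefix_around:
  fixes f :: "'a list \<Rightarrow> real"
  assumes "w \<noteq> []" "f [] \<le> t" "t \<le> f w"
  shows "\<exists>p a. prefix (p @ [a]) w \<and> f p \<le> t \<and> t \<le> f (p @ [a])"
  using assms
proof (induction w rule: rev_induct)
  case (snoc a w)
  show ?case
  proof (cases "f w \<le> t")
    case True
    then show ?thesis using snoc.prems(3) by (intro exI[of _ w] exI[of _ a]) simp
  next
    case False
    then have "w \<noteq> []" using snoc.prems(2) by (cases "w = []") simp_all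
    then have "\<exists>p a. prefix (p @ [a]) w \<and> f p \<le> t \<and> t \<le> f (p @ [a])"
      by (rule snoc.IH[OF _ snoc.prems(2) less_imp_le[OF not_le_imp_less[OF False]]])
    then show ?thesis by (meson prefix_prefix)
  qed
qed simp

lemma shorter_prefix_snoc:
  assumes "prefix (p @ [a]) w" "prefix p' w" "length p < length p'"
  shows "prefix (p @ [a]) p'"
  using assms(3) by (intro prefix_length_prefix[OF assms(1,2)]) simp

context rauzy_tiling
begin

lemma box_tiling: "lattice_tiling UNIV (rbox n)"
proof
  have mem: "z \<in> (+) x ` rbox n e' \<longleftrightarrow> z - x \<in> rbox n e'" for x z e'
    by (auto simp: image_iff algebra_simps) (metis add.commute diff_add_cancel)
  show "\<exists>x\<in>int_vecs. \<exists>e\<in>UNIV. z - x \<in> rbox n e" for z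
    using tiles[of n] unfolding tiles_space_def by (auto simp: mem set_eq_iff)
  show "negligible {z. z - x \<in> rbox n e \<and> z - x' \<in> rbox n e'}"
    if "x \<in> int_vecs" "x' \<in> int_vecs" "(x, e) \<noteq> (x', e')" for x e x' e'
  proof -
    have "(\<lambda>(x, a). (+) x ` rbox n a) (x, e) \<inter> (\<lambda>(x, a). (+) x ` rbox n a) (x', e') \<in> null_sets lebesgue"
      using tiles[of n] that unfolding tiles_space_def by blast
    moreover have "(+) x ` rbox n e \<inter> (+) x' ` rbox n e' = {z. z - x \<in> rbox n e \<and> z - x' \<in> rbox n e'}"
      by (simp add: set_eq_iff mem)
    ultimately show ?thesis by (simp add: negligible_iff_null_sets)
  qed
qed (auto simp: compact_box)

lemma finite_edges: "finite (edges \<sigma> n)"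
proof (rule finite_subset)
  show "edges \<sigma> n \<subseteq> UNIV \<times> (\<Union>b. set (prefixes (\<sigma> n [b]))) \<times> UNIV"
    using append_prefixD by (fastforce simp: edges_def)
qed auto

text \<open>Modulo the lattice, \<open>N n *v z\<close> lies in the box of some \<open>b\<close> at
  the next level. The slab of that box containing its height selects the edge.\<close>

lemma ebox_cover: "\<exists>x\<in>int_vecs. \<exists>e\<in>edges \<sigma> n. z - x \<in> ebox n e"
proof -
  obtain y b where y: "y \<in> int_vecs" "N n *v z - y \<in> rbox (n + 1) b"
    using lattice_tiling.cover[OF box_tiling[of "n + 1"], of "N n *v z"] by auto
  let ?w = "N n *v z - y"
  have "0 \<le> ?w \<bullet> W (n + 1)" "?w \<bullet> W (n + 1) \<le> abelianization (\<sigma> n [b]) \<bullet> W n"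
    using y W_block[of n "n + 1" b] by (auto simp: box_eq strip_def block_single)
  moreover have "\<sigma> n [b] \<noteq> []"
    using substitution_eq_Nil_iff[OF subst] by auto
  ultimately obtain p a where p: "prefix (p @ [a]) (\<sigma> n [b])"
    "abelianization p \<bullet> W n \<le> ?w \<bullet> W (n + 1)" "?w \<bullet> W (n + 1) \<le> abelianization (p @ [a]) \<bullet> W n"
    using ex_prefix_around[of "\<sigma> n [b]" "\<lambda>p. abelianization p \<bullet> W n" "?w \<bullet> W (n + 1)"] by auto
  let ?e = "(a, p, b)" and ?x = "M n *v y + abelianization p"
  have tau: "tau n p (z - ?x) = ?w"
    by (simp add: tau_eq_iff matrix_vector_mult_diff_distrib matrix_inv_vector[OF invertible_M])
  have "?x \<in> int_vecs"
    using y by (simp add: int_vecs_add incidence_int_vecs abelianization_int_vecs)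
  moreover have "?e \<in> edges \<sigma> n"
    using p by (simp add: edges_def)
  moreover have "z - ?x \<in> edge_cyl n ?e"
    using tau y by (simp add: edge_cyl_def edge_label_def rng_def box_eq)
  moreover have "z - ?x \<in> strip n a"
    using tau_height[of n p "z - ?x"] p unfolding tau
    by (simp add: strip_def abelianization_append abelianization_single inner_add_left axis_W)
  ultimately show ?thesis
    by (intro bexI[of _ ?x] bexI[of _ ?e]) (auto simp: edge_box_eq src_def)
qed

lemma tau_diff: "tau n p (z - x) = N n *v z - N n *v (x - abelianization p)"
  by (simp add: tau_def matrix_vector_mult_diff_distrib algebra_simps)

text \<open>Two edge boxes carried into the same translate of the box of \<open>b\<close> are separated by a
  hyperplane orthogonal to \<open>W n\<close>.\<close>

lemma ebox_overlap_same:
  assumes "e \<in> edges \<sigma> n" "e' \<in> edges \<sigma> n" "rng e = rng e'"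
    and "x - abelianization (edge_label e) = x' - abelianization (edge_label e')"
    and "length (edge_label e) < length (edge_label e')"
  shows "negligible {z. z - x \<in> ebox n e \<and> z - x' \<in> ebox n e'}"
proof -
  let ?p = "edge_label e" and ?p' = "edge_label e'"
  have "prefix (?p @ [src e]) ?p'"
    using assms append_prefixD unfolding edges_iff by (metis shorter_prefix_snoc)
  then obtain s where s: "?p' = ?p @ [src e] @ s" by (auto elim: prefixE)
  then have W: "abelianization ?p \<bullet> W n + W n $ src e \<le> abelianization ?p' \<bullet> W n"
    using W_abelianization_nonneg[of s n]
    by (simp add: abelianization_append abelianization_Cons inner_add_left axis_W)
  have "z \<bullet> W n = (x' - abelianization ?p') \<bullet> W n + abelianization ?p' \<bullet> W n"
    if "z - x \<in> ebox n e" "z - x' \<in> ebox n e'" for z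
  proof -
    have "x = x' - abelianization ?p' + abelianization ?p" using assms(4) by (simp add: algebra_simps)
    then show ?thesis
      using that W by (auto simp: edge_box_eq strip_def inner_diff_left inner_add_left)
  qed
  then have "{z. z - x \<in> ebox n e \<and> z - x' \<in> ebox n e'}
      \<subseteq> {z. W n \<bullet> z = (x' - abelianization ?p') \<bullet> W n + abelianization ?p' \<bullet> W n}"
    by (auto simp: inner_commute)
  then show ?thesis
    using negligible_subset[OF negligible_hyperplane] W_nonzero[of n] by blast
qed

text \<open>Both edge boxes are mapped into tiles of level \<open>n + 1\<close>. If these tiles
  differ, the overlap lies in the linear image of a null set; if they coincide, the edges are two
  positions in the same word, and their slabs meet at most in a hyperplane.\<close>

lemma ebox_overlap:
  assumes x: "x \<in> int_vecs" "x' \<in> int_vecs" and e: "e \<in> edges \<sigma> n" "e' \<in> edges \<sigma> n"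
    and ne: "(x, e) \<noteq> (x', e')"
  shows "negligible {z. z - x \<in> ebox n e \<and> z - x' \<in> ebox n e'}"
proof -
  let ?p = "edge_label e" and ?p' = "edge_label e'"
  let ?y = "N n *v (x - abelianization ?p)" and ?y' = "N n *v (x' - abelianization ?p')"
  show ?thesis
  proof (cases "(?y, rng e) = (?y', rng e')")
    case False
    have "negligible {w. w - ?y \<in> rbox (n + 1) (rng e) \<and> w - ?y' \<in> rbox (n + 1) (rng e')}"
      using False x
      by (intro lattice_tiling.overlap[OF box_tiling]) (auto intro!: N_int_vecs int_vecs_diff abelianization_int_vecs)
    then have "negligible ((*v) (M n) ` {w. w - ?y \<in> rbox (n + 1) (rng e) \<and> w - ?y' \<in> rbox (n + 1) (rng e')})"
      by (intro negligible_differentiable_image_negligible linear_imp_differentiable_on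
          matrix_vector_mul_linear) auto
    moreover have "{z. z - x \<in> ebox n e \<and> z - x' \<in> ebox n e'}
      \<subseteq> (*v) (M n) ` {w. w - ?y \<in> rbox (n + 1) (rng e) \<and> w - ?y' \<in> rbox (n + 1) (rng e')}"
    proof
      fix z assume "z \<in> {z. z - x \<in> ebox n e \<and> z - x' \<in> ebox n e'}"
      then have "N n *v z \<in> {w. w - ?y \<in> rbox (n + 1) (rng e) \<and> w - ?y' \<in> rbox (n + 1) (rng e')}"
        using tau_box[OF e(1), of "z - x"] tau_box[OF e(2), of "z - x'"] by (simp add: tau_diff)
      then show "z \<in> (*v) (M n) ` {w. w - ?y \<in> rbox (n + 1) (rng e) \<and> w - ?y' \<in> rbox (n + 1) (rng e')}"
        by (rule image_eqI[rotated]) (simp add: matrix_inv_vector[OF invertible_M])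
    qed
    ultimately show ?thesis by (rule negligible_subset)
  next
    case True
    then have eq: "x - abelianization ?p = x' - abelianization ?p'" "rng e = rng e'"
      by (metis Pair_inject matrix_inv_vector(1)[OF invertible_M], simp)
    consider "length ?p < length ?p'" | "length ?p' < length ?p" | "length ?p = length ?p'"
      by linarith
    then show ?thesis
    proof cases
      case 1
      then show ?thesis using ebox_overlap_same[OF e] eq by simp
    next
      case 2
      have "{z. z - x \<in> ebox n e \<and> z - x' \<in> ebox n e'} = {z. z - x' \<in> ebox n e' \<and> z - x \<in> ebox n e}"
        by auto
      then show ?thesis using ebox_overlap_same[of e' n e x' x] e eq 2 by simp
    next
      case 3
      \<comment> \<open>Prefixes of one word with equal lengths agree, here together with the letter
        that follows, so the edges coincide.\<close>
      have "?p @ [src e] = take (Suc (length ?p)) (\<sigma> n [rng e])"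
        "?p' @ [src e'] = take (Suc (length ?p')) (\<sigma> n [rng e'])"
        using e by (auto simp: edges_iff prefix_def)
      then have "?p @ [src e] = ?p' @ [src e']"
        using 3 eq by metis
      then have "e = e'" "x = x'"
        using eq by (auto simp: edge_label_def src_def rng_def prod_eq_iff split: prod.splits)
      then show ?thesis using ne by simp
    qed
  qed
qed

lemma edge_tiling: "lattice_tiling (edges \<sigma> n) (ebox n)"
  by standard (auto simp: finite_edges compact_edge_box ebox_cover intro: ebox_overlap)

text \<open>The image of \<open>z\<close> lies in the interior of the box of \<open>rng e\<close>
  and \<open>w\<close> in that of \<open>src e'\<close>. Interiors of the letter tiling that meet
  modulo the lattice belong to the same tile with translation 0.\<close>

lemma lift_step:
  assumes "e \<in> edges \<sigma> n" "e' \<in> edges \<sigma> (n + 1)"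
    and "z \<in> interior (ebox n e)" "w \<in> interior (ebox (n + 1) e')"
    and "tau n (edge_label e) z - w \<in> int_vecs"
  shows "rng e = src e' \<and> tau n (edge_label e) z = w"
proof -
  let ?t = "tau n (edge_label e) z"
  have "w \<in> interior (rbox (n + 1) (src e'))"
    using interior_mono[OF edge_box_subset[OF assms(2)]] assms(4) by blast
  then have "?t + (w - ?t) \<in> interior (rbox (n + 1) (src e'))" by simp
  then have "w - ?t = 0 \<and> rng e = src e'"
    using assms tau_interior_box[OF assms(1,3)] int_vecs_minus[OF assms(5)]
    by (intro lattice_tiling.interior_overlap[OF box_tiling[of "n + 1"], of _ _ _ ?t]) auto
  then show ?thesis by auto
qed

text \<open>Some box of a later level has interior points, and primitivity embeds its cylinder into
  the cylinder of every letter. The claim concerns cylinders because the box of \<open>b\<close>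
  itself could be flat.\<close>

lemma interior_cyl_nonempty: "interior (cyl n b) \<noteq> {}"
proof -
  obtain m where m: "n < m" "positive_matrix (B n m)"
    using prim by (auto simp: primitive_def)
  obtain a where "interior (rbox m a) \<noteq> {}"
    using lattice_tiling.ex_interior[OF box_tiling[of m]] by auto
  then obtain w where w: "w \<in> interior (cyl m a)" by (auto simp: interior_box)
  have "count_list (block \<sigma> n m [a]) b \<noteq> 0"
    using m(2) by (auto simp: positive_matrix_def incidence_def dest!: spec[of _ b] spec[of _ a])
  then have "b \<in> set (block \<sigma> n m [a])"
    by (simp add: count_list_0_iff)
  then obtain p where p: "prefix (p @ [b]) (block \<sigma> n m [a])"
    by (auto simp: in_set_conv_decomp prefix_def)
  let ?f = "\<lambda>z. matrix_inv (B n m) *v (z + abelianization p)"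
  have "open (?f -` interior (cyl m a))"
    by (intro open_vimage open_interior continuous_on_compose2[OF matrix_vector_mult_linear_continuous_on]
        continuous_intros) auto
  moreover have "?f -` interior (cyl m a) \<subseteq> cyl n b"
    using cyl_block[OF less_imp_le[OF m(1)] p, of "?f _"] interior_subset[of "cyl m a"]
    by (auto simp: matrix_inv_vector[OF invertible_B])
  moreover have "B n m *v w - abelianization p \<in> ?f -` interior (cyl m a)"
    using w by (simp add: matrix_inv_vector[OF invertible_B])
  ultimately show ?thesis
    using interior_maximal[of "?f -` interior (cyl m a)" "cyl n b"] by blast
qed

lemma interior_edge_cyl_nonempty: "interior (edge_cyl n e) \<noteq> {}"
proof -
  obtain w where w: "w \<in> interior (cyl (n + 1) (rng e))"
    using interior_cyl_nonempty by blast
  have "tau n (edge_label e) (M n *v w - abelianization (edge_label e)) = w"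
    by (simp add: tau_eq_iff)
  then have "M n *v w - abelianization (edge_label e) \<in> interior (edge_cyl n e)"
    using w by (simp add: interior_edge_cyl)
  then show ?thesis by auto
qed

end

section \<open>Lifts of orbits\<close>

text \<open>Turns both branches of \<open>pullback\<close> into preimages under a single map
  (\<open>pullback_int_pow\<close>).\<close>

definition int_pow :: "('x \<Rightarrow> 'x) \<Rightarrow> int \<Rightarrow> 'x \<Rightarrow> 'x" where
  "int_pow f k = (if k \<ge> 0 then f ^^ nat k else inv f ^^ nat (- k))"

lemma int_pow_0 [simp]: "int_pow f 0 x = x"
  by (simp add: int_pow_def)

lemma int_pow_Suc:
  assumes "bij f"
  shows "int_pow f (k + 1) x = f (int_pow f k x)"
proof (cases "k \<ge> 0")
  case True
  then show ?thesis by (simp add: int_pow_def nat_add_distrib)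
next
  case False
  then obtain j where j: "k = - int (Suc j)"
    by (metis int_cases linorder_not_less of_nat_0_le_iff)
  then have "nat (- k) = Suc j" "nat (- (k + 1)) = j" by auto
  then show ?thesis
    using j bij_is_surj[OF assms, THEN surj_f_inv_f] by (auto simp: int_pow_def)
qed

lemma inv_funpow: "bij f \<Longrightarrow> (inv f ^^ j) ((f ^^ j) x) = x"
  and funpow_inv: "bij f \<Longrightarrow> (f ^^ j) ((inv f ^^ j) x) = x"
  by (metis bij_fn bij_is_inj inv_f_f inv_fn) (metis bij_fn bij_is_surj surj_f_inv_f inv_fn)

lemma pullback_int_pow:
  assumes "bij f"
  shows "pullback f k S = int_pow f k -` S"
proof (cases "k \<ge> 0")
  case False
  have "(f ^^ nat (- k)) ` S = (inv f ^^ nat (- k)) -` S"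
  proof (intro set_eqI iffI)
    fix x assume "x \<in> (inv f ^^ nat (- k)) -` S"
    then show "x \<in> (f ^^ nat (- k)) ` S"
      by (intro image_eqI[of _ _ "(inv f ^^ nat (- k)) x"]) (auto simp: funpow_inv[OF assms])
  qed (auto simp: inv_funpow[OF assms])
  with False show ?thesis by (simp add: pullback_def int_pow_def)
qed (simp add: pullback_def int_pow_def)

lemma abs_torus_surj: "\<exists>z. x = abs_torus z"
  by (metis Quotient_abs_rep[OF Quotient_torus])

context rauzy_tiling
begin

abbreviation "F \<equiv> family_map \<sigma>"

lemma F_abs: "F (n, abs_torus z) = (n + 1, abs_torus (N n *v z))"
  by (rule family_map_abs[where \<sigma> = \<sigma>, OF unimodular])

lemma F_tau: "F (n, abs_torus z) = (n + 1, abs_torus (tau n p z))"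
proof -
  have "N n *v z - tau n p z = - (N n *v abelianization p)"
    by (simp add: tau_def matrix_vector_right_distrib)
  then show ?thesis
    by (simp add: F_abs abs_torus_eq_iff int_vecs_minus N_int_vecs abelianization_int_vecs)
qed

lemma bij_F: "bij F"
proof (rule bijI)
  show "inj F"
  proof (rule injI)
    fix x y assume eq: "F x = F y"
    obtain n z m w where xy: "x = (n, abs_torus z)" "y = (m, abs_torus w)"
      using abs_torus_surj by (metis surj_pair)
    then have nm: "n = m" and "N n *v z - N n *v w \<in> int_vecs"
      using eq by (auto simp: F_abs abs_torus_eq_iff)
    then have "M n *v (N n *v (z - w)) \<in> int_vecs"
      by (intro incidence_int_vecs) (simp add: matrix_vector_mult_diff_distrib)
    then show "x = y"
      using nm by (simp add: xy abs_torus_eq_iff matrix_inv_vector[OF invertible_M])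
  qed
  show "surj F"
  proof (rule surjI)
    fix x :: "int \<times> 'd torus"
    show "F (fst x - 1, abs_torus (M (fst x - 1) *v rep_torus (snd x))) = x"
      using F_abs[of "fst x - 1" "M (fst x - 1) *v rep_torus (snd x)"]
      by (simp add: matrix_inv_vector[OF invertible_M] prod_eq_iff Quotient_abs_rep[OF Quotient_torus])
  qed
qed

abbreviation "iterF \<equiv> int_pow F"

lemmas pullback_F = pullback_int_pow[OF bij_F]

primrec forw :: "int \<Rightarrow> (int \<Rightarrow> 'd edge) \<Rightarrow> nat \<Rightarrow> real ^ 'd \<Rightarrow> real ^ 'd" where
  "forw n e 0 z = z"
| "forw n e (Suc j) z = tau (n + int j) (edge_label (e (int j))) (forw n e j z)"

primrec backw :: "int \<Rightarrow> (int \<Rightarrow> 'd edge) \<Rightarrow> nat \<Rightarrow> real ^ 'd \<Rightarrow> real ^ 'd" where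
  "backw n e 0 z = z"
| "backw n e (Suc j) z =
     M (n - int j - 1) *v backw n e j z - abelianization (edge_label (e (- int j - 1)))"

text \<open>\<open>pos n e k z\<close> lifts the \<open>k\<close>-th iterate of the point below \<open>z\<close>, at level \<open>n\<close>, to the
  universal cover at level \<open>n + k\<close>, with translations prescribed by the labels of \<open>e\<close>.\<close>

definition pos :: "int \<Rightarrow> (int \<Rightarrow> 'd edge) \<Rightarrow> int \<Rightarrow> real ^ 'd \<Rightarrow> real ^ 'd" where
  "pos n e k z = (if k \<ge> 0 then forw n e (nat k) z else backw n e (nat (- k)) z)"

lemma pos_0 [simp]: "pos n e 0 z = z"
  by (simp add: pos_def)

lemma pos_Suc: "pos n e (k + 1) z = tau (n + k) (edge_label (e k)) (pos n e k z)"
proof (cases "k \<ge> 0")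
  case True
  then show ?thesis by (simp add: pos_def nat_add_distrib)
next
  case False
  then obtain j where j: "k = - int (Suc j)"
    by (metis int_cases linorder_not_less of_nat_0_le_iff)
  then have k: "nat (- k) = Suc j" "nat (- (k + 1)) = j" "n + k = n - int j - 1" "k = - int j - 1" by auto
  have "pos n e (k + 1) z = backw n e j z"
    using j by (auto simp: pos_def)
  moreover have "pos n e k z = backw n e (Suc j) z"
    using False by (simp only: pos_def k(1) if_False)
  ultimately show ?thesis
    unfolding k(3) by (simp add: k(4) tau_def matrix_inv_vector[OF invertible_M])
qed

lemma pos_Suc_iff: "pos n e (k + 1) z = tau (n + k) (edge_label (e k)) w \<longleftrightarrow> pos n e k z = w"
  unfolding pos_Suc by (metis M_tau add_right_cancel)

lemma iterF_pos: "iterF k (n, abs_torus z) = (n + k, abs_torus (pos n e k z))"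
proof (induction k rule: int_induct[of _ 0])
  case (step1 k)
  then show ?case
    using F_tau by (simp add: int_pow_Suc[OF bij_F] pos_Suc add.assoc[symmetric])
next
  case (step2 k)
  have "F (iterF (k - 1) (n, abs_torus z)) = F (n + (k - 1), abs_torus (pos n e (k - 1) z))"
    using int_pow_Suc[OF bij_F, of "k - 1"] step2 pos_Suc[of n e "k - 1" z]
      F_tau[of "n + (k - 1)" "pos n e (k - 1) z" "edge_label (e (k - 1))"] by simp
  then show ?case
    using bij_is_inj[OF bij_F] by (simp add: inj_eq)
qed simp

lemma pos_surj: "\<exists>z. pos n e k z = w"
proof (induction k arbitrary: w rule: int_induct[of _ 0])
  case (step1 k)
  obtain w' where "tau (n + k) (edge_label (e k)) w' = w" by (simp add: tau_eq_iff)
  moreover obtain z where "pos n e k z = w'" using step1 by blast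
  ultimately show ?case by (auto simp: pos_Suc)
next
  case (step2 k)
  obtain z where "pos n e k z = tau (n + (k - 1)) (edge_label (e (k - 1))) w" using step2 by blast
  then show ?case using pos_Suc_iff[of n e "k - 1" z w] by auto
qed auto

text \<open>Each \<open>tau\<close> shifts heights by a constant, so differences of heights are the
  same at every level; far in the past they are bounded by small entries of
  \<open>W\<close>.\<close>

lemma pos_height_diff:
  "(pos n e k z - pos n e k z') \<bullet> W (n + k) = (z - z') \<bullet> W n"
proof (induction k rule: int_induct[of _ 0])
  case (step1 k)
  then show ?case
    using tau_height[of "n + k"] by (simp add: pos_Suc inner_diff_left add.assoc[symmetric])
next
  case (step2 k)
  then show ?case
    using tau_height[of "n + (k - 1)"] pos_Suc[of n e "k - 1"] by (simp add: inner_diff_left)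
qed simp

lemma pos_B_diff:
  "k \<ge> 0 \<Longrightarrow> B n (n + k) *v (pos n e k z - pos n e k z') = z - z'"
proof (induction k rule: int_ge_induct)
  case (step k)
  then show ?case
    using B_rec'[of n "n + k"] M_tau[of "n + k"]
    by (simp add: pos_Suc matrix_vector_mult_diff_distrib matrix_vector_right_distrib
        add.assoc[symmetric] flip: matrix_vector_mul_assoc)
qed (simp add: B_refl)

text \<open>Moving along \<open>U\<close> changes heights and leaves cylinders invariant, so heights
  can be adjusted at all levels at once.\<close>

lemma pos_add_U: "pos n e k (z + t *\<^sub>R U n) = pos n e k z + t *\<^sub>R U (n + k)"
proof (induction k rule: int_induct[of _ 0])
  case (step1 k)
  then show ?case
    using N_U[of "n + k"] by (simp add: pos_Suc tau_add matrix_vector_mult_scaleR add.assoc[symmetric])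
next
  case (step2 k)
  have "pos n e (k - 1 + 1) (z + t *\<^sub>R U n) = tau (n + (k - 1)) (edge_label (e (k - 1))) (pos n e (k - 1) z + t *\<^sub>R U (n + (k - 1)))"
    using step2 N_U[of "n + (k - 1)"] pos_Suc[of n e "k - 1" z] by (simp add: tau_add matrix_vector_mult_scaleR)
  then show ?case by (simp only: pos_Suc_iff)
qed simp

section \<open>Chains of edges and lifts of finite cylinders\<close>

definition chain :: "int \<Rightarrow> (int \<Rightarrow> 'd edge) \<Rightarrow> int \<Rightarrow> int \<Rightarrow> bool" where
  "chain n e i j \<longleftrightarrow> (\<forall>k. i \<le> k \<and> k \<le> j \<longrightarrow> e k \<in> edges \<sigma> (n + k)) \<and>
     (\<forall>k. i \<le> k \<and> k < j \<longrightarrow> rng (e k) = src (e (k + 1)))"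

text \<open>The lift of a finite intersection of pulled back open boxes. When the range contains 0
  it is bounded, and \<open>cylinder_eq\<close> leads back to the torus.\<close>

definition window :: "int \<Rightarrow> (int \<Rightarrow> 'd edge) \<Rightarrow> int \<Rightarrow> int \<Rightarrow> (real ^ 'd) set" where
  "window n e i j = {z. \<forall>k. i \<le> k \<and> k \<le> j \<longrightarrow> pos n e k z \<in> interior (ebox (n + k) (e k))}"

text \<open>Heights only constrain the first box of a chain and the cylinder over the base only the last:
  this is the product structure behind the Markov property.\<close>

lemma window_eq:
  assumes "chain n e i j" "i \<le> j"
  shows "window n e i j = {z. pos n e i z \<in> open_strip (n + i) (src (e i)) \<and>
    pos n e j z \<in> interior (edge_cyl (n + j) (e j))}"
proof (intro set_eqI iffI)
  fix z assume "z \<in> {z. pos n e i z \<in> open_strip (n + i) (src (e i)) \<and>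
    pos n e j z \<in> interior (edge_cyl (n + j) (e j))}"
  then have z: "pos n e i z \<in> open_strip (n + i) (src (e i))"
    "pos n e j z \<in> interior (edge_cyl (n + j) (e j))" by auto
  have edge: "e k \<in> edges \<sigma> (n + k)" if "i \<le> k" "k \<le> j" for k
    using assms that by (simp add: chain_def)
  have link: "rng (e k) = src (e (k + 1))" if "i \<le> k" "k < j" for k
    using assms that by (simp add: chain_def)
  have strip: "k \<le> j \<longrightarrow> pos n e k z \<in> open_strip (n + k) (src (e k))" if "i \<le> k" for k
    using that
  proof (induction k rule: int_ge_induct)
    case (step k)
    then show ?case
      using tau_open_strip[OF edge[of k], of "pos n e k z"] link[of k]
      by (cases "k < j") (simp_all add: pos_Suc add.assoc[symmetric])
  qed (simp add: z)
  have cyl: "i \<le> k \<longrightarrow> pos n e k z \<in> interior (edge_cyl (n + k) (e k))" if "k \<le> j" for k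
    using that
  proof (induction k rule: int_le_induct)
    case (step k)
    show ?case
    proof
      assume "i \<le> k - 1"
      then have "pos n e k z \<in> interior (cyl (n + k) (src (e k)))"
        using step interior_mono[OF edge_cyl_subset[OF edge[of k]]] by auto
      then have "tau (n + (k - 1)) (edge_label (e (k - 1))) (pos n e (k - 1) z)
          \<in> interior (cyl (n + (k - 1) + 1) (rng (e (k - 1))))"
        using link[of "k - 1"] pos_Suc[of n e "k - 1" z] step \<open>i \<le> k - 1\<close> by simp
      then show "pos n e (k - 1) z \<in> interior (edge_cyl (n + (k - 1)) (e (k - 1)))"
        by (simp add: interior_edge_cyl)
    qed
  qed (simp add: z)
  show "z \<in> window n e i j"
    using strip cyl by (auto simp: window_def interior_edge_box)
qed (use assms in \<open>auto simp: window_def interior_edge_box\<close>)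

text \<open>A point of the last cylinder is pulled back to level \<open>n\<close> and then slid
  along \<open>U\<close> until its first height is admissible; sliding does not disturb the
  cylinder.\<close>

lemma window_nonempty:
  assumes "chain n e i j" "i \<le> j" "0 < W (n + i) $ src (e i)"
  shows "window n e i j \<noteq> {}"
proof -
  obtain w where w: "w \<in> interior (edge_cyl (n + j) (e j))"
    using interior_edge_cyl_nonempty by blast
  obtain z where z: "pos n e j z = w" using pos_surj by blast
  \<comment> \<open>This shift puts the height at index \<open>i\<close> in the middle of the first
    open strip.\<close>
  define t where "t = (W (n + i) $ src (e i) / 2 - pos n e i z \<bullet> W (n + i)) / (U (n + i) \<bullet> W (n + i))"
  have t: "t * (U (n + i) \<bullet> W (n + i)) = W (n + i) $ src (e i) / 2 - pos n e i z \<bullet> W (n + i)"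
    using UW_pos[of "n + i"] by (simp add: t_def)
  have shift: "x + t *\<^sub>R U m \<in> cyl m a \<longleftrightarrow> x \<in> cyl m a" for x m a t
    by (simp add: cyl_def P_add)
  have "w + t *\<^sub>R U (n + j) \<in> interior (edge_cyl (n + j) (e j))"
  proof -
    have "w + t *\<^sub>R U (n + j) \<in> (+) (t *\<^sub>R U (n + j)) ` interior (edge_cyl (n + j) (e j))"
      using w by (auto simp: add.commute)
    moreover have "(+) (t *\<^sub>R U (n + j)) ` edge_cyl (n + j) (e j) \<subseteq> edge_cyl (n + j) (e j)"
      using N_U[of "n + j"] shift
      by (auto simp: edge_cyl_def tau_add add.commute[of "t *\<^sub>R U (n + j)"] matrix_vector_mult_scaleR)
    ultimately show ?thesis
      using interior_translation interior_mono by blast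
  qed
  moreover have "pos n e i z + t *\<^sub>R U (n + i) \<in> open_strip (n + i) (src (e i))"
    using assms(3) t by (simp add: open_strip_def inner_add_left)
  ultimately have "z + t *\<^sub>R U n \<in> window n e i j"
    by (simp add: window_eq[OF assms(1,2)] pos_add_U z)
  then show ?thesis by auto
qed

lemma open_box_iff:
  "x \<in> open_box \<sigma> u v n e \<longleftrightarrow> (\<exists>z\<in>interior (ebox n e). x = (n, abs_torus z))"
  by (auto simp: open_box_def level_def)

lemma window_pullback:
  assumes "z \<in> window n e i j" "i \<le> k" "k \<le> j"
  shows "(n, abs_torus z) \<in> pullback F k (open_box \<sigma> u v (n + k) (e k))"
proof -
  have "pos n e k z \<in> interior (ebox (n + k) (e k))"
    using assms by (auto simp: window_def)
  then show ?thesis by (auto simp: pullback_F iterF_pos[of k n z e] open_box_iff)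
qed

text \<open>Starting from a representative at index 0, \<open>lift_step\<close> forces the lifted
  orbit to hit the prescribed boxes themselves and not merely integer translates, in both
  directions; the links of the chain come out as well.\<close>

lemma pullback_window:
  assumes "\<And>k. i \<le> k \<Longrightarrow> k \<le> j \<Longrightarrow> e k \<in> edges \<sigma> (n + k)" "i \<le> 0" "0 \<le> j"
    and x: "\<And>k. i \<le> k \<Longrightarrow> k \<le> j \<Longrightarrow> x \<in> pullback F k (open_box \<sigma> u v (n + k) (e k))"
  shows "\<exists>z\<in>window n e i j. x = (n, abs_torus z) \<and> chain n e i j"
proof -
  obtain z where z: "z \<in> interior (ebox n (e 0))" and xz: "x = (n, abs_torus z)"
    using x[of 0] assms by (auto simp: pullback_F open_box_iff)
  have rep: "\<exists>w\<in>interior (ebox (n + k) (e k)). pos n e k z - w \<in> int_vecs"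
    if "i \<le> k" "k \<le> j" for k
    using x[OF that] by (auto simp: pullback_F xz iterF_pos[of k n z e] open_box_iff abs_torus_eq_iff)
  have up: "k \<le> j \<longrightarrow> pos n e k z \<in> interior (ebox (n + k) (e k))" if "0 \<le> k" for k
    using that
  proof (induction k rule: int_ge_induct)
    case (step k)
    show ?case
    proof
      assume k: "k + 1 \<le> j"
      obtain w where w: "w \<in> interior (ebox (n + (k + 1)) (e (k + 1)))" "pos n e (k + 1) z - w \<in> int_vecs"
        using rep[of "k + 1"] k step assms(2) by auto
      then have "tau (n + k) (edge_label (e k)) (pos n e k z) = w"
        using lift_step[of "e k" "n + k" "e (k + 1)" "pos n e k z" w] assms(1)[of k] assms(1)[of "k + 1"] assms(2) step k
        by (auto simp: pos_Suc add.assoc)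
      then show "pos n e (k + 1) z \<in> interior (ebox (n + (k + 1)) (e (k + 1)))"
        using w by (simp add: pos_Suc)
    qed
  qed (simp add: z)
  have down: "i \<le> k \<longrightarrow> pos n e k z \<in> interior (ebox (n + k) (e k))" if "k \<le> 0" for k
    using that
  proof (induction k rule: int_le_induct)
    case (step k)
    show ?case
    proof
      assume k: "i \<le> k - 1"
      let ?m = "n + (k - 1)"
      obtain w where w: "w \<in> interior (ebox ?m (e (k - 1)))" "pos n e (k - 1) z - w \<in> int_vecs"
        using rep[of "k - 1"] k step assms(3) by auto
      \<comment> \<open>Backwards the known point is the image, so the representative
        \<open>w\<close> is pushed forward and compared with \<open>pos n e k z\<close>.\<close>
      have "tau ?m (edge_label (e (k - 1))) w - tau ?m (edge_label (e (k - 1))) (pos n e (k - 1) z)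
        = - (N ?m *v (pos n e (k - 1) z - w))"
        by (simp add: tau_def matrix_vector_mult_diff_distrib matrix_vector_right_distrib)
      then have "tau ?m (edge_label (e (k - 1))) w - pos n e k z \<in> int_vecs"
        using int_vecs_minus[OF N_int_vecs[OF w(2)]] pos_Suc[of n e "k - 1" z] by simp
      then have "tau ?m (edge_label (e (k - 1))) w = pos n e k z"
        using lift_step[of "e (k - 1)" ?m "e k" w "pos n e k z"] assms(1)[of k] assms(1)[of "k - 1"] assms(3) step k w
        by auto
      then have "pos n e (k - 1) z = w"
        using pos_Suc_iff[of n e "k - 1" z w] by simp
      then show "pos n e (k - 1) z \<in> interior (ebox ?m (e (k - 1)))" using w by simp
    qed
  qed (simp add: z)
  have all: "pos n e k z \<in> interior (ebox (n + k) (e k))" if "i \<le> k" "k \<le> j" for k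
    using up[of k] down[of k] that by linarith
  have "rng (e k) = src (e (k + 1))" if "i \<le> k" "k < j" for k
    using lift_step[of "e k" "n + k" "e (k + 1)" "pos n e k z" "pos n e (k + 1) z"] assms(1)[of k] assms(1)[of "k + 1"]
      all[of k] all[of "k + 1"] that by (auto simp: pos_Suc add.assoc)
  then show ?thesis
    using all xz assms(1) by (intro bexI[of _ z]) (auto simp: window_def chain_def)
qed

end

section \<open>The Markov property\<close>

lemma vimage_abs_torus_image: "abs_torus -` (abs_torus ` S) = (\<Union>x\<in>int_vecs. (+) x ` S)"
proof (intro set_eqI iffI)
  fix z assume "z \<in> abs_torus -` (abs_torus ` S)"
  then obtain s where "s \<in> S" "z - s \<in> int_vecs" by (auto simp: abs_torus_eq_iff)
  then show "z \<in> (\<Union>x\<in>int_vecs. (+) x ` S)"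
    by (intro UN_I[of "z - s"] image_eqI[of _ _ s]) auto
next
  fix z assume "z \<in> (\<Union>x\<in>int_vecs. (+) x ` S)"
  then obtain x s where "x \<in> int_vecs" "s \<in> S" "z = x + s" by auto
  then show "z \<in> abs_torus -` (abs_torus ` S)"
    by (auto simp: abs_torus_eq_iff intro!: image_eqI[of _ _ s])
qed

lemma open_abs_torus_image: "open S \<Longrightarrow> open (abs_torus ` S)"
  by (simp add: open_torus_def vimage_abs_torus_image open_UN open_translation)

lemma closed_torus_iff: "closed S \<longleftrightarrow> closed (abs_torus -` S)"
  by (simp add: closed_def open_torus_def vimage_Compl)

lemma closed_abs_torus_image:
  assumes "compact S"
  shows "closed (abs_torus ` S)"
proof -
  have "(\<Union>x\<in>int_vecs. (+) x ` S) = (\<Union>x\<in>int_vecs. \<Union>y\<in>S. {x + y})" by auto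
  then show ?thesis
    using assms by (simp add: closed_torus_iff vimage_abs_torus_image closed_compact_sums int_vecs_subset_closed)
qed

text \<open>Pigeonhole: otherwise each of \<open>CARD('a)\<close> consecutive intervals of length
  \<delta> above \<open>f y\<close> contains a value of \<open>f\<close>, and the points taking
  these values are distinct and different from \<open>y\<close>.\<close>

lemma bounded_gaps_spread:
  fixes f :: "'a::finite \<Rightarrow> real" and \<delta> :: real
  assumes "\<delta> \<ge> 0"
    and gap: "\<And>\<theta> x y. f x \<le> \<theta> \<Longrightarrow> f y > \<theta> + \<delta> \<Longrightarrow> \<exists>z. \<theta> < f z \<and> f z \<le> \<theta> + \<delta>"
  shows "f x \<le> f y + CARD('a) * \<delta>"
proof (rule ccontr)
  assume *: "\<not> ?thesis"
  have "\<exists>z. f y + k * \<delta> < f z \<and> f z \<le> f y + k * \<delta> + \<delta>" if "k < CARD('a)" for k :: nat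
  proof (rule gap[of y _ x])
    have "(real k + 1) * \<delta> \<le> CARD('a) * \<delta>"
      using that assms(1) by (intro mult_right_mono) auto
    then show "f y + k * \<delta> + \<delta> < f x"
      using * by (simp add: algebra_simps)
  qed (use assms in simp)
  then obtain g where g: "\<And>k. k < CARD('a) \<Longrightarrow> f y + k * \<delta> < f (g k) \<and> f (g k) \<le> f y + k * \<delta> + \<delta>"
    by metis
  have ne: "g j \<noteq> g k" if "j < k" "k < CARD('a)" for j k
  proof -
    have "(real j + 1) * \<delta> \<le> k * \<delta>"
      using that assms(1) by (intro mult_right_mono) auto
    then show ?thesis
      using g[of j] g[of k] that by (auto simp: algebra_simps)
  qed
  then have "inj_on g {..<CARD('a)}"
    by (auto intro!: inj_onI) (metis linorder_neqE_nat)
  moreover have "g ` {..<CARD('a)} \<subseteq> UNIV - {y}"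
  proof -
    have "f y < f (g k)" if "k < CARD('a)" for k
      using g[OF that] assms(1) by (smt (verit) mult_nonneg_nonneg of_nat_0_le_iff)
    then show ?thesis by fastforce
  qed
  ultimately have "CARD('a) \<le> card (UNIV - {y})"
    by (metis card_inj_on_le card_lessThan finite)
  then show False
    using card_Diff1_less[of "UNIV :: 'a set" y] by (meson UNIV_I finite leD)
qed

context rauzy_tiling
begin

lemma open_open_box: "open (open_box \<sigma> u v n e)"
  unfolding open_box_def level_def
  by (intro open_Times open_abs_torus_image open_interior) (simp add: open_discrete)

lemma open_box_disjoint:
  assumes "e \<in> edges \<sigma> n" "e' \<in> edges \<sigma> n" "x \<in> open_box \<sigma> u v n e" "x \<in> open_box \<sigma> u v n e'"
  shows "e = e'"
proof -
  obtain z z' where z: "z \<in> interior (ebox n e)" "z' \<in> interior (ebox n e')" "z' - z \<in> int_vecs"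
    using assms(4,3) by (auto simp: open_box_iff abs_torus_eq_iff)
  then show ?thesis
    using lattice_tiling.interior_overlap[OF edge_tiling[of n] z(3) assms(1,2) z(1)] by simp
qed

lemma open_boxes_dense: "level n UNIV \<subseteq> (\<Union>e\<in>edges \<sigma> n. closure (open_box \<sigma> u v n e))"
proof
  fix x assume "x \<in> level n (UNIV :: 'd torus set)"
  then obtain t where x: "x = (n, abs_torus t)"
    using abs_torus_surj by (auto simp: level_def)
  let ?S = "\<Union>e\<in>edges \<sigma> n. open_box \<sigma> u v n e"
  have "x \<in> closure ?S"
  proof (rule ccontr)
    assume "x \<notin> closure ?S"
    let ?V = "(\<lambda>z. (n, abs_torus z)) -` (- closure ?S)"
    have "open ?V"
      by (intro open_vimage open_Compl closed_closure continuous_intros continuous_abs_torus)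
    moreover have "t \<in> ?V" using \<open>x \<notin> closure ?S\<close> x by simp
    ultimately obtain z y e where z: "z \<in> ?V" "y \<in> int_vecs" "e \<in> edges \<sigma> n" "z - y \<in> interior (ebox n e)"
      using lattice_tiling.interiors_dense[OF edge_tiling[of n], of ?V] by blast
    have "abs_torus z = abs_torus (z - y)" using z(2) by (simp add: abs_torus_eq_iff)
    then have "(n, abs_torus z) \<in> ?S" using z by (auto simp: open_box_iff)
    then show False using z(1) closure_subset[of ?S] by auto
  qed
  moreover have "closure ?S \<subseteq> (\<Union>e\<in>edges \<sigma> n. closure (open_box \<sigma> u v n e))"
    using closure_subset finite_edges by (intro closure_minimal closed_UN) blast+
  ultimately show "x \<in> (\<Union>e\<in>edges \<sigma> n. closure (open_box \<sigma> u v n e))" by blast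
qed

text \<open>Every nonempty intersection of two consecutive boxes is lifted and yields a link of the
  diagram. A linked sequence is a chain, and the window of a chain is nonempty once its first height
  is positive.\<close>

theorem markov: "markov_partition F (edges \<sigma>) (open_box \<sigma> u v)"
  unfolding markov_partition_def
proof (intro conjI allI impI)
  fix n
  show "topological_partition (level n UNIV) (edges \<sigma> n) (open_box \<sigma> u v n)"
    unfolding topological_partition_def
  proof (intro conjI ballI)
    fix e assume "e \<in> edges \<sigma> n"
    have "open_box \<sigma> u v n e \<subseteq> level n UNIV" by (auto simp: open_box_def level_def)
    then show "openin (top_of_set (level n UNIV)) (open_box \<sigma> u v n e)"
      by (intro open_subset open_open_box)
  next
    show "disjoint_family_on (open_box \<sigma> u v n) (edges \<sigma> n)"
      unfolding disjoint_family_on_def using open_box_disjoint by blast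
  qed (use finite_edges open_boxes_dense in auto)
next
  fix i :: "int \<Rightarrow> 'd edge" and n m :: int
  assume i: "\<forall>k. i k \<in> edges \<sigma> k" and m: "2 \<le> m"
    and *: "\<forall>k\<in>{n..n + m - 1}. open_box \<sigma> u v k (i k) \<inter> pullback F 1 (open_box \<sigma> u v (k + 1) (i (k + 1))) \<noteq> {}"
  let ?e = "\<lambda>j. i (n + j)"
  have link: "rng (i k) = src (i (k + 1))" if k: "k \<in> {n..n + m - 1}" for k
  proof -
    obtain x where x: "x \<in> open_box \<sigma> u v k (i k)" "x \<in> pullback F 1 (open_box \<sigma> u v (k + 1) (i (k + 1)))"
      using * k by blast
    have "x \<in> pullback F j (open_box \<sigma> u v (k + j) (i (k + j)))" if "0 \<le> j" "j \<le> 1" for j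
    proof -
      have "j = 0 \<or> j = 1" using that by auto
      then show ?thesis using x by (auto simp: pullback_F)
    qed
    then have "chain k (\<lambda>j. i (k + j)) 0 1"
      using pullback_window[of 0 1 "\<lambda>j. i (k + j)" k x] i by auto
    then show ?thesis by (auto simp: chain_def)
  qed
  have "chain n ?e 0 m"
    using link i by (auto simp: chain_def add.assoc[symmetric])
  \<comment> \<open>Positivity cannot come from primitivity here; it holds because the first open
    box is met by assumption.\<close>
  moreover have "0 < W (n + 0) $ src (?e 0)"
  proof -
    obtain x where "x \<in> open_box \<sigma> u v n (i n)"
      using * m by force
    then show ?thesis by (force simp: open_box_iff interior_edge_box open_strip_def)
  qed
  ultimately obtain z where z: "z \<in> window n ?e 0 m"
    using window_nonempty[of n ?e 0 m] m by auto
  have "(n, abs_torus z) \<in> (\<Inter>j\<in>{0..m}. pullback F j (open_box \<sigma> u v (n + j) (i (n + j))))"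
    using window_pullback[OF z] by auto
  then show "(\<Inter>j\<in>{0..m}. pullback F j (open_box \<sigma> u v (n + j) (i (n + j)))) \<noteq> {}" by blast
qed

section \<open>Growth of block matrices and decay of the eigenvectors\<close>

lemma B_entry: "B n m $ a $ b = real (count_list (block \<sigma> n m [b]) a)"
  by (simp add: incidence_def)

lemma B_nonneg: "0 \<le> B n m $ a $ b"
  by (simp add: B_entry)

lemma B_ge_1_iff: "1 \<le> B n m $ a $ b \<longleftrightarrow> B n m $ a $ b \<noteq> 0"
  by (auto simp: B_entry Suc_le_eq)

lemma B_column_ge_1: "\<exists>a. 1 \<le> B n m $ a $ b"
proof (rule ccontr)
  assume "\<not> ?thesis"
  then have "B n m *v axis b 1 = 0"
    by (simp add: B_ge_1_iff matrix_vector_mult_basis column_def vec_eq_iff)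
  then show False using inj_B[of n m "axis b 1" 0] by (simp add: axis_eq_0_iff)
qed

lemma B_row_ge_1: "\<exists>b. 1 \<le> B n m $ a $ b"
proof (rule ccontr)
  assume "\<not> ?thesis"
  then have "(B n m *v x) $ a = 0" for x
    by (simp add: B_ge_1_iff matrix_vector_mult_def)
  then have "(B n m *v (matrix_inv (B n m) *v axis a 1)) $ a = 0" .
  then show False by (simp add: matrix_inv_vector[OF invertible_B])
qed

lemma B_prod_ge:
  assumes "n \<le> m" "m \<le> k" "\<And>c. 0 \<le> K c" "\<And>c. K c \<le> B n m $ a $ c * B m k $ c $ b"
  shows "sum K UNIV \<le> B n k $ a $ b"
  using assms(4) by (simp add: B_split[OF assms(1,2)] matrix_matrix_mult_def sum_mono)

lemma B_mult_ge:
  assumes "n \<le> m" "m \<le> k"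
  shows "B n m $ a $ c * B m k $ c $ b \<le> B n k $ a $ b"
  unfolding B_split[OF assms] matrix_matrix_mult_def
  by (simp add: member_le_sum[of c UNIV "\<lambda>c. B n m $ a $ c * B m k $ c $ b"] B_nonneg)

text \<open>An entry of the product has \<open>CARD('d)\<close>, hence at least two, summands, each
  at least \<open>K\<close>.\<close>

lemma B_growth_step:
  assumes "n \<le> m" "m \<le> k" "K \<ge> 0" "\<And>a b. K \<le> B n m $ a $ b" "\<And>a b. 1 \<le> B m k $ a $ b"
  shows "2 * K \<le> B n k $ a $ b"
proof -
  have "2 * K \<le> CARD('d) * K"
    using two_letters assms(3) by (intro mult_right_mono) auto
  also have "\<dots> = (\<Sum>c\<in>(UNIV :: 'd set). K)" by simp
  also have "\<dots> \<le> B n k $ a $ b"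
  proof (rule B_prod_ge[OF assms(1,2)])
    show "K \<le> B n m $ a $ c * B m k $ c $ b" for c
      using mult_mono[OF assms(4)[of a c] assms(5)[of c b]] assms(3) B_nonneg by simp
  qed (use assms in auto)
  finally show ?thesis .
qed

lemma B_growth_step':
  assumes "n \<le> m" "m \<le> k" "K \<ge> 0" "\<And>a b. 1 \<le> B n m $ a $ b" "\<And>a b. K \<le> B m k $ a $ b"
  shows "2 * K \<le> B n k $ a $ b"
proof -
  have "2 * K \<le> CARD('d) * K"
    using two_letters assms(3) by (intro mult_right_mono) auto
  also have "\<dots> = (\<Sum>c\<in>(UNIV :: 'd set). K)" by simp
  also have "\<dots> \<le> B n k $ a $ b"
  proof (rule B_prod_ge[OF assms(1,2)])
    show "K \<le> B n m $ a $ c * B m k $ c $ b" for c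
      using mult_mono[OF assms(4)[of a c] assms(5)[of c b]] assms(3) B_nonneg by simp
  qed (use assms in auto)
  finally show ?thesis .
qed

lemma positive_B_iff: "positive_matrix (B n m) \<longleftrightarrow> (\<forall>a b. 1 \<le> B n m $ a $ b)"
  by (auto simp: positive_matrix_def B_entry Suc_le_eq)

lemma prim_ge_1: "\<exists>m>n. \<forall>a b. 1 \<le> B n m $ a $ b"
  using prim unfolding primitive_def positive_B_iff by blast

lemma B_growth_pow: "\<exists>m\<ge>n. \<forall>a b. 2 ^ K \<le> B n m $ a $ b"
proof (induction K)
  case 0
  then show ?case using prim_ge_1[of n] by (auto intro: less_imp_le)
next
  case (Suc K)
  then obtain m where m: "m \<ge> n" "\<forall>a b. 2 ^ K \<le> B n m $ a $ b" by blast
  obtain k where "k > m" "\<forall>a b. 1 \<le> B m k $ a $ b" using prim_ge_1 by blast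
  then show ?case
    using B_growth_step[of n m k "2 ^ K"] m by (intro exI[of _ k]) auto
qed

text \<open>A bound reached at one level persists at all later ones because an invertible integer
  matrix with nonnegative entries has an entry at least 1 in every column.\<close>

lemma B_growth: "\<exists>m\<ge>n. \<forall>k\<ge>m. \<forall>a b. K \<le> B n k $ a $ b"
proof -
  obtain j where j: "K < 2 ^ j" using real_arch_pow[of 2 K] by auto
  obtain m where m: "m \<ge> n" "\<forall>a b. 2 ^ j \<le> B n m $ a $ b" using B_growth_pow by blast
  have "K \<le> B n k $ a $ b" if k: "k \<ge> m" for k a b
  proof -
    obtain c where c: "1 \<le> B m k $ c $ b" using B_column_ge_1 by blast
    have "2 ^ j * 1 \<le> B n m $ a $ c * B m k $ c $ b"
      using m c B_nonneg by (intro mult_mono) auto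
    then show ?thesis using B_mult_ge[OF m(1) k, of a c b] j by linarith
  qed
  then show ?thesis using m(1) by blast
qed

text \<open>The mirror image of \<open>B_growth\<close>, with positive blocks attached on the left
  and nonzero rows in place of nonzero columns.\<close>

lemma B_growth_back:
  assumes "two_sided_primitive \<sigma>"
  shows "\<exists>m\<le>n. \<forall>k\<le>m. \<forall>a b. K \<le> B k n $ a $ b"
proof -
  have two: "\<exists>m<n. \<forall>a b. 1 \<le> B m n $ a $ b" for n
    using assms unfolding two_sided_primitive_def positive_B_iff by blast
  have pow: "\<exists>m\<le>n. \<forall>a b. 2 ^ K \<le> B m n $ a $ b" for K
  proof (induction K)
    case 0
    then show ?case using two[of n] by (auto intro: less_imp_le)
  next
    case (Suc K)
    then obtain m where m: "m \<le> n" "\<forall>a b. 2 ^ K \<le> B m n $ a $ b" by blast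
    obtain k where "k < m" "\<forall>a b. 1 \<le> B k m $ a $ b" using two by blast
    then show ?case
      using B_growth_step'[of k m n "2 ^ K"] m by (intro exI[of _ k]) auto
  qed
  obtain j where j: "K < 2 ^ j" using real_arch_pow[of 2 K] by auto
  obtain m where m: "m \<le> n" "\<forall>a b. 2 ^ j \<le> B m n $ a $ b" using pow by blast
  have "K \<le> B k n $ a $ b" if k: "k \<le> m" for k a b
  proof -
    obtain c where c: "1 \<le> B k m $ a $ c" using B_row_ge_1 by blast
    have "1 * 2 ^ j \<le> B k m $ a $ c * B m n $ c $ b"
      using m c B_nonneg by (intro mult_mono) auto
    then show ?thesis using B_mult_ge[OF k m(1), of a c b] j by linarith
  qed
  then show ?thesis using m(1) by blast
qed

text \<open>The fixed vector \<open>U n\<close> equals \<open>B n m *v U m\<close>, so huge entries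
  of the block force \<open>U m\<close> to be small. \<open>W_small\<close> uses the same mechanism
  in the past.\<close>

lemma U_small:
  assumes "\<epsilon> > 0"
  shows "\<exists>m\<ge>n. (\<Sum>b\<in>UNIV. U m $ b) < \<epsilon>"
proof -
  fix a :: 'd
  \<comment> \<open>The summand 1 makes the final comparison with \<open>?K * \<epsilon>\<close>
    strict.\<close>
  let ?K = "U n $ a / \<epsilon> + 1"
  have K: "?K > 0" using U_pos[of n a] assms by (simp add: add_pos_pos)
  obtain m where m: "m \<ge> n" "\<And>a b. ?K \<le> B n m $ a $ b" using B_growth by blast
  have "?K * (\<Sum>b\<in>UNIV. U m $ b) \<le> (\<Sum>b\<in>UNIV. B n m $ a $ b * U m $ b)"
    unfolding sum_distrib_left using m U_nonneg by (intro sum_mono mult_right_mono) auto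
  also have "\<dots> = U n $ a"
    using U_B[OF m(1)] by (simp add: matrix_vector_mult_def vec_eq_iff)
  also have "\<dots> < ?K * \<epsilon>" using assms by (simp add: field_simps)
  finally show ?thesis using m(1) K by (auto simp: mult_less_cancel_left_pos)
qed

lemma W_sum: "m \<le> n \<Longrightarrow> (\<Sum>c\<in>UNIV. B m n $ c $ a * W m $ c) = W n $ a"
  using W_B[of m n "axis a 1"] unfolding axis_W
  by (simp add: matrix_vector_mult_basis column_def inner_vec_def)

lemma W_small:
  assumes "two_sided_primitive \<sigma>" "\<epsilon> > 0"
  shows "\<exists>m\<le>n. \<forall>k\<le>m. \<forall>a. W k $ a < \<epsilon>"
proof -
  fix b :: 'd
  let ?K = "W n $ b / \<epsilon> + 1"
  have K: "?K > 0" using W_nonneg[of n b] assms(2) by (simp add: add_nonneg_pos)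
  obtain m where m: "m \<le> n" "\<And>k a b. k \<le> m \<Longrightarrow> ?K \<le> B k n $ a $ b"
    using B_growth_back[OF assms(1)] by blast
  have "W k $ a < \<epsilon>" if k: "k \<le> m" for k a
  proof -
    have "?K * W k $ a \<le> B k n $ a $ b * W k $ a"
      using m(2)[OF k] W_nonneg by (intro mult_right_mono) auto
    also have "\<dots> \<le> (\<Sum>c\<in>UNIV. B k n $ c $ b * W k $ c)"
      using B_nonneg W_nonneg by (intro member_le_sum) auto
    also have "\<dots> = W n $ b"
      using W_sum k m(1) by simp
    also have "\<dots> < ?K * \<epsilon>" using assms by (simp add: field_simps)
    finally show ?thesis using K by (simp add: mult_less_cancel_left_pos)
  qed
  then show ?thesis using m(1) by blast
qed

lemma W_pos:
  assumes "two_sided_primitive \<sigma>"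
  shows "0 < W n $ a"
proof -
  obtain m where m: "m \<le> n" "\<And>a b. 1 \<le> B m n $ a $ b"
    using B_growth_back[OF assms, of n 1] by blast
  obtain c where c: "W m $ c \<noteq> 0" using W_nonzero[of m] by (auto simp: vec_eq_iff)
  have "0 < W m $ c" using c W_nonneg[of m c] by simp
  also have "1 * W m $ c \<le> B m n $ c $ a * W m $ c"
    using m(2) W_nonneg by (intro mult_right_mono) auto
  also have "\<dots> \<le> (\<Sum>c\<in>UNIV. B m n $ c $ a * W m $ c)"
    using B_nonneg W_nonneg by (intro member_le_sum) auto
  also have "\<dots> = W n $ a"
    by (rule W_sum[OF m(1)])
  finally show ?thesis by simp
qed

text \<open>If \<open>c\<close> were a nonzero integer vector orthogonal to \<open>U n\<close>, then all tiles would lie in the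
  hyperplanes on which \<open>c\<close> takes integer values.\<close>

lemma rational_independence:
  assumes c: "c \<in> int_vecs" "c \<bullet> U n = 0"
  shows "c = 0"
proof (rule ccontr)
  assume "c \<noteq> 0"
  have int: "x \<bullet> c \<in> \<int>" if "x \<in> int_vecs" for x
    using that c(1) by (auto simp: inner_vec_def int_vecs_def intro!: Ints_sum Ints_mult)
  have P: "P n x \<bullet> c = x \<bullet> c" for x
    using c(2) by (simp add: proj_eq inner_diff_left inner_commute[of "U n" c])
  have "closed ((\<lambda>y. y \<bullet> c) -` \<int>)"
    by (intro closed_vimage closed_Ints continuous_intros)
  then have "R n a \<subseteq> (\<lambda>y. y \<bullet> c) -` \<int>" for a
    unfolding subtile_def by (intro closure_minimal) (auto simp: P int abelianization_int_vecs)
  then have R: "y \<bullet> c \<in> \<int>" if "y \<in> R n a" for y a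
    using that by auto
  have "z \<bullet> c \<in> \<int>" for z
  proof -
    obtain x a where x: "x \<in> int_vecs" "z - x \<in> rbox n a"
      using lattice_tiling.cover[OF box_tiling[of n]] by blast
    then have "- P n (z - x) \<bullet> c \<in> \<int>" by (intro R[of _ a]) (simp add: box_eq cyl_def)
    then have "(z - x) \<bullet> c \<in> \<int>" by (simp add: P)
    then have "(z - x) \<bullet> c + x \<bullet> c \<in> \<int>" using int[OF x(1)] Ints_add by blast
    then show ?thesis by (simp add: inner_diff_left)
  qed
  then have "((1 / (2 * (c \<bullet> c))) *\<^sub>R c) \<bullet> c \<in> \<int>" .
  then have "(1/2 :: real) \<in> \<int>" using \<open>c \<noteq> 0\<close> by simp
  then obtain k where "(1/2 :: real) = of_int k" by (auto elim: Ints_cases)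
  then have "of_int (2 * k) = (of_int 1 :: real)" by simp
  then have "2 * k = 1" using of_int_eq_iff by blast
  then show False by presburger
qed

section \<open>Contraction of the subtiles\<close>

lemma R_nonempty: "R n a \<noteq> {}"
proof -
  obtain z where "z \<in> cyl n a" using interior_cyl_nonempty interior_subset by blast
  then show ?thesis by (auto simp: cyl_def)
qed

text \<open>Coordinate \<open>i\<close>, seen from level \<open>N\<^sub>0\<close>, of vectors of level \<open>n\<close>; \<open>lo\<close> and \<open>hi\<close>
  bound the values on a subtile and \<open>off\<close> is the displacement caused by a word.\<close>

definition coord :: "int \<Rightarrow> 'd \<Rightarrow> int \<Rightarrow> real ^ 'd \<Rightarrow> real" where
  "coord N\<^sub>0 i n y = (B N\<^sub>0 n *v y) $ i"

definition lo :: "int \<Rightarrow> 'd \<Rightarrow> int \<Rightarrow> 'd \<Rightarrow> real" where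
  "lo N\<^sub>0 i n a = Inf (coord N\<^sub>0 i n ` R n a)"

definition hi :: "int \<Rightarrow> 'd \<Rightarrow> int \<Rightarrow> 'd \<Rightarrow> real" where
  "hi N\<^sub>0 i n a = Sup (coord N\<^sub>0 i n ` R n a)"

definition off :: "int \<Rightarrow> 'd \<Rightarrow> int \<Rightarrow> 'd list \<Rightarrow> real" where
  "off N\<^sub>0 i n p = coord N\<^sub>0 i n (P n (abelianization p))"

lemma continuous_coord: "continuous_on S (coord N\<^sub>0 i n)"
  unfolding coord_def by (intro continuous_intros matrix_vector_mult_linear_continuous_on)

lemma coord_add: "coord N\<^sub>0 i n (x + y) = coord N\<^sub>0 i n x + coord N\<^sub>0 i n y"
  by (simp add: coord_def matrix_vector_right_distrib)

lemma coord_B: "N\<^sub>0 \<le> n \<Longrightarrow> n \<le> m \<Longrightarrow> coord N\<^sub>0 i n (B n m *v y) = coord N\<^sub>0 i m y"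
  by (simp add: coord_def matrix_vector_mul_assoc flip: B_split)

lemma off_append: "off N\<^sub>0 i n (p @ q) = off N\<^sub>0 i n p + off N\<^sub>0 i n q"
  by (simp add: off_def abelianization_append P_add coord_add)

lemma off_Nil [simp]: "off N\<^sub>0 i n [] = 0"
  using off_append[of N\<^sub>0 i n "[]" "[]"] by simp

lemma compact_coord: "compact (coord N\<^sub>0 i n ` R n a)" "coord N\<^sub>0 i n ` R n a \<noteq> {}"
  by (auto intro: compact_continuous_image continuous_coord R_compact simp: R_nonempty)

lemma lo_le: "y \<in> R n a \<Longrightarrow> lo N\<^sub>0 i n a \<le> coord N\<^sub>0 i n y"
  unfolding lo_def using compact_coord(1)[of N\<^sub>0 i n a]
  by (intro cInf_lower) (auto dest: compact_imp_bounded bounded_imp_bdd_below)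

lemma hi_ge: "y \<in> R n a \<Longrightarrow> coord N\<^sub>0 i n y \<le> hi N\<^sub>0 i n a"
  unfolding hi_def using compact_coord(1)[of N\<^sub>0 i n a]
  by (intro cSup_upper) (auto dest: compact_imp_bounded bounded_imp_bdd_above)

lemma lo_attained: "\<exists>y\<in>R n a. coord N\<^sub>0 i n y = lo N\<^sub>0 i n a"
proof -
  have "Inf (coord N\<^sub>0 i n ` R n a) \<in> coord N\<^sub>0 i n ` R n a"
    using compact_coord[of N\<^sub>0 i n a]
    by (intro closed_contains_Inf) (auto dest: compact_imp_closed compact_imp_bounded bounded_imp_bdd_below)
  then show ?thesis by (auto simp: lo_def)
qed

lemma hi_attained: "\<exists>y\<in>R n a. coord N\<^sub>0 i n y = hi N\<^sub>0 i n a"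
proof -
  have "Sup (coord N\<^sub>0 i n ` R n a) \<in> coord N\<^sub>0 i n ` R n a"
    using compact_coord[of N\<^sub>0 i n a]
    by (intro closed_contains_Sup) (auto dest: compact_imp_closed compact_imp_bounded bounded_imp_bdd_above)
  then show ?thesis by (auto simp: hi_def)
qed

lemma lo_le_hi: "lo N\<^sub>0 i n a \<le> hi N\<^sub>0 i n a"
  using lo_attained hi_ge by metis

text \<open>\<open>R_block\<close> places a translated image of the subtile of \<open>b\<close>
  inside the subtile of \<open>a\<close>; comparing attained extreme values gives both
  inequalities.\<close>

lemma
  assumes "N\<^sub>0 \<le> n" "n \<le> m" "prefix (p @ [a]) (block \<sigma> n m [b])"
  shows lo_block: "lo N\<^sub>0 i n a \<le> off N\<^sub>0 i n p + lo N\<^sub>0 i m b"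
    and hi_block: "off N\<^sub>0 i n p + hi N\<^sub>0 i m b \<le> hi N\<^sub>0 i n a"
proof -
  have *: "coord N\<^sub>0 i n (P n (abelianization p) + B n m *v y) = off N\<^sub>0 i n p + coord N\<^sub>0 i m y" for y
    using assms by (simp add: coord_add coord_B off_def)
  show "lo N\<^sub>0 i n a \<le> off N\<^sub>0 i n p + lo N\<^sub>0 i m b"
    using lo_attained[of m b N\<^sub>0 i] lo_le[OF R_block[OF assms(2,3)]] * by metis
  show "off N\<^sub>0 i n p + hi N\<^sub>0 i m b \<le> hi N\<^sub>0 i n a"
    using hi_attained[of m b N\<^sub>0 i] hi_ge[OF R_block[OF assms(2,3)]] * by metis
qed

lemma B_prefix:
  assumes "1 \<le> B n m $ a $ b"
  shows "\<exists>p. prefix (p @ [a]) (block \<sigma> n m [b])"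
proof -
  have "a \<in> set (block \<sigma> n m [b])"
    by (rule ccontr) (use assms in \<open>simp add: B_entry\<close>)
  then show ?thesis by (auto simp: in_set_conv_decomp prefix_def)
qed

text \<open>All subtiles have asymptotically the same extent in the chosen coordinate, so the position of
  a subtile inside another one is determined up to a small error.\<close>

lemma lo_approx:
  assumes "\<epsilon> > 0"
  shows "\<exists>n\<^sub>0\<ge>N\<^sub>0. \<forall>n\<ge>n\<^sub>0. \<forall>m\<ge>n. \<forall>p a b. prefix (p @ [a]) (block \<sigma> n m [b]) \<longrightarrow>
    lo N\<^sub>0 i n a \<le> off N\<^sub>0 i n p + lo N\<^sub>0 i m b \<and> off N\<^sub>0 i n p + lo N\<^sub>0 i m b \<le> lo N\<^sub>0 i n a + \<epsilon>"
proof -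
  let ?len = "\<lambda>(n, a). hi N\<^sub>0 i n a - lo N\<^sub>0 i n a"
  \<comment> \<open>The limit length, taken as one infimum over all letters and all levels from
    \<open>N\<^sub>0\<close> on.\<close>
  let ?L = "Inf (?len ` ({N\<^sub>0..} \<times> UNIV))"
  have bdd: "bdd_below (?len ` ({N\<^sub>0..} \<times> UNIV))"
    using lo_le_hi by (intro bdd_belowI[of _ 0]) auto
  have L: "?L \<le> hi N\<^sub>0 i n a - lo N\<^sub>0 i n a" if "n \<ge> N\<^sub>0" for n a
    using cInf_lower[OF _ bdd, of "?len (n, a)"] that by force
  have "\<exists>x\<in>?len ` ({N\<^sub>0..} \<times> UNIV). x < ?L + \<epsilon>"
    using assms by (intro cInf_lessD) auto
  then obtain n\<^sub>1 a\<^sub>1 where n1: "n\<^sub>1 \<ge> N\<^sub>0" "hi N\<^sub>0 i n\<^sub>1 a\<^sub>1 - lo N\<^sub>0 i n\<^sub>1 a\<^sub>1 < ?L + \<epsilon>"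
    by auto
  obtain n\<^sub>0 where n0: "n\<^sub>0 \<ge> n\<^sub>1" "\<And>n a b. n \<ge> n\<^sub>0 \<Longrightarrow> 1 \<le> B n\<^sub>1 n $ a $ b"
    using B_growth by blast
  \<comment> \<open>From \<open>n\<^sub>0\<close> on every subtile sits, up to translation, inside
    the nearly shortest one of letter \<open>a\<^sub>1\<close>, so all lengths are close to
    \<open>?L\<close>.\<close>
  have len: "hi N\<^sub>0 i n a - lo N\<^sub>0 i n a \<le> ?L + \<epsilon>" if n: "n \<ge> n\<^sub>0" for n a
  proof -
    obtain p where p: "prefix (p @ [a\<^sub>1]) (block \<sigma> n\<^sub>1 n [a])" using B_prefix n0(2)[OF n] by blast
    have "n\<^sub>1 \<le> n" using n n0(1) by simp
    then show ?thesis
      using lo_block[OF n1(1) _ p, of i] hi_block[OF n1(1) _ p, of i] n1(2) by simp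
  qed
  \<comment> \<open>The inner interval has length at least \<open>?L\<close> and the outer one at
    most \<open>?L + \<epsilon>\<close>; since the inner upper end is below the outer one, the lower
    ends differ by at most \<epsilon>.\<close>
  have "off N\<^sub>0 i n p + lo N\<^sub>0 i m b \<le> lo N\<^sub>0 i n a + \<epsilon>"
    if "n \<ge> n\<^sub>0" "m \<ge> n" "prefix (p @ [a]) (block \<sigma> n m [b])" for n m p a b
    using hi_block[of N\<^sub>0 n m p a b i] len[of n a] L[of m b] that n0 n1 by simp
  moreover have "lo N\<^sub>0 i n a \<le> off N\<^sub>0 i n p + lo N\<^sub>0 i m b"
    if "n \<ge> n\<^sub>0" "m \<ge> n" "prefix (p @ [a]) (block \<sigma> n m [b])" for n m p a b
    using lo_block[of N\<^sub>0 n m p a b i] that n0 n1 by simp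
  ultimately show ?thesis using n0(1) n1(1) by (intro exI[of _ n\<^sub>0]) auto
qed

text \<open>\<open>U n\<close> combines the abelianized blocks with weights \<open>U m\<close>,
  whose sum is arbitrarily small. Bounded values on blocks thus force \<open>c\<close> to be
  orthogonal to \<open>U n\<close>, and rational independence applies.\<close>

lemma bounded_on_words_imp_zero:
  assumes "c \<in> int_vecs" "\<And>m b. m \<ge> n \<Longrightarrow> \<bar>c \<bullet> abelianization (block \<sigma> n m [b])\<bar> \<le> K"
  shows "c = 0"
proof (rule rational_independence[OF assms(1), of n], rule ccontr)
  assume ne: "c \<bullet> U n \<noteq> 0"
  have K: "K \<ge> 0" using assms(2)[of n undefined] by linarith
  obtain m where m: "m \<ge> n" "(\<Sum>b\<in>UNIV. U m $ b) < \<bar>c \<bullet> U n\<bar> / (K + 1)"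
    using U_small[of "\<bar>c \<bullet> U n\<bar> / (K + 1)" n] ne K by auto
  have "U n = (\<Sum>b\<in>UNIV. U m $ b *\<^sub>R abelianization (block \<sigma> n m [b]))"
  proof -
    have "U n = B n m *v U m" using U_B[OF m(1)] by simp
    also have "\<dots> = (\<Sum>b\<in>UNIV. U m $ b *\<^sub>R column b (B n m))"
      by (simp add: matrix_mult_sum scalar_mult_eq_scaleR)
    finally show ?thesis by (simp add: matrix_vector_mult_basis flip: incidence_column)
  qed
  then have "\<bar>c \<bullet> U n\<bar> = \<bar>\<Sum>b\<in>UNIV. U m $ b * (c \<bullet> abelianization (block \<sigma> n m [b]))\<bar>"
    by (simp add: inner_sum_right)
  also have "\<dots> \<le> (\<Sum>b\<in>UNIV. \<bar>U m $ b * (c \<bullet> abelianization (block \<sigma> n m [b]))\<bar>)"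
    by (rule sum_abs)
  also have "\<dots> \<le> (\<Sum>b\<in>UNIV. U m $ b * K)"
    using assms(2)[OF m(1)] U_nonneg by (intro sum_mono) (auto simp: abs_mult intro: mult_left_mono)
  also have "\<dots> = (\<Sum>b\<in>UNIV. U m $ b) * K" by (simp add: sum_distrib_right)
  also have "\<dots> \<le> (\<Sum>b\<in>UNIV. U m $ b) * (K + 1)"
    using U_nonneg by (intro mult_left_mono sum_nonneg) auto
  also have "\<dots> < \<bar>c \<bullet> U n\<bar>" using m(2) K by (simp add: field_simps)
  finally show False by simp
qed

text \<open>A gap in the values of \<open>lo\<close> would make the side of the gap on which a letter lies depend
  on the preceding letter only; the resulting coboundary is bounded on all words, so it vanishes by
  rational independence, and the side is the same for all letters.\<close>

lemma no_gap:
  assumes "\<epsilon> > 0" and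
    approx: "\<And>m p a b. m \<ge> n \<Longrightarrow> prefix (p @ [a]) (block \<sigma> n m [b]) \<Longrightarrow>
      lo N\<^sub>0 i n a \<le> off N\<^sub>0 i n p + lo N\<^sub>0 i m b \<and> off N\<^sub>0 i n p + lo N\<^sub>0 i m b \<le> lo N\<^sub>0 i n a + \<epsilon>"
    and low: "lo N\<^sub>0 i n x \<le> \<theta>" and high: "lo N\<^sub>0 i n y > \<theta> + 2 * \<epsilon>"
  shows "\<exists>z. \<theta> < lo N\<^sub>0 i n z \<and> lo N\<^sub>0 i n z \<le> \<theta> + 2 * \<epsilon>"
proof (rule ccontr)
  assume gap: "\<not> ?thesis"
  let ?l = "lo N\<^sub>0 i n" and ?q = "off N\<^sub>0 i n"
  define h where "h a = (if ?l a > \<theta> then 1 else 0 :: real)" for a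
  \<comment> \<open>The quantity \<open>?l a + ?q [a]\<close> predicts the value of
    \<open>?l\<close> at the next letter with error at most \<epsilon>. The threshold lies in the
    middle of a gap of width twice \<epsilon>, so \<open>t a\<close> is exactly the side of the next
    letter.\<close>
  define t where "t a = (if ?l a + ?q [a] > \<theta> + \<epsilon> then 1 else 0 :: real)" for a
  define c where "c = (\<chi> a. t a - h a)"
  have c_axis: "c \<bullet> axis a 1 = t a - h a" for a
    by (simp add: c_def inner_axis)
  have step: "t a = h a'" if "m \<ge> n" "prefix (p @ [a, a']) (block \<sigma> n m [b])" for m p a a' b
  proof -
    have "prefix (p @ [a]) (block \<sigma> n m [b])" "prefix ((p @ [a]) @ [a']) (block \<sigma> n m [b])"
      using that(2) append_prefixD[of "p @ [a]" "[a']"] by auto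
    note this[THEN approx[OF that(1)]]
    then show ?thesis using gap by (auto simp: h_def t_def off_append not_le not_less) 
  qed
  have telescope: "c \<bullet> abelianization (p @ [a]) = t a - h (hd (p @ [a]))"
    if "m \<ge> n" "prefix (p @ [a]) (block \<sigma> n m [b])" for m p a b
    using that(2)
  proof (induction p arbitrary: a rule: rev_induct)
    case Nil
    then show ?case by (simp add: abelianization_single c_axis)
  next
    case (snoc a' p)
    have "prefix (p @ [a']) (block \<sigma> n m [b])"
      using snoc.prems append_prefixD[of "p @ [a']" "[a]"] by auto
    then have "c \<bullet> abelianization (p @ [a']) = h a - h (hd (p @ [a']))"
      using snoc.IH step[OF that(1), of p a' a b] snoc.prems by simp
    then show ?case
      unfolding abelianization_append[of "p @ [a']" "[a]"] inner_add_right abelianization_single c_axis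
      by (simp add: hd_append)
  qed
  have "c = 0"
  proof (rule bounded_on_words_imp_zero[where K = 1])
    show "c \<in> int_vecs" by (auto simp: int_vecs_def c_def t_def h_def)
    fix m b assume m: "m \<ge> n"
    let ?w = "block \<sigma> n m [b]"
    have "?w \<noteq> []" using substitution_eq_Nil_iff[OF subst_block] by auto
    then obtain p a where w: "?w = p @ [a]" by (metis rev_exhaust)
    show "\<bar>c \<bullet> abelianization ?w\<bar> \<le> 1"
      using telescope[OF m, of p a b] by (simp add: w t_def h_def)
  qed
  obtain m where m: "m \<ge> n" "\<And>a b. 1 \<le> B n m $ a $ b"
    using B_growth[of n 1] by blast
  \<comment> \<open>Since \<open>c = 0\<close>, both \<open>t a = h a\<close> and, by telescoping,
    \<open>t a = h\<close> of the first letter hold; one block containing all letters makes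
    \<open>h\<close> constant.\<close>
  have "h a = h (hd (block \<sigma> n m [x]))" for a
  proof -
    obtain p where p: "prefix (p @ [a]) (block \<sigma> n m [x])"
      using B_prefix m(2) by blast
    then have "hd (p @ [a]) = hd (block \<sigma> n m [x])"
      by (metis hd_append2 prefix_def snoc_eq_iff_butlast)
    then show ?thesis
      using telescope[OF m(1) p] \<open>c = 0\<close> c_axis[of a] by simp
  qed
  then have "h x = h y" by metis
  then show False using low high assms(1) by (auto simp: h_def split: if_splits)
qed

text \<open>A prefix has displacement close to the difference of the lower ends of its next letter
  and of the first letter of the word, since the empty prefix has displacement 0. Without gaps, all
  lower ends are close to each other.\<close>

lemma coord_small:
  assumes "\<epsilon> > 0"
  shows "\<exists>n\<^sub>0\<ge>N\<^sub>0. \<forall>n\<ge>n\<^sub>0. \<forall>a. \<forall>y\<in>R n a. \<bar>coord N\<^sub>0 i n y\<bar> \<le> \<epsilon>"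
proof -
  \<comment> \<open>The spread costs at most \<open>CARD('d)\<close> gaps of width twice \<delta>,
    and the prediction error one more \<delta>.\<close>
  define \<delta> where "\<delta> = \<epsilon> / (2 * CARD('d) + 1)"
  have \<delta>: "\<delta> > 0" "CARD('d) * (2 * \<delta>) + \<delta> = \<epsilon>"
  proof -
    have "\<delta> * (2 * CARD('d) + 1) = \<epsilon>"
      unfolding \<delta>_def by (rule nonzero_eq_divide_eq[THEN iffD1]) auto
    then show "CARD('d) * (2 * \<delta>) + \<delta> = \<epsilon>" by (simp add: algebra_simps)
  qed (use assms in \<open>simp add: \<delta>_def add_pos_pos\<close>)
  obtain n\<^sub>0 where n0: "n\<^sub>0 \<ge> N\<^sub>0" and approx: "\<And>n m p a b. n \<ge> n\<^sub>0 \<Longrightarrow> m \<ge> n \<Longrightarrow> prefix (p @ [a]) (block \<sigma> n m [b]) \<Longrightarrow>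
    lo N\<^sub>0 i n a \<le> off N\<^sub>0 i n p + lo N\<^sub>0 i m b \<and> off N\<^sub>0 i n p + lo N\<^sub>0 i m b \<le> lo N\<^sub>0 i n a + \<delta>"
    using lo_approx[OF \<delta>(1), of N\<^sub>0 i] by blast
  have "\<bar>coord N\<^sub>0 i n y\<bar> \<le> \<epsilon>" if n: "n \<ge> n\<^sub>0" and y: "y \<in> R n a" for n a y
  proof -
    have spread: "lo N\<^sub>0 i n a \<le> lo N\<^sub>0 i n a' + CARD('d) * (2 * \<delta>)" for a a'
      using \<delta>(1) no_gap[OF \<delta>(1) approx[OF n]] by (intro bounded_gaps_spread) auto
    have "\<bar>off N\<^sub>0 i n p\<bar> \<le> \<epsilon>" if m: "m \<ge> n" and p: "prefix (p @ [a]) (block \<sigma> n m [b])" for p m b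
    proof -
      obtain a' w where w: "block \<sigma> n m [b] = a' # w"
        using substitution_eq_Nil_iff[OF subst_block, of n m "[b]"] by (cases "block \<sigma> n m [b]") auto
      then have "prefix ([] @ [a']) (block \<sigma> n m [b])" by simp
      from approx[OF n m this] approx[OF n m p] spread[of a a'] spread[of a' a] \<delta>
      show ?thesis by (simp only: off_Nil) linarith
    qed
    moreover have "\<exists>m b. m \<ge> n \<and> prefix (p @ [a]) (block \<sigma> n m [b])"
      if "infinite {(m, b). m \<ge> n \<and> prefix (p @ [a]) (block \<sigma> n m [b])}" for p
      using not_finite_existsD[OF that] by auto
    ultimately have "{P n (abelianization p) |p. infinite {(m, b). m \<ge> n \<and> prefix (p @ [a]) (block \<sigma> n m [b])}}
      \<subseteq> {y. \<bar>coord N\<^sub>0 i n y\<bar> \<le> \<epsilon>}"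
      unfolding off_def by blast
    moreover have "closed {y. \<bar>coord N\<^sub>0 i n y\<bar> \<le> \<epsilon>}"
      by (intro closed_Collect_le continuous_intros continuous_coord)
    ultimately have "R n a \<subseteq> {y. \<bar>coord N\<^sub>0 i n y\<bar> \<le> \<epsilon>}"
      unfolding subtile_def by (rule closure_minimal)
    then show ?thesis using y by blast
  qed
  then show ?thesis using n0 by blast
qed

lemma strong_convergence:
  assumes "\<epsilon> > 0"
  shows "\<exists>n\<^sub>0\<ge>N\<^sub>0. \<forall>n\<ge>n\<^sub>0. \<forall>a. \<forall>y\<in>R n a. norm (B N\<^sub>0 n *v y) \<le> \<epsilon>"
proof -
  have \<delta>: "\<epsilon> / CARD('d) > 0" using assms by simp
  have "\<forall>i. \<exists>n\<^sub>0\<ge>N\<^sub>0. \<forall>n\<ge>n\<^sub>0. \<forall>a. \<forall>y\<in>R n a. \<bar>coord N\<^sub>0 i n y\<bar> \<le> \<epsilon> / CARD('d)"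
    using coord_small[OF \<delta>] by blast
  then obtain f where f: "\<And>i. f i \<ge> N\<^sub>0"
    "\<And>i n a y. n \<ge> f i \<Longrightarrow> y \<in> R n a \<Longrightarrow> \<bar>coord N\<^sub>0 i n y\<bar> \<le> \<epsilon> / CARD('d)"
    by metis
  let ?n = "Max (range f)"
  have max: "f i \<le> ?n" for i by simp
  have "norm (B N\<^sub>0 n *v y) \<le> \<epsilon>" if n: "n \<ge> ?n" and y: "y \<in> R n a" for n a y
  proof -
    have "norm (B N\<^sub>0 n *v y) \<le> (\<Sum>i\<in>UNIV. \<bar>coord N\<^sub>0 i n y\<bar>)"
      unfolding coord_def by (rule norm_le_l1_cart)
    also have "\<dots> \<le> (\<Sum>i\<in>(UNIV :: 'd set). \<epsilon> / CARD('d))"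
      using max n y by (intro sum_mono f(2)) (auto intro: order_trans)
    also have "\<dots> = \<epsilon>" by simp
    finally show ?thesis .
  qed
  moreover have "N\<^sub>0 \<le> ?n" using max f(1) order_trans by blast
  ultimately show ?thesis by blast
qed

section \<open>The coding map\<close>

lemma proj_decomp: "z = P n z + ((z \<bullet> W n) / (U n \<bullet> W n)) *\<^sub>R U n"
  by (simp add: proj_eq)

text \<open>The lift starts at index 0, so only the labels inside the range enter. This is the
  source of the continuity of the coding.\<close>

lemma window_cong:
  assumes "i \<le> 0" "0 \<le> j" "\<And>k. i \<le> k \<Longrightarrow> k \<le> j \<Longrightarrow> e k = e' k"
  shows "window n e i j = window n e' i j"
proof -
  have up: "k \<le> j \<longrightarrow> pos n e k z = pos n e' k z" if "0 \<le> k" for k z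
    using that
  proof (induction k rule: int_ge_induct)
    case (step k)
    then show ?case using assms(1) assms(3)[of k] by (auto simp: pos_Suc)
  qed simp
  have down: "i \<le> k \<longrightarrow> pos n e k z = pos n e' k z" if "k \<le> 0" for k z
    using that
  proof (induction k rule: int_le_induct)
    case (step k)
    show ?case
    proof
      assume "i \<le> k - 1"
      then have "pos n e (k - 1 + 1) z = tau (n + (k - 1)) (edge_label (e (k - 1))) (pos n e' (k - 1) z)"
        using step assms(2) assms(3)[of "k - 1"] pos_Suc[of n e' "k - 1" z] by simp
      then show "pos n e (k - 1) z = pos n e' (k - 1) z" by (simp only: pos_Suc_iff)
    qed
  qed simp
  have "pos n e k z = pos n e' k z" if "i \<le> k" "k \<le> j" for k z
    using up[of k z] down[of k z] that by (cases "0 \<le> k") auto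
  then show ?thesis using assms(3) by (auto simp: window_def)
qed

lemma window_subset: "i \<le> 0 \<Longrightarrow> 0 \<le> j \<Longrightarrow> window n e i j \<subseteq> ebox n (e 0)"
  using interior_subset by (force simp: window_def dest: spec[of _ 0])

lemma window_mono: "i' \<le> i \<Longrightarrow> j \<le> j' \<Longrightarrow> window n e i' j' \<subseteq> window n e i j"
  by (auto simp: window_def)

lemma compact_closure_window: "i \<le> 0 \<Longrightarrow> 0 \<le> j \<Longrightarrow> compact (closure (window n e i j))"
  using window_subset compact_edge_box bounded_subset compact_imp_bounded
  by (metis compact_closure)

text \<open>The vertical part of \<open>z - z'\<close> is bounded by the strip at level
  \<open>n - l\<close>; the horizontal part is the image under \<open>B n (n + l)\<close> of a
  difference of two points of a subtile.\<close>

lemma window_diff: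
  assumes "chain n e (- l) l" "0 \<le> l" "z \<in> window n e (- l) l" "z' \<in> window n e (- l) l"
    and small: "\<And>a y. y \<in> R (n + l) a \<Longrightarrow> norm (B n (n + l) *v y) \<le> \<rho>"
  shows "dist z z' \<le> 2 * \<rho> + W (n - l) $ src (e (- l)) / (U n \<bullet> W n) * norm (U n)"
proof -
  have in_strip: "pos n e (- l) w \<in> open_strip (n - l) (src (e (- l)))"
    and in_cyl: "- P (n + l) (pos n e l w) \<in> R (n + l) (src (e l))" if "w \<in> window n e (- l) l" for w
  proof -
    have "pos n e (- l) w \<in> interior (ebox (n + (- l)) (e (- l)))" "pos n e l w \<in> interior (ebox (n + l) (e l))"
      using that assms(2) by (auto simp: window_def)
    moreover have "ebox (n + l) (e l) \<subseteq> rbox (n + l) (src (e l))"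
      using assms(1,2) by (intro edge_box_subset) (auto simp: chain_def)
    ultimately show "pos n e (- l) w \<in> open_strip (n - l) (src (e (- l)))"
      "- P (n + l) (pos n e l w) \<in> R (n + l) (src (e l))"
      using interior_subset[of "ebox (n + l) (e l)"] by (auto simp: interior_edge_box box_eq cyl_def)
  qed
  have "\<bar>(z - z') \<bullet> W n\<bar> \<le> W (n - l) $ src (e (- l))"
    using in_strip[OF assms(3)] in_strip[OF assms(4)] pos_height_diff[of n e "- l" z z']
    by (auto simp: open_strip_def inner_diff_left)
  then have height: "norm (((z - z') \<bullet> W n / (U n \<bullet> W n)) *\<^sub>R U n)
      \<le> W (n - l) $ src (e (- l)) / (U n \<bullet> W n) * norm (U n)"
    using UW_pos[of n] by (auto simp: abs_mult intro!: mult_right_mono divide_right_mono)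
  have "P n (z - z') = B n (n + l) *v P (n + l) (pos n e l z - pos n e l z')"
    using pos_B_diff[OF assms(2)] assms(2) by (simp add: P_B)
  also have "\<dots> = B n (n + l) *v (- P (n + l) (pos n e l z')) - B n (n + l) *v (- P (n + l) (pos n e l z))"
    by (simp add: P_diff matrix_vector_minus matrix_vector_mult_diff_distrib)
  also have "norm \<dots> \<le> \<rho> + \<rho>"
    using small[OF in_cyl[OF assms(3)]] small[OF in_cyl[OF assms(4)]]
    by (intro order_trans[OF norm_triangle_ineq4] add_mono)
  finally have "norm (P n (z - z')) \<le> 2 * \<rho>" by simp
  then show ?thesis
    using height norm_triangle_ineq[of "P n (z - z')" "((z - z') \<bullet> W n / (U n \<bullet> W n)) *\<^sub>R U n"]
      proj_decomp[of "z - z'" n] by (simp add: dist_norm)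
qed

lemma closure_window_diff:
  assumes "\<And>z z'. z \<in> S \<Longrightarrow> z' \<in> S \<Longrightarrow> dist z z' \<le> r" "z \<in> closure S" "z' \<in> closure S"
  shows "dist z z' \<le> (r :: real)"
proof -
  have "S \<subseteq> cball w r" if "w \<in> S" for w
    using assms(1) that by (auto)
  then have 1: "closure S \<subseteq> cball w r" if "w \<in> S" for w
    using that by (intro closure_minimal) auto
  then have "S \<subseteq> cball w r" if "w \<in> closure S" for w
    using that by (auto simp: dist_commute subset_iff)
  then have "closure S \<subseteq> cball w r" if "w \<in> closure S" for w
    using that by (intro closure_minimal) auto
  from this[OF assms(2)] show ?thesis using assms(3) by auto
qed

lemma paths_chain: "e \<in> paths \<sigma> n \<Longrightarrow> chain n e i j"
  by (auto simp: paths_def chain_def)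

lemma left_shift_paths: "e \<in> paths \<sigma> n \<Longrightarrow> left_shift e \<in> paths \<sigma> (n + 1)"
proof -
  have "n + 1 + k = n + (k + 1)" for k :: int by simp
  then show "e \<in> paths \<sigma> n \<Longrightarrow> left_shift e \<in> paths \<sigma> (n + 1)"
    by (simp only: paths_def left_shift_def mem_Collect_eq) blast
qed

lemma cylinder_eq:
  assumes "e \<in> paths \<sigma> n"
  shows "(\<Inter>k\<in>{k. \<bar>k\<bar> \<le> int l}. pullback F k (open_box \<sigma> u v (n + k) (e k)))
    = level n (abs_torus ` window n e (- int l) (int l))"
proof (intro set_eqI iffI)
  fix x assume "x \<in> (\<Inter>k\<in>{k. \<bar>k\<bar> \<le> int l}. pullback F k (open_box \<sigma> u v (n + k) (e k)))"
  then show "x \<in> level n (abs_torus ` window n e (- int l) (int l))"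
    using pullback_window[of "- int l" "int l" e n x] assms by (auto simp: paths_def level_def)
next
  fix x assume "x \<in> level n (abs_torus ` window n e (- int l) (int l))"
  then show "x \<in> (\<Inter>k\<in>{k. \<bar>k\<bar> \<le> int l}. pullback F k (open_box \<sigma> u v (n + k) (e k)))"
    using window_pullback[of _ n e "- int l" "int l"] by (auto simp: level_def)
qed

lemma continuous_level: "continuous_on S (\<lambda>z. (n, abs_torus z))"
  using continuous_on_subset[OF continuous_abs_torus] by (intro continuous_intros) auto

text \<open>Compactness upstairs makes the projected closure closed, so projection and closure
  commute.\<close>

lemma closure_level:
  assumes "compact (closure S)"
  shows "closure (level n (abs_torus ` S)) = level n (abs_torus ` closure S)"
proof
  have "closed (level n (abs_torus ` closure S))"
    unfolding level_def by (intro closed_Times closed_abs_torus_image assms) (simp add: closed_def open_discrete)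
  then show "closure (level n (abs_torus ` S)) \<subseteq> level n (abs_torus ` closure S)"
    using closure_subset[of S] by (intro closure_minimal) (auto simp: level_def)
  have "(\<lambda>z. (n, abs_torus z)) ` closure S \<subseteq> closure (level n (abs_torus ` S))"
    using closure_subset[of "level n (abs_torus ` S)"]
    by (intro image_closure_subset continuous_level) (auto simp: level_def)
  then show "level n (abs_torus ` closure S) \<subseteq> closure (level n (abs_torus ` S))"
    by (auto simp: level_def)
qed

text \<open>The intersection is taken upstairs, where nested closed sets of shrinking diameter meet
  in one point; for a path under two-sided primitivity its class is the value of the coding.\<close>

definition lim_pt :: "int \<Rightarrow> (int \<Rightarrow> 'd edge) \<Rightarrow> real ^ 'd" where
  "lim_pt n e = (THE z. (\<Inter>l. closure (window n e (- int l) (int l))) = {z})"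

lemma forward_shift: "pos (n + 1) (left_shift e) k (tau n (edge_label (e 0)) z) = pos n e (k + 1) z"
proof (induction k rule: int_induct[of _ 0])
  case base
  then show ?case using pos_Suc[of n e 0 z] by simp
next
  case (step1 k)
  then show ?case
    using pos_Suc[of n e "k + 1" z]
    by (simp only: pos_Suc[of "n + 1"] left_shift_def add.assoc add.commute[of 1 k])
next
  case (step2 k)
  have "pos (n + 1) (left_shift e) (k - 1 + 1) (tau n (edge_label (e 0)) z) =
      tau (n + 1 + (k - 1)) (edge_label (left_shift e (k - 1))) (pos n e (k - 1 + 1) z)"
    using step2 by (simp add: pos_Suc left_shift_def)
  then show ?case by (simp only: pos_Suc_iff)
qed

end

section \<open>Generation and coding under two-sided primitivity\<close>

locale two_sided_rauzy_tiling = rauzy_tiling \<sigma> u v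
  for \<sigma> :: "int \<Rightarrow> 'd::finite list \<Rightarrow> 'd list" and u v +
  assumes two_sided: "two_sided_primitive \<sigma>"
begin

text \<open>The length \<open>l\<close> is the same for all chains, as needed for continuity. Two
  subtile points cost \<epsilon>/6 each and the height costs \<epsilon>/3; the resulting bound
  passes to closures and stays below \<epsilon>.\<close>

lemma window_shrink:
  assumes "\<epsilon> > 0"
  shows "\<exists>l::nat. \<forall>e. chain n e (- int l) (int l) \<longrightarrow>
    (\<forall>z\<in>closure (window n e (- int l) (int l)). \<forall>z'\<in>closure (window n e (- int l) (int l)). dist z z' < \<epsilon>)"
proof -
  define c where "c = norm (U n) / (U n \<bullet> W n) + 1"
  have c: "c > 0" using UW_pos[of n] by (simp add: c_def add_nonneg_pos)
  obtain n\<^sub>0 where n0: "n\<^sub>0 \<ge> n" "\<And>m a y. m \<ge> n\<^sub>0 \<Longrightarrow> y \<in> R m a \<Longrightarrow> norm (B n m *v y) \<le> \<epsilon> / 6"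
    using strong_convergence[of "\<epsilon> / 6" n] assms by auto
  obtain n\<^sub>1 where n1: "n\<^sub>1 \<le> n" "\<And>k a. k \<le> n\<^sub>1 \<Longrightarrow> W k $ a < \<epsilon> / (3 * c)"
    using W_small[OF two_sided, of "\<epsilon> / (3 * c)" n] assms c by auto
  define l where "l = nat (max (n\<^sub>0 - n) (n - n\<^sub>1))"
  have l: "n + int l \<ge> n\<^sub>0" "n - int l \<le> n\<^sub>1" using n0(1) n1(1) by (auto simp: l_def)
  have "dist z z' \<le> 2 * \<epsilon> / 3"
    if e: "chain n e (- int l) (int l)" and z: "z \<in> window n e (- int l) (int l)" "z' \<in> window n e (- int l) (int l)"
    for e z z'
  proof -
    let ?w = "W (n - int l) $ src (e (- int l))"
    have "?w / (U n \<bullet> W n) * norm (U n) = ?w * (norm (U n) / (U n \<bullet> W n))" by simp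
    also have "\<dots> \<le> ?w * c" using W_nonneg by (intro mult_left_mono) (auto simp: c_def)
    also have "\<dots> \<le> \<epsilon> / (3 * c) * c"
      using n1(2)[OF l(2)] c by (intro mult_right_mono) (auto intro: less_imp_le)
    also have "\<dots> = \<epsilon> / 3" using c by simp
    finally have "?w / (U n \<bullet> W n) * norm (U n) \<le> \<epsilon> / 3" .
    moreover have "dist z z' \<le> 2 * (\<epsilon> / 6) + ?w / (U n \<bullet> W n) * norm (U n)"
      using n0(2)[OF l(1)] by (intro window_diff[OF e _ z]) auto
    ultimately show ?thesis by linarith
  qed
  then have "dist z z' \<le> 2 * \<epsilon> / 3"
    if "chain n e (- int l) (int l)" "z \<in> closure (window n e (- int l) (int l))"
      "z' \<in> closure (window n e (- int l) (int l))" for e z z'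
    using closure_window_diff that by blast
  then show ?thesis using assms by (intro exI[of _ l]) fastforce
qed

lemma lim_pt:
  assumes "e \<in> paths \<sigma> n"
  shows "(\<Inter>l. closure (window n e (- int l) (int l))) = {lim_pt n e}"
proof -
  have "\<exists>z. (\<Inter>l. closure (window n e (- int l) (int l))) = {z}"
  proof (rule decreasing_closed_nest_sing)
    show "closure (window n e (- int l) (int l)) \<noteq> {}" for l
      using window_nonempty[OF paths_chain[OF assms], of "- int l" "int l"] W_pos[OF two_sided] by simp
    show "closure (window n e (- int k) (int k)) \<subseteq> closure (window n e (- int l) (int l))" if "l \<le> k" for l k
      using that by (intro closure_mono window_mono) auto
    show "\<exists>l. \<forall>x\<in>closure (window n e (- int l) (int l)). \<forall>y\<in>closure (window n e (- int l) (int l)). dist x y < \<epsilon>"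
      if "\<epsilon> > 0" for \<epsilon>
      using window_shrink[OF that, of n] paths_chain[OF assms] by blast
  qed simp
  then obtain z where z: "(\<Inter>l. closure (window n e (- int l) (int l))) = {z}" ..
  then have "lim_pt n e = z"
    unfolding lim_pt_def by (intro the_equality) auto
  then show ?thesis using z by simp
qed

lemma lim_pt_closure: "e \<in> paths \<sigma> n \<Longrightarrow> lim_pt n e \<in> closure (window n e (- int l) (int l))"
  using lim_pt[of e n] by blast

text \<open>An intersection of projections could exceed the projection of the intersection, since
  the representative may depend on \<open>l\<close>. All representatives lie in one coset of the
  lattice and converge to \<open>lim_pt n e\<close>, and the coset is closed.\<close>

lemma cylinder_limit_eq:
  assumes "e \<in> paths \<sigma> n"
  shows "cylinder_limit \<sigma> u v n e = {(n, abs_torus (lim_pt n e))}"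
proof -
  have "cylinder_limit \<sigma> u v n e = (\<Inter>l::nat. level n (abs_torus ` closure (window n e (- int l) (int l))))"
    unfolding cylinder_limit_def cylinder_eq[OF assms]
    by (intro INF_cong refl closure_level compact_closure_window) auto
  also have "\<dots> = {(n, abs_torus (lim_pt n e))}"
  proof (intro equalityI subsetI)
    fix x assume x: "x \<in> (\<Inter>l::nat. level n (abs_torus ` closure (window n e (- int l) (int l))))"
    obtain y where y: "snd x = abs_torus y" using abs_torus_surj by blast
    have "lim_pt n e \<in> closure ((+) y ` int_vecs)"
      unfolding closure_approachable
    proof (intro allI impI)
      fix \<epsilon> :: real assume "\<epsilon> > 0"
      then obtain l where l: "\<And>z z'. z \<in> closure (window n e (- int l) (int l)) \<Longrightarrow>
          z' \<in> closure (window n e (- int l) (int l)) \<Longrightarrow> dist z z' < \<epsilon>"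
        using window_shrink[of \<epsilon> n] paths_chain[OF assms] by blast
      obtain z where z: "z \<in> closure (window n e (- int l) (int l))" "abs_torus z = abs_torus y"
        using INT_D[OF x UNIV_I, of l] y by (fastforce simp: level_def)
      then have "z - y \<in> int_vecs" by (simp add: abs_torus_eq_iff)
      then have "z \<in> (+) y ` int_vecs" by (intro image_eqI[of _ _ "z - y"]) auto
      then show "\<exists>z\<in>(+) y ` int_vecs. dist z (lim_pt n e) < \<epsilon>"
        using l[OF z(1) lim_pt_closure[OF assms]] by blast
    qed
    moreover have "closed ((+) y ` int_vecs)"
      by (intro closed_translation int_vecs_subset_closed) simp
    ultimately have "abs_torus (lim_pt n e) = abs_torus y"
      by (auto simp: abs_torus_eq_iff)
    moreover have "fst x = n" using x by (auto simp: level_def)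
    ultimately show "x \<in> {(n, abs_torus (lim_pt n e))}" using y by (simp add: prod_eq_iff)
  qed (use lim_pt_closure[OF assms] in \<open>auto simp: level_def\<close>)
  finally show ?thesis .
qed

lemma coding_eq: "e \<in> paths \<sigma> n \<Longrightarrow> coding \<sigma> u v n e = (n, abs_torus (lim_pt n e))"
  by (simp add: coding_def cylinder_limit_eq)

text \<open>Shifting costs one index: \<open>tau\<close> maps the window of radius
  \<open>Suc l\<close> into the shifted window of radius \<open>l\<close>, hence limit point to
  limit point.\<close>

lemma coding_shift:
  assumes e: "e \<in> paths \<sigma> n"
  shows "coding \<sigma> u v (n + 1) (left_shift e) = F (coding \<sigma> u v n e)"
proof -
  let ?t = "tau n (edge_label (e 0))"
  have "?t (lim_pt n e) \<in> closure (window (n + 1) (left_shift e) (- int l) (int l))" for l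
  proof -
    have "pos (n + 1) (left_shift e) k (?t z) \<in> interior (ebox (n + 1 + k) (left_shift e k))"
      if "z \<in> window n e (- int (Suc l)) (int (Suc l))" "- int l \<le> k" "k \<le> int l" for z k
    proof -
      have "pos n e (k + 1) z \<in> interior (ebox (n + (k + 1)) (e (k + 1)))"
        using that unfolding window_def by (auto dest: spec[of _ "k + 1"])
      then show ?thesis unfolding forward_shift by (simp add: left_shift_def algebra_simps)
    qed
    then have "?t ` window n e (- int (Suc l)) (int (Suc l)) \<subseteq> window (n + 1) (left_shift e) (- int l) (int l)"
      unfolding window_def by blast
    then have "?t ` closure (window n e (- int (Suc l)) (int (Suc l)))
        \<subseteq> closure (window (n + 1) (left_shift e) (- int l) (int l))"
      using closure_subset by (intro image_closure_subset continuous_tau) blast+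
    then show ?thesis using lim_pt_closure[OF e, of "Suc l"] by blast
  qed
  then have "?t (lim_pt n e) = lim_pt (n + 1) (left_shift e)"
    using lim_pt[OF left_shift_paths[OF e]] by blast
  then show ?thesis
    using F_tau[of n "lim_pt n e" "edge_label (e 0)"] by (simp add: coding_eq e left_shift_paths)
qed

lemma continuous_pos: "continuous_on S (pos n e k)"
proof (induction k rule: int_induct[of _ 0])
  case base
  then show ?case by (simp add: pos_def continuous_on_id)
next
  case (step1 k)
  have "continuous_on S (\<lambda>z. tau (n + k) (edge_label (e k)) (pos n e k z))"
    by (rule continuous_on_compose2[OF continuous_tau step1(2)]) auto
  then show ?case by (simp add: pos_Suc)
next
  case (step2 k)
  have "pos n e (k - 1) z = M (n + (k - 1)) *v pos n e k z - abelianization (edge_label (e (k - 1)))" for z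
    using pos_Suc[of n e "k - 1" z] by (simp add: M_tau)
  moreover have "continuous_on S (\<lambda>z. M (n + (k - 1)) *v pos n e k z - abelianization (edge_label (e (k - 1))))"
    by (intro continuous_intros continuous_on_compose2[OF matrix_vector_mult_linear_continuous_on step2(2)]) auto
  ultimately show ?case by simp
qed

lemma boundary_free:
  assumes "x \<notin> boundary_pullbacks \<sigma> u v" "e \<in> edges \<sigma> m"
    "iterF k x = (m, abs_torus z)" "z \<in> ebox m e"
  shows "iterF k x \<in> open_box \<sigma> u v m e"
proof -
  have "iterF k x \<notin> box_boundary \<sigma> u v m e"
    using assms(1,2) by (auto simp: boundary_pullbacks_def pullback_F)
  then have "z \<notin> frontier (ebox m e)"
    using assms(3) by (auto simp: box_boundary_def level_def)
  then show ?thesis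
    using assms(3,4) closure_subset[of "ebox m e"] by (auto simp: open_box_iff frontier_def)
qed

text \<open>The limit point lies in the closures of all windows, so its lifted orbit stays in the
  closed boxes; off the boundary pullbacks these are the open ones.\<close>

lemma coding_itinerary:
  assumes e: "e \<in> paths \<sigma> n" and "coding \<sigma> u v n e \<notin> boundary_pullbacks \<sigma> u v"
  shows "iterF k (coding \<sigma> u v n e) \<in> open_box \<sigma> u v (n + k) (e k)"
proof (rule boundary_free[OF assms(2)])
  let ?l = "nat \<bar>k\<bar>"
  show "e k \<in> edges \<sigma> (n + k)" using e by (simp add: paths_def)
  show "iterF k (coding \<sigma> u v n e) = (n + k, abs_torus (pos n e k (lim_pt n e)))"
    by (simp add: coding_eq[OF e] iterF_pos)
  have "pos n e k ` closure (window n e (- int ?l) (int ?l)) \<subseteq> ebox (n + k) (e k)"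
  proof (intro image_closure_subset continuous_pos)
    show "closed (ebox (n + k) (e k))" by (rule compact_edge_box[THEN compact_imp_closed])
    show "pos n e k ` window n e (- int ?l) (int ?l) \<subseteq> ebox (n + k) (e k)"
      using interior_subset[of "ebox (n + k) (e k)"] by (auto simp: window_def dest: spec[of _ k])
  qed
  then show "pos n e k (lim_pt n e) \<in> ebox (n + k) (e k)"
    using lim_pt_closure[OF e, of ?l] by blast
qed

lemma itinerary_unique:
  assumes "e \<in> paths \<sigma> n" "coding \<sigma> u v n e \<notin> boundary_pullbacks \<sigma> u v"
    and "\<And>k. e' k \<in> edges \<sigma> (n + k)" "\<And>k. iterF k (coding \<sigma> u v n e) \<in> open_box \<sigma> u v (n + k) (e' k)"
  shows "e' = e"
proof
  fix k
  show "e' k = e k"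
    using open_box_disjoint[OF assms(3) _ assms(4) coding_itinerary[OF assms(1,2)]] assms(1)
    by (simp add: paths_def)
qed

lemma inj_coding: "inj_on (coding \<sigma> u v n) (paths \<sigma> n - coding \<sigma> u v n -` boundary_pullbacks \<sigma> u v)"
proof (rule inj_onI)
  fix e e' assume e: "e \<in> paths \<sigma> n - coding \<sigma> u v n -` boundary_pullbacks \<sigma> u v"
    and e': "e' \<in> paths \<sigma> n - coding \<sigma> u v n -` boundary_pullbacks \<sigma> u v"
    and eq: "coding \<sigma> u v n e = coding \<sigma> u v n e'"
  have "e' k \<in> edges \<sigma> (n + k)" for k using e' by (simp add: paths_def)
  then have "e' = e"
    using e e' coding_itinerary[of e' n] by (intro itinerary_unique[of e n]) (auto simp: eq)
  then show "e = e'" by simp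
qed

text \<open>The links between consecutive edges are not assumed: lifting the orbit on larger and
  larger ranges produces them.\<close>

lemma coding_of_itinerary:
  assumes "\<And>k. e k \<in> edges \<sigma> (n + k)" "\<And>k. iterF k x \<in> open_box \<sigma> u v (n + k) (e k)"
  shows "e \<in> paths \<sigma> n" "coding \<sigma> u v n e = x"
proof -
  have pb: "x \<in> pullback F k (open_box \<sigma> u v (n + k) (e k))" for k
    using assms(2) by (simp add: pullback_F)
  have chains: "chain n e (- int l) (int l)" for l
    using pullback_window[of "- int l" "int l" e n x] assms(1) pb by auto
  have "rng (e k) = src (e (k + 1))" for k
    using chains[of "nat (\<bar>k\<bar> + 1)"] by (auto simp: chain_def dest: spec[of _ k])
  then show e: "e \<in> paths \<sigma> n" using assms(1) by (simp add: paths_def)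
  have "x \<in> cylinder_limit \<sigma> u v n e"
    unfolding cylinder_limit_def using pb by (intro INT_I subsetD[OF closure_subset]) auto
  then show "coding \<sigma> u v n e = x"
    by (simp add: cylinder_limit_eq[OF e] coding_eq[OF e])
qed

text \<open>A point in all the closures makes every finite intersection nonempty. The sequence is
  then a path, and its cylinder limit is a singleton.\<close>

lemma generating: "generating F (edges \<sigma>) (open_box \<sigma> u v)"
  unfolding generating_def
proof (intro allI impI)
  fix i :: "int \<Rightarrow> 'd edge" and x y
  assume i: "\<forall>k. i k \<in> edges \<sigma> k"
    and xy: "{x, y} \<subseteq> (\<Inter>n::nat. closure (\<Inter>k\<in>{k. \<bar>k\<bar> < int n}. pullback F k (open_box \<sigma> u v k (i k))))"
  have set: "{k. \<bar>k\<bar> < int (Suc l)} = {k. \<bar>k\<bar> \<le> int l}" for l by auto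
  have "chain 0 i (- int l) (int l)" for l
  proof -
    have "(\<Inter>k\<in>{k. \<bar>k\<bar> < int (Suc l)}. pullback F k (open_box \<sigma> u v k (i k))) \<noteq> {}"
    proof -
      have "x \<in> (\<Inter>n::nat. closure (\<Inter>k\<in>{k. \<bar>k\<bar> < int n}. pullback F k (open_box \<sigma> u v k (i k))))"
        using xy by simp
      from INT_D[OF this UNIV_I, of "Suc l"] show ?thesis by force
    qed
    then obtain w where "\<And>k. \<bar>k\<bar> \<le> int l \<Longrightarrow> w \<in> pullback F k (open_box \<sigma> u v k (i k))"
      unfolding set by blast
    then show ?thesis
      using pullback_window[of "- int l" "int l" i 0 w] i by auto
  qed
  note chains = this
  have "rng (i k) = src (i (k + 1))" for k
    using chains[of "nat (\<bar>k\<bar> + 1)"] by (auto simp: chain_def dest: spec[of _ k])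
  then have p: "i \<in> paths \<sigma> 0" using i by (simp add: paths_def)
  have "{x, y} \<subseteq> cylinder_limit \<sigma> u v 0 i"
    unfolding cylinder_limit_def
  proof (intro INT_greatest)
    fix l :: nat
    show "{x, y} \<subseteq> closure (\<Inter>k\<in>{k. \<bar>k\<bar> \<le> int l}. pullback F k (open_box \<sigma> u v (0 + k) (i k)))"
      using order_trans[OF xy INT_lower[OF UNIV_I, of _ "Suc l"]] unfolding set by simp
  qed
  then show "x = y" by (simp add: cylinder_limit_eq[OF p])
qed

section \<open>Continuity and injectivity of the coding\<close>

lemma topspace_path: "topspace (path_topology \<sigma> n) = paths \<sigma> n"
  by (auto simp: path_topology_def paths_def)

lemma openin_path_cylinder:
  assumes "e \<in> paths \<sigma> n"
  shows "openin (path_topology \<sigma> n) {e' \<in> paths \<sigma> n. \<forall>k. \<bar>k\<bar> \<le> int l \<longrightarrow> e' k = e k}"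
proof -
  let ?S = "\<lambda>k. if \<bar>k\<bar> \<le> int l then {e k} else edges \<sigma> (n + k)"
  have "finite {k. \<bar>k\<bar> \<le> int l}"
    by (rule finite_subset[of _ "{- int l..int l}"]) auto
  then have "finite {k \<in> UNIV. ?S k \<noteq> topspace (discrete_topology (edges \<sigma> (n + k)))}"
    by (rule rev_finite_subset) auto
  then have "openin (product_topology (\<lambda>k. discrete_topology (edges \<sigma> (n + k))) UNIV) (PiE UNIV ?S)"
    using assms by (subst openin_PiE_gen) (auto simp: paths_def)
  then have "openin (path_topology \<sigma> n) (paths \<sigma> n \<inter> PiE UNIV ?S)"
    unfolding path_topology_def by (simp add: openin_subtopology_Int2)
  moreover have "paths \<sigma> n \<inter> PiE UNIV ?S = {e' \<in> paths \<sigma> n. \<forall>k. \<bar>k\<bar> \<le> int l \<longrightarrow> e' k = e k}"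
    by (auto simp: PiE_iff paths_def split: if_splits)
  ultimately show ?thesis by simp
qed

lemma continuous_coding: "continuous_map (path_topology \<sigma> n) (top_of_set (level n UNIV)) (coding \<sigma> u v n)"
proof (rule continuous_map_into_subtopology)
  show "coding \<sigma> u v n \<in> topspace (path_topology \<sigma> n) \<rightarrow> level n UNIV"
    by (auto simp: topspace_path coding_eq level_def)
  show "continuous_map (path_topology \<sigma> n) euclidean (coding \<sigma> u v n)"
    unfolding continuous_map_def topspace_path
  proof (intro conjI allI impI)
    fix G :: "(int \<times> 'd torus) set" assume "openin euclidean G"
    then have "open ((\<lambda>z. (n, abs_torus z)) -` G)"
      by (intro open_vimage continuous_level) simp
    show "openin (path_topology \<sigma> n) {e \<in> paths \<sigma> n. coding \<sigma> u v n e \<in> G}"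
    proof (subst openin_subopen, intro ballI)
      fix e assume "e \<in> {e \<in> paths \<sigma> n. coding \<sigma> u v n e \<in> G}"
      then have e: "e \<in> paths \<sigma> n" "lim_pt n e \<in> (\<lambda>z. (n, abs_torus z)) -` G"
        by (auto simp: coding_eq)
      then obtain \<epsilon> where \<epsilon>: "\<epsilon> > 0" "ball (lim_pt n e) \<epsilon> \<subseteq> (\<lambda>z. (n, abs_torus z)) -` G"
        using \<open>open _\<close> open_contains_ball by blast
      obtain l where l: "\<And>z z'. z \<in> closure (window n e (- int l) (int l)) \<Longrightarrow>
          z' \<in> closure (window n e (- int l) (int l)) \<Longrightarrow> dist z z' < \<epsilon>"
        using window_shrink[OF \<epsilon>(1), of n] paths_chain[OF e(1)] by blast
      have "coding \<sigma> u v n e' \<in> G" if e': "e' \<in> paths \<sigma> n" "\<forall>k. \<bar>k\<bar> \<le> int l \<longrightarrow> e' k = e k" for e'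
      proof -
        have "window n e (- int l) (int l) = window n e' (- int l) (int l)"
          using e'(2) by (intro window_cong) auto
        then have "lim_pt n e' \<in> ball (lim_pt n e) \<epsilon>"
          using l[OF lim_pt_closure[OF e(1)]] lim_pt_closure[OF e'(1)] by simp
        then show ?thesis using \<epsilon>(2) by (auto simp: coding_eq[OF e'(1)])
      qed
      then show "\<exists>T. openin (path_topology \<sigma> n) T \<and> e \<in> T \<and> T \<subseteq> {e \<in> paths \<sigma> n. coding \<sigma> u v n e \<in> G}"
        using openin_path_cylinder[OF e(1)] e(1)
        by (intro exI[of _ "{e' \<in> paths \<sigma> n. \<forall>k. \<bar>k\<bar> \<le> int l \<longrightarrow> e' k = e k}"]) auto
    qed
  qed auto
qed

lemma topspace_edge_shift: "topspace (edge_shift_topology \<sigma>) = Sigma UNIV (paths \<sigma>)"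
  by (simp add: edge_shift_topology_def topspace_path comp_def)

lemma full_coding_fst: "x \<in> Sigma UNIV (paths \<sigma>) \<Longrightarrow> fst (full_coding \<sigma> u v x) = fst x"
  by (auto simp: full_coding_def coding_eq)

lemma inj_full_coding:
  "inj_on (full_coding \<sigma> u v)
     (topspace (edge_shift_topology \<sigma>) - full_coding \<sigma> u v -` boundary_pullbacks \<sigma> u v)"
proof (rule inj_onI)
  fix x y
  assume x: "x \<in> topspace (edge_shift_topology \<sigma>) - full_coding \<sigma> u v -` boundary_pullbacks \<sigma> u v"
    and y: "y \<in> topspace (edge_shift_topology \<sigma>) - full_coding \<sigma> u v -` boundary_pullbacks \<sigma> u v"
    and eq: "full_coding \<sigma> u v x = full_coding \<sigma> u v y"
  have "fst x = fst y"
    using full_coding_fst[of x] full_coding_fst[of y] x y eq by (simp add: topspace_edge_shift)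
  then show "x = y"
    using x y eq inj_onD[OF inj_coding[of "fst x"], of "snd x" "snd y"]
    by (auto simp: topspace_edge_shift full_coding_def prod_eq_iff)
qed

end

section \<open>Haar measure\<close>

definition unit_box :: "(real ^ 'n) set" where
  "unit_box = {x. \<forall>i. 0 \<le> x $ i \<and> x $ i < 1}"

lemma unit_box_borel: "(unit_box :: (real ^ 'n) set) \<in> sets borel"
proof -
  have "unit_box = (\<Inter>i. {x. 0 \<le> x $ i} \<inter> {x :: real ^ 'n. x $ i < 1})"
    by (auto simp: unit_box_def)
  moreover have "{x :: real ^ 'n. 0 \<le> x $ i} \<inter> {x. x $ i < 1} \<in> sets borel" for i
    by (intro sets.Int borel_closed borel_open closed_Collect_le open_Collect_less continuous_intros)
  then have "(\<Inter>i. {x. 0 \<le> x $ i} \<inter> {x :: real ^ 'n. x $ i < 1}) \<in> sets borel"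
    by (intro sets.finite_INT) auto
  ultimately show ?thesis by simp
qed

lemma unit_box_bounded: "bounded unit_box"
  by (rule bounded_subset[of "cbox 0 (\<chi> i. 1)"])
    (auto simp: unit_box_def mem_box_cart less_le)

text \<open>Haar measure is defined through the unit box, which toral automorphisms do not preserve;
  this notion allows a change of domain.\<close>

definition fundamental_domain :: "(real ^ 'n) set \<Rightarrow> bool" where
  "fundamental_domain D \<longleftrightarrow> D \<in> sets borel \<and> (\<forall>z. \<exists>!x. x \<in> int_vecs \<and> z - x \<in> D)"

lemma fundamental_domain_unit_box: "fundamental_domain (unit_box :: (real ^ 'n) set)"
proof -
  have "\<exists>!x. x \<in> int_vecs \<and> z - x \<in> unit_box" for z :: "real ^ 'n"
  proof (rule ex1I)
    show "(\<chi> i. of_int \<lfloor>z $ i\<rfloor>) \<in> int_vecs \<and> z - (\<chi> i. of_int \<lfloor>z $ i\<rfloor>) \<in> unit_box"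
      using floor_correct[of "z $ _"] by (auto simp: int_vecs_def unit_box_def algebra_simps)
    fix x assume x: "x \<in> int_vecs \<and> z - x \<in> unit_box"
    have "x $ i = of_int \<lfloor>z $ i\<rfloor>" for i
    proof -
      obtain k where k: "x $ i = of_int k" using x by (auto simp: int_vecs_def elim: Ints_cases)
      have "0 \<le> (z - x) $ i" "(z - x) $ i < 1" using x by (simp_all only: unit_box_def mem_Collect_eq)
      then have "\<lfloor>z $ i\<rfloor> = k" using k by (simp add: floor_eq_iff)
      then show ?thesis using k by simp
    qed
    then show "x = (\<chi> i. of_int \<lfloor>z $ i\<rfloor>)" by (simp add: vec_eq_iff)
  qed
  then show ?thesis by (simp add: fundamental_domain_def unit_box_borel)
qed

lemma
  assumes "fundamental_domain D"
  shows fundamental_domain_unique: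
      "x \<in> int_vecs \<Longrightarrow> y \<in> int_vecs \<Longrightarrow> z - x \<in> D \<Longrightarrow> z - y \<in> D \<Longrightarrow> x = y"
    and fundamental_domain_ex: "\<exists>x\<in>int_vecs. z - x \<in> D"
proof -
  have ex1: "\<exists>!x. x \<in> int_vecs \<and> z - x \<in> D" for z
    using assms by (simp add: fundamental_domain_def)
  show "x \<in> int_vecs \<Longrightarrow> y \<in> int_vecs \<Longrightarrow> z - x \<in> D \<Longrightarrow> z - y \<in> D \<Longrightarrow> x = y"
    using ex1_implies_ex[OF ex1[of z]] ex1[of z] by auto
  show "\<exists>x\<in>int_vecs. z - x \<in> D"
    using ex1_implies_ex[OF ex1[of z]] by auto
qed

text \<open>Cut \<open>D \<inter> P\<close> according to the integer translation that moves a point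
  into \<open>D'\<close>. The translated pieces partition \<open>D' \<inter> P\<close>, because
  \<open>P\<close> is periodic.\<close>

lemma emeasure_fundamental_domain:
  fixes D D' P :: "(real ^ 'n) set"
  assumes D: "fundamental_domain D" and D': "fundamental_domain D'"
    and P: "P \<in> sets borel" "\<And>x z. x \<in> int_vecs \<Longrightarrow> z + x \<in> P \<longleftrightarrow> z \<in> P"
  shows "emeasure lborel (D \<inter> P) = emeasure lborel (D' \<inter> P)"
proof -
  define X where "X x = (D \<inter> P) \<inter> (\<lambda>z. z - x) -` D'" for x
  define Y where "Y x = (D' \<inter> P) \<inter> (+) x -` D" for x
  have borel: "D \<in> sets borel" "D' \<in> sets borel"
    using D D' by (auto simp: fundamental_domain_def)
  have shift: "(\<lambda>z. z - x) -` S \<in> sets borel" "(+) x -` S \<in> sets borel" if "S \<in> sets borel" for S and x :: "real ^ 'n"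
    using measurable_sets_borel[OF _ that, of "\<lambda>z. z - x"] measurable_sets_borel[OF _ that, of "(+) x"] by auto
  have meas: "X x \<in> sets lborel" "Y x \<in> sets lborel" for x
    using P(1) borel shift by (auto simp: X_def Y_def)
  have disj: "disjoint_family_on X int_vecs" "disjoint_family_on Y int_vecs"
  proof -
    show "disjoint_family_on X int_vecs"
      unfolding disjoint_family_on_def X_def using fundamental_domain_unique[OF D'] by auto
    have "x = y" if "x \<in> int_vecs" "y \<in> int_vecs" "x + z \<in> D" "y + z \<in> D" for x y z
    proof -
      have "- x \<in> int_vecs \<and> z - (- x) \<in> D" "- y \<in> int_vecs \<and> z - (- y) \<in> D"
        using that by (auto simp: int_vecs_minus add.commute)
      then have "- x = - y" using fundamental_domain_unique[OF D, of "- x" "- y" z] by auto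
      then show ?thesis by simp
    qed
    then show "disjoint_family_on Y int_vecs"
      unfolding disjoint_family_on_def Y_def by auto
  qed
  have XY: "(+) x -` X x = Y x" if "x \<in> int_vecs" for x
  proof -
    have "x + z \<in> P \<longleftrightarrow> z \<in> P" for z using P(2)[OF that, of z] by (simp add: add.commute[of x])
    then show ?thesis by (auto simp: X_def Y_def)
  qed
  have eq: "emeasure lborel (X x) = emeasure lborel (Y x)" if "x \<in> int_vecs" for x
  proof -
    have "emeasure lborel (X x) = emeasure (distr lborel borel ((+) x)) (X x)"
      by (simp add: lborel_distr_plus)
    also have "\<dots> = emeasure lborel (Y x)"
      using meas by (subst emeasure_distr) (auto simp: XY[OF that])
    finally show ?thesis .
  qed
  have "D \<inter> P = (\<Union>x\<in>int_vecs. X x)"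
    using fundamental_domain_ex[OF D'] by (auto simp: X_def)
  moreover have "D' \<inter> P = (\<Union>x\<in>int_vecs. Y x)"
  proof -
    have "\<exists>x\<in>int_vecs. x + z \<in> D" for z
    proof -
      obtain x where "x \<in> int_vecs" "z - x \<in> D" using fundamental_domain_ex[OF D] by auto
      then show ?thesis by (intro bexI[of _ "- x"]) (auto simp: int_vecs_minus)
    qed
    then show ?thesis by (auto simp: Y_def)
  qed
  ultimately show ?thesis
    using meas disj eq by (simp add: emeasure_UN_countable countable_int_vecs cong: nn_integral_cong_simp)
qed

lemma measurable_abs_torus: "abs_torus \<in> borel_measurable borel"
  by (rule borel_measurable_continuous_onI[OF continuous_abs_torus])

lemma sets_torus_haar [simp, measurable_cong]: "sets torus_haar = sets borel"
  by (simp add: torus_haar_def)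

lemma space_torus_haar [simp]: "space torus_haar = UNIV"
  by (simp add: torus_haar_def)

lemma emeasure_torus_haar:
  fixes E :: "'n::finite torus set"
  assumes "E \<in> sets borel"
  shows "emeasure torus_haar E = emeasure lborel (unit_box \<inter> abs_torus -` E)"
proof -
  have *: "(abs_torus :: real ^ 'n \<Rightarrow> 'n torus) \<in> measurable (restrict_space lborel unit_box) borel"
    using measurable_abs_torus by (intro measurable_restrict_space1) simp
  have "emeasure torus_haar E = emeasure (restrict_space lborel unit_box) (abs_torus -` E \<inter> unit_box)"
    unfolding torus_haar_def unit_box_def[symmetric]
    using emeasure_distr[OF * assms] by (simp add: space_restrict_space)
  also have "\<dots> = emeasure lborel (abs_torus -` E \<inter> unit_box)"
    using unit_box_borel by (intro emeasure_restrict_space) auto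
  finally show ?thesis by (simp add: Int_commute)
qed

lemma negligible_borel_iff:
  assumes "S \<in> sets borel"
  shows "negligible S \<longleftrightarrow> emeasure lborel S = 0"
proof -
  have "S \<in> null_sets lebesgue \<longleftrightarrow> S \<in> null_sets lborel"
    using assms by (intro null_sets_completion_iff) simp
  then show ?thesis
    unfolding negligible_iff_null_sets using assms by (simp add: null_sets_def)
qed

lemma emeasure_torus_haar_UNIV:
  "emeasure torus_haar (UNIV :: 'n::finite torus set) \<noteq> top"
  "emeasure torus_haar (UNIV :: 'n::finite torus set) \<noteq> 0"
proof -
  have eq: "emeasure torus_haar (UNIV :: 'n torus set) = emeasure lborel (unit_box :: (real ^ 'n) set)"
    by (simp add: emeasure_torus_haar)
  show "emeasure torus_haar (UNIV :: 'n torus set) \<noteq> top"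
    unfolding eq by (metis emeasure_bounded_finite infinity_ennreal_def less_irrefl unit_box_bounded)
  have "box 0 1 \<subseteq> (unit_box :: (real ^ 'n) set)"
    by (auto simp: unit_box_def mem_box_cart less_le)
  moreover have "(\<chi> i. 1 / 2) \<in> box (0 :: real ^ 'n) 1"
    by (simp add: mem_box_cart)
  ultimately have "\<not> negligible (unit_box :: (real ^ 'n) set)"
    using open_not_negligible[OF open_box, of "0 :: real ^ 'n" 1] negligible_subset by blast
  then show "emeasure torus_haar (UNIV :: 'n torus set) \<noteq> 0"
    unfolding eq by (simp add: negligible_borel_iff unit_box_borel)
qed

interpretation torus_haar: finite_measure "torus_haar :: 'n::finite torus measure"
  by (rule finite_measureI) (simp add: emeasure_torus_haar_UNIV)

lemma null_abs_torus_image: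
  assumes "compact S" "negligible S"
  shows "abs_torus ` S \<in> null_sets torus_haar"
proof -
  have closed: "closed (abs_torus ` S)" by (rule closed_abs_torus_image[OF assms(1)])
  have "negligible (\<Union>x\<in>int_vecs. (+) x ` S)"
    using assms(2) countable_int_vecs
    by (intro negligible_countable_Union countable_image) (auto intro: negligible_translation)
  then have "negligible (unit_box \<inter> abs_torus -` abs_torus ` S)"
    unfolding vimage_abs_torus_image by (rule negligible_subset) auto
  moreover have "unit_box \<inter> abs_torus -` abs_torus ` S \<in> sets borel"
    using unit_box_borel closed by (auto intro: borel_closed simp: closed_torus_iff)
  ultimately have "emeasure lborel (unit_box \<inter> abs_torus -` abs_torus ` S) = 0"
    by (simp add: negligible_borel_iff)
  then show ?thesis
    using closed by (simp add: null_sets_def emeasure_torus_haar borel_closed)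
qed

section \<open>Invariance of Haar measure under toral automorphisms\<close>

lemma nn_integral_lborel_translate:
  fixes f :: "'a::euclidean_space \<Rightarrow> ennreal"
  assumes [measurable]: "f \<in> borel_measurable borel"
  shows "(\<integral>\<^sup>+x. f (c + x) \<partial>lborel) = (\<integral>\<^sup>+x. f x \<partial>lborel)"
proof -
  have "(\<integral>\<^sup>+x. f x \<partial>lborel) = (\<integral>\<^sup>+x. f x \<partial>distr lborel borel ((+) c))"
    by (simp add: lborel_distr_plus)
  also have "\<dots> = (\<integral>\<^sup>+x. f (c + x) \<partial>lborel)"
    by (subst nn_integral_distr) auto
  finally show ?thesis by simp
qed

lemma measurable_matrix_vector [measurable]: "(*v) A \<in> borel_measurable borel" for A :: "real ^ 'n ^ 'm"
  by (intro borel_measurable_continuous_onI matrix_vector_mult_linear_continuous_on)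

text \<open>Both \<open>E \<mapsto> lborel (A -` E)\<close> and \<open>lborel\<close> are translation invariant, so they are proportional;
  the constant is found by comparing fundamental domains.\<close>

lemma emeasure_linear_vimage_proportional:
  fixes A A' :: "real ^ 'n ^ 'n"
  assumes inv: "A ** A' = mat 1" and [measurable]: "E \<in> sets borel" "Q \<in> sets borel"
  shows "emeasure lborel Q * emeasure lborel ((*v) A -` E)
    = emeasure lborel E * emeasure lborel ((\<lambda>x. - (A *v x)) -` Q)"
proof -
  have inv': "A *v (A' *v z) = z" for z
    by (simp add: matrix_vector_mul_assoc inv)
  have vE [measurable]: "(*v) A -` E \<in> sets borel"
    by (rule measurable_sets_borel[OF measurable_matrix_vector]) fact
  have vQ [measurable]: "(\<lambda>x. - (A *v x)) -` Q \<in> sets borel"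
    by (rule measurable_sets_borel[OF _ assms(3)]) measurable
  \<comment> \<open>Integrating \<open>?f\<close> over \<open>x\<close> first yields a translate of
    the preimage of \<open>E\<close>. The substitution of \<open>y - A *v x\<close> for
    \<open>y\<close> turns \<open>?f\<close> into \<open>?g\<close>, whose integral over
    \<open>x\<close> yields a translate of the reflected preimage of \<open>Q\<close>.\<close>
  let ?f = "\<lambda>x y. indicator Q y * indicator E (A *v x + y) :: ennreal"
  let ?g = "\<lambda>x y. indicator Q (y - A *v x) * indicator E y :: ennreal"
  have mf: "(\<lambda>x. ?f (fst x) (snd x)) \<in> borel_measurable (lborel \<Otimes>\<^sub>M lborel)"
    and mg: "(\<lambda>x. ?g (fst x) (snd x)) \<in> borel_measurable (lborel \<Otimes>\<^sub>M lborel)"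
    by measurable
  have "emeasure lborel Q * emeasure lborel ((*v) A -` E) = (\<integral>\<^sup>+y. \<integral>\<^sup>+x. ?f x y \<partial>lborel \<partial>lborel)"
  proof -
    have "(\<integral>\<^sup>+x. ?f x y \<partial>lborel) = indicator Q y * emeasure lborel ((*v) A -` E)" for y
    proof -
      have "(\<integral>\<^sup>+x. ?f x y \<partial>lborel) = indicator Q y * (\<integral>\<^sup>+x. indicator ((*v) A -` E) (A' *v y + x) \<partial>lborel)"
        by (subst nn_integral_cmult[symmetric])
          (auto simp: indicator_def inv' matrix_vector_right_distrib add.commute intro!: nn_integral_cong)
      then show ?thesis by (simp add: nn_integral_lborel_translate vE)
    qed
    then show ?thesis by (simp add: nn_integral_multc)
  qed
  also have "\<dots> = (\<integral>\<^sup>+x. \<integral>\<^sup>+y. ?f x y \<partial>lborel \<partial>lborel)"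
    using lborel_pair.Fubini[OF mf] by simp
  also have "\<dots> = (\<integral>\<^sup>+x. \<integral>\<^sup>+y. ?g x y \<partial>lborel \<partial>lborel)"
  proof (rule nn_integral_cong)
    fix x
    show "(\<integral>\<^sup>+y. ?f x y \<partial>lborel) = (\<integral>\<^sup>+y. ?g x y \<partial>lborel)"
      using nn_integral_lborel_translate[of "?g x" "A *v x"] by simp
  qed
  also have "\<dots> = (\<integral>\<^sup>+y. \<integral>\<^sup>+x. ?g x y \<partial>lborel \<partial>lborel)"
    using lborel_pair.Fubini[OF mg] by simp
  also have "\<dots> = emeasure lborel E * emeasure lborel ((\<lambda>x. - (A *v x)) -` Q)"
  proof -
    have "(\<integral>\<^sup>+x. ?g x y \<partial>lborel) = indicator E y * emeasure lborel ((\<lambda>x. - (A *v x)) -` Q)" for y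
    proof -
      have "(\<integral>\<^sup>+x. ?g x y \<partial>lborel) = indicator E y *
          (\<integral>\<^sup>+x. indicator ((\<lambda>x. - (A *v x)) -` Q) (- (A' *v y) + x) \<partial>lborel)"
        by (subst nn_integral_cmult[symmetric])
          (auto simp: indicator_def inv' matrix_vector_mult_diff_distrib intro!: nn_integral_cong)
      then show ?thesis by (simp add: nn_integral_lborel_translate vQ del: uminus_add_conv_diff add_uminus_conv_diff)
    qed
    then show ?thesis by (simp add: nn_integral_multc)
  qed
  finally show ?thesis .
qed

lemma
  fixes A A' :: "real ^ 'n::finite ^ 'n"
  assumes inv: "A ** A' = mat 1" "A' ** A = mat 1"
    and int: "\<And>x. x \<in> int_vecs \<Longrightarrow> A *v x \<in> int_vecs" "\<And>x. x \<in> int_vecs \<Longrightarrow> A' *v x \<in> int_vecs"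
  shows fundamental_domain_automorphism: "fundamental_domain ((*v) A' -` unit_box)"
    and emeasure_automorphism:
      "E \<in> sets borel \<Longrightarrow> emeasure lborel ((*v) A -` E) = emeasure lborel E"
proof -
  have inv': "A *v (A' *v z) = z" "A' *v (A *v z) = z" for z
    by (simp_all add: matrix_vector_mul_assoc inv)
  let ?D = "(*v) A' -` unit_box"
  have borel: "?D \<in> sets borel"
    by (rule measurable_sets_borel[OF measurable_matrix_vector unit_box_borel])
  show D: "fundamental_domain ?D"
    unfolding fundamental_domain_def
  proof (intro conjI allI borel)
    fix z
    obtain x where x: "x \<in> int_vecs" "A' *v z - x \<in> unit_box"
      using fundamental_domain_ex[OF fundamental_domain_unit_box] by auto
    show "\<exists>!x. x \<in> int_vecs \<and> z - x \<in> ?D"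
    proof (rule ex1I[of _ "A *v x"])
      show "A *v x \<in> int_vecs \<and> z - A *v x \<in> ?D"
        using x by (simp add: int inv' matrix_vector_mult_diff_distrib)
      fix y assume "y \<in> int_vecs \<and> z - y \<in> ?D"
      then have "A' *v y = x"
        using x by (intro fundamental_domain_unique[OF fundamental_domain_unit_box, of _ _ "A' *v z"])
          (auto simp: int matrix_vector_mult_diff_distrib)
      then show "y = A *v x" using inv'(1)[of y] by simp
    qed
  qed
  have unit: "emeasure lborel (unit_box :: (real ^ 'n) set) \<noteq> 0" "emeasure lborel (unit_box :: (real ^ 'n) set) \<noteq> top"
    using emeasure_torus_haar_UNIV[where 'n = 'n] by (simp_all add: emeasure_torus_haar)
  let ?c = "emeasure lborel ((\<lambda>x. - (A *v x)) -` unit_box)"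
  have "(*v) A -` ?D = unit_box"
    by (auto simp: inv')
  moreover have "emeasure lborel ?D = emeasure lborel (unit_box :: (real ^ 'n) set)"
    using emeasure_fundamental_domain[OF D fundamental_domain_unit_box, of UNIV] by simp
  \<comment> \<open>Proportionality is applied to \<open>?D\<close>, whose preimage is the unit box
    and whose measure equals that of the unit box, which evaluates the constant.\<close>
  ultimately have "?c = emeasure lborel (unit_box :: (real ^ 'n) set)"
    using emeasure_linear_vimage_proportional[OF inv(1) borel unit_box_borel] unit
    by (auto simp: ennreal_mult_cancel_left)
  then show "emeasure lborel ((*v) A -` E) = emeasure lborel E" if "E \<in> sets borel"
    using emeasure_linear_vimage_proportional[OF inv(1) that unit_box_borel] unit
    by (simp add: mult.commute[of "emeasure lborel E"] ennreal_mult_cancel_left)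
qed

text \<open>Pulling back by \<open>A\<close> replaces the unit box by its image \<open>?D\<close>,
  again a fundamental domain; the lifted set is periodic, so \<open>?D\<close> may be exchanged for
  the unit box.\<close>

lemma measure_preserving_torus_map:
  fixes A A' :: "real ^ 'n::finite ^ 'n"
  assumes inv: "A ** A' = mat 1" "A' ** A = mat 1"
    and int: "\<And>x. x \<in> int_vecs \<Longrightarrow> A *v x \<in> int_vecs" "\<And>x. x \<in> int_vecs \<Longrightarrow> A' *v x \<in> int_vecs"
  shows "measure_preserving torus_haar torus_haar (torus_map A)"
proof -
  have vimage: "abs_torus -` torus_map A -` S = (*v) A -` abs_torus -` S" for S
    by (auto simp: torus_map_abs[OF int(1)])
  have cont: "continuous_on UNIV (torus_map A)"
  proof (subst continuous_on_open_vimage[OF open_UNIV], intro allI impI)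
    fix S :: "'n torus set" assume "open S"
    then have "open (abs_torus -` S)" by (simp add: open_torus_def)
    then have "open ((*v) A -` abs_torus -` S)"
      by (rule open_vimage[OF _ matrix_vector_mult_linear_continuous_on])
    then show "open (torus_map A -` S \<inter> UNIV)" by (simp add: open_torus_def vimage)
  qed
  have meas: "torus_map A \<in> torus_haar \<rightarrow>\<^sub>M torus_haar"
    using borel_measurable_continuous_onI[OF cont] by simp
  have "distr torus_haar torus_haar (torus_map A) = torus_haar"
  proof (rule measure_eqI)
    fix E assume "E \<in> sets (distr torus_haar torus_haar (torus_map A))"
    then have E: "E \<in> sets borel" by simp
    let ?P = "abs_torus -` E" and ?D = "(*v) A' -` unit_box"
    have P: "?P \<in> sets borel" by (rule measurable_sets_borel[OF measurable_abs_torus E])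
    have E': "torus_map A -` E \<in> sets borel"
      using measurable_sets[OF meas, of E] E by simp
    have D: "fundamental_domain ?D"
      using inv int by (rule fundamental_domain_automorphism)
    have "emeasure (distr torus_haar torus_haar (torus_map A)) E = emeasure torus_haar (torus_map A -` E)"
      using E meas by (simp add: emeasure_distr)
    also have "\<dots> = emeasure lborel (unit_box \<inter> (*v) A -` ?P)"
      by (simp only: emeasure_torus_haar[OF E'] vimage)
    also have "unit_box \<inter> (*v) A -` ?P = (*v) A -` (?D \<inter> ?P)"
      by (auto simp: matrix_vector_mul_assoc inv)
    also have "emeasure lborel \<dots> = emeasure lborel (?D \<inter> ?P)"
      using P D by (intro emeasure_automorphism[OF inv int]) (auto simp: fundamental_domain_def)
    also have "\<dots> = emeasure lborel (unit_box \<inter> ?P)"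
    proof (rule emeasure_fundamental_domain[OF D fundamental_domain_unit_box P])
      fix x z :: "real ^ 'n" assume "x \<in> int_vecs"
      then have "abs_torus (z + x) = abs_torus z" by (simp add: abs_torus_eq_iff)
      then show "z + x \<in> ?P \<longleftrightarrow> z \<in> ?P" by simp
    qed
    also have "\<dots> = emeasure torus_haar E" by (simp add: emeasure_torus_haar[OF E])
    finally show "emeasure (distr torus_haar torus_haar (torus_map A)) E = emeasure torus_haar E" .
  qed simp
  with meas show "measure_preserving torus_haar torus_haar (torus_map A)"
    by (simp add: measure_preserving_def)
qed

section \<open>The measure on the disjoint union of tori\<close>

lemma sets_family_haar: "sets family_haar = sets (count_space UNIV \<Otimes>\<^sub>M borel)"
  unfolding family_haar_def by (intro sets_pair_measure_cong) auto

lemma space_family_haar [simp]: "space family_haar = UNIV"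
  by (simp add: family_haar_def space_pair_measure)

lemma sets_family_haar_iff: "S \<in> sets family_haar \<longleftrightarrow> (\<forall>n. Pair n -` S \<in> sets borel)"
proof
  assume "S \<in> sets family_haar"
  then show "\<forall>n. Pair n -` S \<in> sets borel"
    unfolding sets_family_haar by (auto intro: sets_Pair1)
next
  assume *: "\<forall>n. Pair n -` S \<in> sets borel"
  have "S = (\<Union>n. {n} \<times> Pair n -` S)" by auto
  also have "\<dots> \<in> sets family_haar"
    unfolding sets_family_haar using * by (intro sets.countable_UN) auto
  finally show "S \<in> sets family_haar" .
qed

lemma emeasure_family_haar:
  "S \<in> sets family_haar \<Longrightarrow> emeasure family_haar S = (\<integral>\<^sup>+n. emeasure torus_haar (Pair n -` S) \<partial>count_space UNIV)"
  unfolding family_haar_def by (rule torus_haar.emeasure_pair_measure_alt)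

lemma null_family_haar_iff:
  "S \<in> null_sets family_haar \<longleftrightarrow> (\<forall>n. Pair n -` S \<in> null_sets torus_haar)"
  by (auto simp: null_sets_def sets_family_haar_iff emeasure_family_haar nn_integral_0_iff_AE AE_count_space)

lemma null_level:
  assumes "S \<in> null_sets torus_haar"
  shows "level n S \<in> null_sets family_haar"
proof -
  have "Pair m -` level n S = (if m = n then S else {})" for m by (auto simp: level_def)
  then show ?thesis using assms by (simp add: null_family_haar_iff)
qed

section \<open>The measurable conjugacy\<close>

text \<open>A bijection of the levels only permutes the sum of the fibre measures. It is left
  arbitrary to serve both the family map and its inverse.\<close>

lemma measure_preserving_levels:
  fixes T :: "int \<Rightarrow> 'n::finite torus \<Rightarrow> 'n torus"
  assumes \<tau>: "bij \<tau>" and T: "\<And>n. measure_preserving torus_haar torus_haar (T n)"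
  shows "measure_preserving family_haar family_haar (\<lambda>x. (\<tau> (fst x), T (fst x) (snd x)))"
    (is "measure_preserving _ _ ?f")
proof -
  have vimage: "Pair n -` ?f -` S = T n -` Pair (\<tau> n) -` S" for n S
    by auto
  have T_meas: "T n \<in> torus_haar \<rightarrow>\<^sub>M torus_haar" for n
    using T by (simp add: measure_preserving_def)
  have meas: "?f \<in> family_haar \<rightarrow>\<^sub>M family_haar"
  proof (rule measurableI)
    fix S assume "S \<in> sets (family_haar :: (int \<times> 'n torus) measure)"
    then have "Pair (\<tau> n) -` S \<in> sets borel" for n by (simp add: sets_family_haar_iff)
    then have "T n -` Pair (\<tau> n) -` S \<in> sets borel" for n
      using measurable_sets[OF T_meas, of "Pair (\<tau> n) -` S" n] by simp
    then show "?f -` S \<inter> space family_haar \<in> sets family_haar"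
      by (simp add: sets_family_haar_iff vimage)
  qed simp
  have "distr family_haar family_haar ?f = family_haar"
  proof (rule measure_eqI)
    fix S assume "S \<in> sets (distr family_haar family_haar ?f)"
    then have S: "S \<in> sets family_haar" by simp
    then have Sn: "Pair n -` S \<in> sets torus_haar" for n by (simp add: sets_family_haar_iff)
    have "emeasure (distr family_haar family_haar ?f) S = emeasure family_haar (?f -` S)"
      using S meas by (simp add: emeasure_distr)
    also have "\<dots> = (\<integral>\<^sup>+n. emeasure torus_haar (T n -` Pair (\<tau> n) -` S) \<partial>count_space UNIV)"
      using measurable_sets[OF meas S] by (simp add: emeasure_family_haar vimage)
    also have "\<dots> = (\<integral>\<^sup>+n. emeasure torus_haar (Pair (\<tau> n) -` S) \<partial>count_space UNIV)"
    proof (rule nn_integral_cong)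
      fix n
      have "emeasure torus_haar (Pair (\<tau> n) -` S) = emeasure (distr torus_haar torus_haar (T n)) (Pair (\<tau> n) -` S)"
        using T[of n] by (simp add: measure_preserving_def)
      then show "emeasure torus_haar (T n -` Pair (\<tau> n) -` S) = emeasure torus_haar (Pair (\<tau> n) -` S)"
        using emeasure_distr[OF T_meas Sn, of n "\<tau> n"] by simp
    qed
    also have "\<dots> = (\<integral>\<^sup>+n. emeasure torus_haar (Pair n -` S) \<partial>count_space UNIV)"
      by (rule nn_integral_bij_count_space[OF \<tau>, of "\<lambda>n. emeasure torus_haar (Pair n -` S)"])
    also have "\<dots> = emeasure family_haar S"
      by (simp add: emeasure_family_haar S)
    finally show "emeasure (distr family_haar family_haar ?f) S = emeasure family_haar S" .
  qed simp
  with meas show ?thesis by (simp add: measure_preserving_def)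
qed

lemma measure_preserving_funpow:
  assumes "measure_preserving \<mu> \<mu> f"
  shows "measure_preserving \<mu> \<mu> (f ^^ j)"
proof (induction j)
  case 0
  have "id = (\<lambda>x. x)" by auto
  then show ?case by (simp add: measure_preserving_def distr_id id_def)
next
  case (Suc j)
  then have f: "f \<in> \<mu> \<rightarrow>\<^sub>M \<mu>" "distr \<mu> \<mu> f = \<mu>" "f ^^ j \<in> \<mu> \<rightarrow>\<^sub>M \<mu>" "distr \<mu> \<mu> (f ^^ j) = \<mu>"
    using assms by (auto simp: measure_preserving_def)
  then have "distr \<mu> \<mu> (f \<circ> f ^^ j) = \<mu>"
    using distr_distr[OF f(1,3)] by simp
  then show ?case
    unfolding measure_preserving_def funpow.simps(2) using measurable_comp[OF f(3,1)] by blast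
qed

lemma null_vimage:
  assumes "measure_preserving \<mu> \<nu> f" "S \<in> null_sets \<nu>"
  shows "f -` S \<inter> space \<mu> \<in> null_sets \<mu>"
proof -
  have f: "f \<in> \<mu> \<rightarrow>\<^sub>M \<nu>" "distr \<mu> \<nu> f = \<nu>" using assms(1) by (auto simp: measure_preserving_def)
  then have "emeasure \<mu> (f -` S \<inter> space \<mu>) = emeasure \<nu> S"
    using emeasure_distr[OF f(1), of S] assms(2) by (auto simp: null_sets_def)
  then show ?thesis
    using measurable_sets[OF f(1), of S] assms(2) by (auto simp: null_sets_def)
qed

context rauzy_tiling
begin

lemma N_M: "N n ** M n = mat 1" "M n ** N n = mat 1"
  by (simp_all add: matrix_inv_mult invertible_M)

lemma measure_preserving_F: "measure_preserving family_haar family_haar F"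
proof -
  have "bij (\<lambda>n :: int. n + 1)"
    by (rule bij_betw_byWitness[of _ "\<lambda>n. n - 1"]) auto
  moreover have "measure_preserving torus_haar torus_haar (torus_map (N n))" for n
    using N_M[of n] N_int_vecs incidence_int_vecs
    by (intro measure_preserving_torus_map[of "N n" "M n"]) auto
  ultimately have "measure_preserving family_haar family_haar (\<lambda>x. (fst x + 1, torus_map (N (fst x)) (snd x)))"
    by (rule measure_preserving_levels)
  then show ?thesis by (simp add: family_map_def case_prod_unfold)
qed

lemma inv_F: "inv F = (\<lambda>x. (fst x - 1, torus_map (M (fst x - 1)) (snd x)))"
proof (rule inv_unique_comp)
  have *: "torus_map (M n) (abs_torus z) = abs_torus (M n *v z)" for n z
    by (rule torus_map_abs[OF incidence_int_vecs])
  show "F \<circ> (\<lambda>x. (fst x - 1, torus_map (M (fst x - 1)) (snd x))) = id"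
  proof
    fix x :: "int \<times> 'd torus"
    obtain z where "snd x = abs_torus z" using abs_torus_surj by blast
    then show "(F \<circ> (\<lambda>x. (fst x - 1, torus_map (M (fst x - 1)) (snd x)))) x = id x"
      by (simp add: * F_abs matrix_inv_vector[OF invertible_M] prod_eq_iff)
  qed
  show "(\<lambda>x. (fst x - 1, torus_map (M (fst x - 1)) (snd x))) \<circ> F = id"
  proof
    fix x :: "int \<times> 'd torus"
    obtain n z where x: "x = (n, abs_torus z)" using abs_torus_surj by (metis surj_pair)
    show "((\<lambda>x. (fst x - 1, torus_map (M (fst x - 1)) (snd x))) \<circ> F) x = id x"
      by (simp add: x * F_abs matrix_inv_vector[OF invertible_M])
  qed
qed

lemma measure_preserving_inv_F: "measure_preserving family_haar family_haar (inv F)"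
proof -
  have "bij (\<lambda>n :: int. n - 1)"
    by (rule bij_betw_byWitness[of _ "\<lambda>n. n + 1"]) auto
  moreover have "measure_preserving torus_haar torus_haar (torus_map (M (n - 1)))" for n
    using N_M[of "n - 1"] N_int_vecs incidence_int_vecs
    by (intro measure_preserving_torus_map[of "M (n - 1)" "N (n - 1)"]) auto
  ultimately have "measure_preserving family_haar family_haar (\<lambda>x. (fst x - 1, torus_map (M (fst x - 1)) (snd x)))"
    by (rule measure_preserving_levels)
  then show ?thesis by (simp add: inv_F)
qed

lemma measure_preserving_iterF: "measure_preserving family_haar family_haar (iterF k)"
  by (simp add: int_pow_def measure_preserving_funpow measure_preserving_F measure_preserving_inv_F)

lemma null_boundary_pullbacks: "boundary_pullbacks \<sigma> u v \<in> null_sets family_haar"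
proof -
  have "pullback F j (box_boundary \<sigma> u v k e) \<in> null_sets family_haar" if "e \<in> edges \<sigma> k" for j k e
  proof -
    have "compact (frontier (ebox k e))"
      using compact_edge_box by (simp add: compact_frontier)
    then have "abs_torus ` frontier (ebox k e) \<in> null_sets torus_haar"
      using lattice_tiling.negligible_frontier[OF edge_tiling that] by (rule null_abs_torus_image)
    then have "box_boundary \<sigma> u v k e \<in> null_sets family_haar"
      unfolding box_boundary_def by (rule null_level)
    then show ?thesis
      using null_vimage[OF measure_preserving_iterF[of j]] by (simp add: pullback_F)
  qed
  then show ?thesis
    unfolding boundary_pullbacks_def
    by (intro null_sets_UN' countable_finite[OF finite_edges]) auto
qed

end

context two_sided_rauzy_tiling
begin

abbreviation "Bd \<equiv> boundary_pullbacks \<sigma> u v"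
abbreviation "X \<equiv> Sigma UNIV (paths \<sigma>)"
abbreviation "\<phi> \<equiv> full_coding \<sigma> u v"

section \<open>Itineraries and the measurable inverse of the coding\<close>

definition itinerary :: "int \<times> 'd torus \<Rightarrow> int \<Rightarrow> 'd edge" where
  "itinerary x k = (SOME e. e \<in> edges \<sigma> (fst x + k) \<and> iterF k x \<in> open_box \<sigma> u v (fst x + k) e)"

lemma itinerary:
  assumes "x \<notin> Bd"
  shows "itinerary x k \<in> edges \<sigma> (fst x + k)" "iterF k x \<in> open_box \<sigma> u v (fst x + k) (itinerary x k)"
proof -
  obtain n z where x: "x = (n, abs_torus z)" using abs_torus_surj by (metis surj_pair)
  obtain w where w: "iterF k x = (n + k, abs_torus w)" using iterF_pos x by blast
  obtain y e where e: "y \<in> int_vecs" "e \<in> edges \<sigma> (n + k)" "w - y \<in> ebox (n + k) e"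
    using ebox_cover by blast
  have "abs_torus w = abs_torus (w - y)" using e(1) by (simp add: abs_torus_eq_iff)
  then have "iterF k x \<in> open_box \<sigma> u v (n + k) e"
    using boundary_free[OF assms e(2) _ e(3)] w by simp
  then have "\<exists>e. e \<in> edges \<sigma> (fst x + k) \<and> iterF k x \<in> open_box \<sigma> u v (fst x + k) e"
    using e(2) x by (intro exI[of _ e]) simp
  from someI_ex[OF this]
  show "itinerary x k \<in> edges \<sigma> (fst x + k)" "iterF k x \<in> open_box \<sigma> u v (fst x + k) (itinerary x k)"
    by (auto simp: itinerary_def)
qed

lemma itinerary_paths: "x \<notin> Bd \<Longrightarrow> itinerary x \<in> paths \<sigma> (fst x)"
  and coding_itinerary_eq: "x \<notin> Bd \<Longrightarrow> coding \<sigma> u v (fst x) (itinerary x) = x"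
  using coding_of_itinerary[of "itinerary x" "fst x" x] itinerary by auto

text \<open>A point off the null set \<open>Bd\<close> exists on every level, and its itinerary is a
  path; this supplies the default value in \<open>decode\<close>.\<close>

lemma paths_nonempty: "paths \<sigma> n \<noteq> {}"
proof -
  have "Pair n -` Bd \<in> null_sets torus_haar"
    using null_boundary_pullbacks by (simp add: null_family_haar_iff)
  then have "Pair n -` Bd \<noteq> UNIV"
    using emeasure_torus_haar_UNIV(2) by (auto simp: null_sets_def)
  then obtain t where "(n, t) \<notin> Bd" by auto
  then show ?thesis using itinerary_paths by fastforce
qed

text \<open>The default on \<open>Bd\<close> keeps the map inside \<open>X\<close>; it depends on
  the level only, so it does not spoil measurability.\<close>

definition decode :: "int \<times> 'd torus \<Rightarrow> int \<times> (int \<Rightarrow> 'd edge)" where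
  "decode x = (fst x, if x \<in> Bd then (SOME e. e \<in> paths \<sigma> (fst x)) else itinerary x)"

lemma decode_in: "decode x \<in> X"
  using some_in_eq[of "paths \<sigma> (fst x)"] paths_nonempty itinerary_paths[of x]
  by (auto simp: decode_def some_in_eq)

lemma full_coding_decode: "x \<notin> Bd \<Longrightarrow> \<phi> (decode x) = x"
  by (simp add: decode_def full_coding_def coding_itinerary_eq)

lemma decode_full_coding:
  assumes "x \<in> X" "\<phi> x \<notin> Bd"
  shows "decode (\<phi> x) = x"
proof -
  obtain n e where x: "x = (n, e)" by (cases x)
  have e: "e \<in> paths \<sigma> n" using assms(1) x by simp
  have \<phi>: "\<phi> x = coding \<sigma> u v n e" "fst (\<phi> x) = n"
    by (auto simp: x full_coding_def coding_eq[OF e])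
  then have "itinerary (\<phi> x) = e"
    using itinerary[OF assms(2)] assms(2) e by (intro itinerary_unique[of e n]) auto
  then show ?thesis using assms(2) \<phi> by (simp add: decode_def x)
qed

text \<open>Only a carrier of the Borel sigma-algebra; the measure of interest is the image of
  \<open>family_haar\<close> under \<open>decode\<close>.\<close>

definition path_space :: "(int \<times> (int \<Rightarrow> 'd edge)) measure" where
  "path_space = sigma X {G. openin (edge_shift_topology \<sigma>) G}"

lemma openin_subset_X: "openin (edge_shift_topology \<sigma>) G \<Longrightarrow> G \<subseteq> X"
  using openin_subset topspace_edge_shift by metis

lemma space_path_space [simp]: "space path_space = X"
  unfolding path_space_def using openin_subset_X by (intro space_measure_of) auto

lemma sets_path_space: "sets path_space = sigma_sets X {G. openin (edge_shift_topology \<sigma>) G}"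
  unfolding path_space_def using openin_subset_X by (intro sets_measure_of) auto

lemma openin_edge_shift_iff:
  "openin (edge_shift_topology \<sigma>) G \<longleftrightarrow> G \<subseteq> X \<and> (\<forall>n. openin (path_topology \<sigma> n) {e. (n, e) \<in> G})"
  by (simp add: edge_shift_topology_def openin_sum_topology topspace_path comp_def)

lemma open_in_path_space: "openin (edge_shift_topology \<sigma>) G \<Longrightarrow> G \<in> sets path_space"
  unfolding sets_path_space by auto

lemma measurable_into_path_space:
  assumes "f \<in> space \<mu> \<rightarrow> X" "\<And>G. openin (edge_shift_topology \<sigma>) G \<Longrightarrow> f -` G \<inter> space \<mu> \<in> sets \<mu>"
  shows "f \<in> \<mu> \<rightarrow>\<^sub>M path_space"
  unfolding path_space_def using assms openin_subset_X by (intro measurable_measure_of) auto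

lemma path_topology_local:
  assumes "openin (path_topology \<sigma> n) V" "e \<in> V"
  shows "\<exists>J. finite J \<and> (\<forall>e'\<in>paths \<sigma> n. (\<forall>k\<in>J. e' k = e k) \<longrightarrow> e' \<in> V)"
proof -
  obtain T where T: "openin (product_topology (\<lambda>k. discrete_topology (edges \<sigma> (n + k))) UNIV) T" "V = T \<inter> paths \<sigma> n"
    using assms(1) by (auto simp: path_topology_def openin_subtopology)
  then obtain Q where Q: "finite {k. Q k \<noteq> edges \<sigma> (n + k)}" "e \<in> PiE UNIV Q" "PiE UNIV Q \<subseteq> T"
    using assms(2) unfolding openin_product_topology_alt by force
  have "e' \<in> V" if e': "e' \<in> paths \<sigma> n" "\<forall>k\<in>{k. Q k \<noteq> edges \<sigma> (n + k)}. e' k = e k" for e'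
  proof -
    have "e' k \<in> Q k" for k
      using e' Q(2) by (cases "Q k = edges \<sigma> (n + k)") (auto simp: paths_def)
    then have "e' \<in> PiE UNIV Q" by (simp add: PiE_iff)
    then show ?thesis using Q(3) T(2) e'(1) by blast
  qed
  then show ?thesis using Q(1) by blast
qed

text \<open>Different labels change the lift by integer vectors only, so \<open>undefined\<close>
  can stand for the sequence of edges.\<close>

lemma open_itinerary: "open {t. iterF k (n, t) \<in> open_box \<sigma> u v m e}"
proof -
  have "abs_torus -` {t. iterF k (n, t) \<in> open_box \<sigma> u v m e}
      = (\<lambda>z. (n + k, abs_torus (pos n undefined k z))) -` open_box \<sigma> u v m e"
    by (auto simp: iterF_pos[of k n _ undefined])
  moreover have "open \<dots>"
    by (intro open_vimage open_open_box continuous_intros continuous_on_compose2[OF continuous_abs_torus continuous_pos]) auto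
  ultimately show ?thesis by (simp add: open_torus_def)
qed

text \<open>Off the boundary the itinerary is locally constant in every coordinate.\<close>

lemma decode_measurable: "decode \<in> family_haar \<rightarrow>\<^sub>M path_space"
proof (rule measurable_into_path_space)
  show "decode \<in> space family_haar \<rightarrow> X" using decode_in by auto
  fix G assume G: "openin (edge_shift_topology \<sigma>) G"
  have Bd: "Pair n -` Bd \<in> sets borel" for n
    using null_boundary_pullbacks by (auto simp: null_sets_def sets_family_haar_iff)
  have "{t. decode (n, t) \<in> G} \<in> sets borel" for n
  proof -
    let ?Q = "\<Union>{Q. open Q \<and> (\<forall>t\<in>Q. (n, t) \<notin> Bd \<longrightarrow> decode (n, t) \<in> G)}"
    have mem: "t \<in> ?Q" if t: "(n, t) \<notin> Bd" "decode (n, t) \<in> G" for t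
    proof -
      let ?e = "itinerary (n, t)"
      have "openin (path_topology \<sigma> n) {e. (n, e) \<in> G}" "?e \<in> {e. (n, e) \<in> G}"
        using G t by (auto simp: openin_edge_shift_iff decode_def)
      from path_topology_local[OF this] obtain J where
        J: "finite J" "\<forall>e'\<in>paths \<sigma> n. (\<forall>k\<in>J. e' k = ?e k) \<longrightarrow> e' \<in> {e. (n, e) \<in> G}"
        by (elim exE conjE)
      let ?V = "\<Inter>k\<in>J. {s. iterF k (n, s) \<in> open_box \<sigma> u v (n + k) (?e k)}"
      have "open ?V" using J(1) open_itinerary by (intro open_INT) auto
      moreover have "decode (n, s) \<in> G" if s: "s \<in> ?V" "(n, s) \<notin> Bd" for s
      proof -
        have "itinerary (n, s) k = ?e k" if "k \<in> J" for k
          using open_box_disjoint[OF _ _ itinerary(2)[OF s(2), of k], of "?e k"]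
            itinerary(1)[OF s(2), of k] itinerary(1)[OF t(1), of k] s(1) that by auto
        then show ?thesis
          using J(2)[rule_format, of "itinerary (n, s)"] itinerary_paths[OF s(2)] s(2) by (simp add: decode_def)
      qed
      moreover have "t \<in> ?V" using itinerary(2)[OF t(1)] by auto
      ultimately show ?thesis by blast
    qed
    have "open ?Q" by auto
    \<comment> \<open>Up to \<open>Bd\<close> the preimage is open; on \<open>Bd\<close>, within one
      level, \<open>decode\<close> is constant.\<close>
    moreover have "{t. decode (n, t) \<in> G} = (?Q - Pair n -` Bd) \<union>
      (if (n, SOME e. e \<in> paths \<sigma> n) \<in> G then Pair n -` Bd else {})"
      using mem by (auto simp: decode_def)
    ultimately show ?thesis using Bd[of n] by simp
  qed
  then show "decode -` G \<inter> space family_haar \<in> sets family_haar"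
    by (simp add: sets_family_haar_iff vimage_def)
qed

lemma full_coding_measurable: "\<phi> \<in> path_space \<rightarrow>\<^sub>M family_haar"
proof -
  have fst: "(\<lambda>x. fst (\<phi> x)) \<in> path_space \<rightarrow>\<^sub>M count_space UNIV"
  proof (subst measurable_count_space_eq2_countable, intro conjI ballI)
    fix n :: int
    have "(\<lambda>x. fst (\<phi> x)) -` {n} \<inter> space path_space = {n} \<times> paths \<sigma> n"
      using full_coding_fst by auto
    moreover have "openin (edge_shift_topology \<sigma>) ({n} \<times> paths \<sigma> n)"
      unfolding openin_edge_shift_iff
    proof (intro conjI allI)
      fix m
      have "{e. (m, e) \<in> {n} \<times> paths \<sigma> n} = (if m = n then topspace (path_topology \<sigma> m) else {})"
        by (auto simp: topspace_path)
      then show "openin (path_topology \<sigma> m) {e. (m, e) \<in> {n} \<times> paths \<sigma> n}" by simp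
    qed auto
    ultimately show "(\<lambda>x. fst (\<phi> x)) -` {n} \<inter> space path_space \<in> sets path_space"
      using open_in_path_space by simp
  qed auto
  have snd: "(\<lambda>x. snd (\<phi> x)) \<in> path_space \<rightarrow>\<^sub>M borel"
  proof (rule borel_measurableI)
    fix S :: "'d torus set" assume "open S"
    have "openin (edge_shift_topology \<sigma>) ((\<lambda>x. snd (\<phi> x)) -` S \<inter> X)"
      unfolding openin_edge_shift_iff
    proof (intro conjI allI)
      fix n
      have "continuous_map (path_topology \<sigma> n) euclidean (coding \<sigma> u v n)"
        using continuous_coding by (simp add: continuous_map_in_subtopology)
      moreover have "openin euclidean (UNIV \<times> S)"
        using \<open>open S\<close> by (simp add: open_Times)
      ultimately have "openin (path_topology \<sigma> n) {e \<in> topspace (path_topology \<sigma> n). coding \<sigma> u v n e \<in> UNIV \<times> S}"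
        by (rule openin_continuous_map_preimage)
      moreover have "{e. (n, e) \<in> (\<lambda>x. snd (\<phi> x)) -` S \<inter> X} =
          {e \<in> topspace (path_topology \<sigma> n). coding \<sigma> u v n e \<in> UNIV \<times> S}"
        by (auto simp: topspace_path full_coding_def mem_Times_iff)
      ultimately show "openin (path_topology \<sigma> n) {e. (n, e) \<in> (\<lambda>x. snd (\<phi> x)) -` S \<inter> X}" by simp
    qed auto
    then show "(\<lambda>x. snd (\<phi> x)) -` S \<inter> space path_space \<in> sets path_space"
      using open_in_path_space by simp
  qed
  have "(\<lambda>x. (fst (\<phi> x), snd (\<phi> x))) \<in> path_space \<rightarrow>\<^sub>M count_space UNIV \<Otimes>\<^sub>M borel"
    by (rule measurable_Pair[OF fst snd])
  then show ?thesis
    by (subst measurable_cong_sets[OF refl sets_family_haar]) simp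
qed

lemma edge_shift_measurable: "edge_shift \<in> path_space \<rightarrow>\<^sub>M path_space"
proof (rule measurable_into_path_space)
  show "edge_shift \<in> space path_space \<rightarrow> X"
    using left_shift_paths by (auto simp: edge_shift_def)
  fix G assume G: "openin (edge_shift_topology \<sigma>) G"
  have "openin (edge_shift_topology \<sigma>) (edge_shift -` G \<inter> X)"
    unfolding openin_edge_shift_iff
  proof (intro conjI allI)
    fix n
    have "continuous_map (path_topology \<sigma> n) (path_topology \<sigma> (n + 1)) left_shift"
      unfolding path_topology_def[of \<sigma> "n + 1"]
    proof (rule continuous_map_into_subtopology)
      show "left_shift \<in> topspace (path_topology \<sigma> n) \<rightarrow> paths \<sigma> (n + 1)"
        using left_shift_paths by (auto simp: topspace_path)
      show "continuous_map (path_topology \<sigma> n) (product_topology (\<lambda>k. discrete_topology (edges \<sigma> (n + 1 + k))) UNIV) left_shift"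
        unfolding continuous_map_componentwise_UNIV left_shift_def path_topology_def
      proof (intro allI continuous_map_from_subtopology)
        fix k
        have "n + 1 + k = n + (k + 1)" by simp
        then show "continuous_map (product_topology (\<lambda>k. discrete_topology (edges \<sigma> (n + k))) UNIV)
            (discrete_topology (edges \<sigma> (n + 1 + k))) (\<lambda>e. e (k + 1))"
          using continuous_map_product_projection[of "k + 1" UNIV "\<lambda>k. discrete_topology (edges \<sigma> (n + k))"]
          by (simp only: UNIV_I)
      qed
    qed
    moreover have "openin (path_topology \<sigma> (n + 1)) {e. (n + 1, e) \<in> G}"
      using G by (simp add: openin_edge_shift_iff)
    ultimately have "openin (path_topology \<sigma> n) {e \<in> topspace (path_topology \<sigma> n). left_shift e \<in> {e. (n + 1, e) \<in> G}}"
      by (rule openin_continuous_map_preimage)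
    moreover have "{e. (n, e) \<in> edge_shift -` G \<inter> X} =
        {e \<in> topspace (path_topology \<sigma> n). left_shift e \<in> {e. (n + 1, e) \<in> G}}"
      by (auto simp: topspace_path edge_shift_def)
    ultimately show "openin (path_topology \<sigma> n) {e. (n, e) \<in> edge_shift -` G \<inter> X}" by simp
  qed auto
  then show "edge_shift -` G \<inter> space path_space \<in> sets path_space"
    using open_in_path_space by simp
qed

lemma full_coding_shift: "x \<in> X \<Longrightarrow> \<phi> (edge_shift x) = F (\<phi> x)"
  by (auto simp: full_coding_def edge_shift_def coding_shift)

lemma AE_not_Bd: "AE x in family_haar. x \<notin> Bd"
  using null_boundary_pullbacks by (intro AE_not_in)

lemma AE_F_not_Bd: "AE x in family_haar. F x \<notin> Bd"
proof -
  have "F -` Bd \<in> null_sets family_haar"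
    using null_vimage[OF measure_preserving_F null_boundary_pullbacks] by simp
  then show ?thesis using AE_not_in by force
qed

text \<open>With the image of Haar measure under \<open>decode\<close>, the coding preserves measure
  because it inverts \<open>decode\<close> almost everywhere. Invariance under the shift is
  transported from that of Haar measure under \<open>F\<close>.\<close>

lemma measurable_conjugacy_coding:
  "\<exists>\<mu>. space \<mu> = topspace (edge_shift_topology \<sigma>) \<and>
    sets \<mu> = sigma_sets (topspace (edge_shift_topology \<sigma>)) {G. openin (edge_shift_topology \<sigma>) G} \<and>
    measurable_conjugacy \<mu> edge_shift family_haar F \<phi>"
proof -
  define \<mu> where "\<mu> = distr family_haar path_space decode"
  have sets: "sets \<mu> = sets path_space" and space: "space \<mu> = X"
    by (simp_all add: \<mu>_def)
  have F_meas: "F \<in> family_haar \<rightarrow>\<^sub>M family_haar"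
    using measure_preserving_F by (simp add: measure_preserving_def)
  have decode_\<mu>: "decode \<in> family_haar \<rightarrow>\<^sub>M \<mu>"
    using decode_measurable measurable_cong_sets[OF refl sets] by blast
  have shift_\<mu>: "edge_shift \<in> \<mu> \<rightarrow>\<^sub>M \<mu>"
    using edge_shift_measurable measurable_cong_sets[OF sets sets] by blast
  have \<phi>_\<mu>: "\<phi> \<in> \<mu> \<rightarrow>\<^sub>M family_haar"
    using full_coding_measurable measurable_cong_sets[OF sets refl] by blast
  have \<mu>: "distr family_haar \<mu> decode = \<mu>"
    unfolding \<mu>_def by (intro distr_cong) auto
  have "distr \<mu> \<mu> edge_shift = distr family_haar \<mu> (edge_shift \<circ> decode)"
    using distr_distr[OF shift_\<mu> decode_\<mu>] \<mu> by simp
  also have "\<dots> = distr family_haar \<mu> (decode \<circ> F)"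
  proof (rule distr_cong_AE)
    show "AE x in family_haar. (edge_shift \<circ> decode) x = (decode \<circ> F) x"
      using AE_not_Bd AE_F_not_Bd
    proof eventually_elim
      case (elim x)
      \<comment> \<open>Both sides are paths that the coding sends to \<open>F x\<close>; as
        \<open>F x\<close> avoids \<open>Bd\<close>, \<open>decode\<close> recovers them from this
        point.\<close>
      have "edge_shift (decode x) \<in> X"
        using left_shift_paths decode_in[of x] by (auto simp: edge_shift_def)
      moreover have "\<phi> (edge_shift (decode x)) = F x"
        using full_coding_shift[OF decode_in] full_coding_decode[OF elim(1)] by simp
      ultimately show ?case using decode_full_coding[of "edge_shift (decode x)"] elim(2) by simp
    qed
  qed (use decode_\<mu> shift_\<mu> F_meas in \<open>auto intro: measurable_comp\<close>)
  also have "\<dots> = distr (distr family_haar family_haar F) \<mu> decode"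
    using distr_distr[OF decode_\<mu> F_meas] by simp
  also have "\<dots> = \<mu>"
    using measure_preserving_F \<mu> by (simp add: measure_preserving_def)
  finally have shift: "measure_preserving \<mu> \<mu> edge_shift"
    using shift_\<mu> by (simp add: measure_preserving_def)
  have "distr \<mu> family_haar \<phi> = distr family_haar family_haar (\<phi> \<circ> decode)"
    using distr_distr[OF \<phi>_\<mu> decode_\<mu>] \<mu> by simp
  also have "\<dots> = distr family_haar family_haar (\<lambda>x. x)"
  proof (rule distr_cong_AE)
    show "AE x in family_haar. (\<phi> \<circ> decode) x = x"
      using AE_not_Bd by eventually_elim (simp add: full_coding_decode)
  qed (use decode_\<mu> \<phi>_\<mu> in \<open>auto intro: measurable_comp\<close>)
  also have "\<dots> = family_haar" by (rule distr_id)
  finally have coding: "measure_preserving \<mu> family_haar \<phi>"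
    using \<phi>_\<mu> by (simp add: measure_preserving_def)
  let ?A = "\<phi> -` Bd \<inter> X"
  have A: "?A \<in> null_sets \<mu>"
    using null_vimage[OF coding null_boundary_pullbacks] by (simp add: space)
  have inj: "inj_on \<phi> (X - ?A)"
    by (rule inj_on_inverseI[where g = decode]) (auto intro: decode_full_coding)
  have image: "\<phi> ` (X - ?A) = UNIV - Bd"
  proof (intro equalityI subsetI)
    fix x assume "x \<in> UNIV - Bd"
    then show "x \<in> \<phi> ` (X - ?A)"
      using decode_in[of x] full_coding_decode[of x] by (intro image_eqI[of _ _ "decode x"]) auto
  qed auto
  have inverse: "the_inv_into (X - ?A) \<phi> x = decode x" if "x \<in> UNIV - Bd" for x
    using that decode_in[of x] full_coding_decode[of x] by (intro the_inv_into_f_eq[OF inj]) auto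
  have "decode \<in> restrict_space family_haar (UNIV - Bd) \<rightarrow>\<^sub>M \<mu>"
    by (rule measurable_restrict_space1[OF decode_\<mu>])
  then have "the_inv_into (X - ?A) \<phi> \<in> restrict_space family_haar (UNIV - Bd) \<rightarrow>\<^sub>M \<mu>"
    by (rule measurable_cong[THEN iffD1, rotated]) (simp add: space_restrict_space inverse)
  then have "measurable_conjugacy \<mu> edge_shift family_haar F \<phi>"
    unfolding measurable_conjugacy_def
    using shift coding measure_preserving_F full_coding_shift A null_boundary_pullbacks inj image
    by (auto simp: space bij_betw_def intro!: bexI[of _ ?A] bexI[of _ Bd])
  then show ?thesis
    using sets space by (intro exI[of _ \<mu>]) (simp add: sets_path_space topspace_edge_shift)
qed

end

theorem theoremD:
  fixes \<sigma> :: "int \<Rightarrow> 'd::finite list \<Rightarrow> 'd list" and u v :: "real ^ 'd"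
  assumes "CARD('d) \<ge> 2"
    and "\<And>n. unimodular_substitution (\<sigma> n)"
    and "tiling_condition \<sigma> u v"
    and "\<And>n. compact (rauzy_fractal \<sigma> u v n)"
  shows "markov_partition (family_map \<sigma>) (edges \<sigma>) (open_box \<sigma> u v) \<and>
    (two_sided_primitive \<sigma> \<longrightarrow>
       generating (family_map \<sigma>) (edges \<sigma>) (open_box \<sigma> u v) \<and>
       (\<forall>n.
          (\<forall>e\<in>paths \<sigma> n. \<exists>x\<in>level n UNIV. cylinder_limit \<sigma> u v n e = {x}) \<and>
          continuous_map (path_topology \<sigma> n) (top_of_set (level n UNIV)) (coding \<sigma> u v n) \<and>
          inj_on (coding \<sigma> u v n)
            (paths \<sigma> n - coding \<sigma> u v n -` boundary_pullbacks \<sigma> u v) \<and>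
          (\<forall>e\<in>paths \<sigma> n. coding \<sigma> u v (n + 1) (left_shift e) = family_map \<sigma> (coding \<sigma> u v n e))) \<and>
       (\<exists>\<mu>. space \<mu> = topspace (edge_shift_topology \<sigma>) \<and>
            sets \<mu> = sigma_sets (topspace (edge_shift_topology \<sigma>))
                       {U. openin (edge_shift_topology \<sigma>) U} \<and>
            measurable_conjugacy \<mu> edge_shift family_haar (family_map \<sigma>) (full_coding \<sigma> u v)) \<and>
       inj_on (full_coding \<sigma> u v)
         (topspace (edge_shift_topology \<sigma>) - full_coding \<sigma> u v -` boundary_pullbacks \<sigma> u v))"
proof -
  interpret rauzy_tiling \<sigma> u v
    by unfold_locales (fact assms)+
  show ?thesis
  proof (intro conjI impI)
    assume "two_sided_primitive \<sigma>"
    then interpret two_sided_rauzy_tiling \<sigma> u v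
      by unfold_locales
    show "generating (family_map \<sigma>) (edges \<sigma>) (open_box \<sigma> u v)"
      by (rule generating)
    have "\<exists>x\<in>level n UNIV. cylinder_limit \<sigma> u v n e = {x}" if "e \<in> paths \<sigma> n" for n e
      using cylinder_limit_eq[OF that] by (auto simp: level_def)
    then show "\<forall>n.
        (\<forall>e\<in>paths \<sigma> n. \<exists>x\<in>level n UNIV. cylinder_limit \<sigma> u v n e = {x}) \<and>
        continuous_map (path_topology \<sigma> n) (top_of_set (level n UNIV)) (coding \<sigma> u v n) \<and>
        inj_on (coding \<sigma> u v n) (paths \<sigma> n - coding \<sigma> u v n -` boundary_pullbacks \<sigma> u v) \<and>
        (\<forall>e\<in>paths \<sigma> n. coding \<sigma> u v (n + 1) (left_shift e) = family_map \<sigma> (coding \<sigma> u v n e))"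
      by (intro allI conjI ballI continuous_coding inj_coding coding_shift) auto
    show "\<exists>\<mu>. space \<mu> = topspace (edge_shift_topology \<sigma>) \<and>
        sets \<mu> = sigma_sets (topspace (edge_shift_topology \<sigma>)) {U. openin (edge_shift_topology \<sigma>) U} \<and>
        measurable_conjugacy \<mu> edge_shift family_haar (family_map \<sigma>) (full_coding \<sigma> u v)"
      by (rule measurable_conjugacy_coding)
    show "inj_on (full_coding \<sigma> u v)
        (topspace (edge_shift_topology \<sigma>) - full_coding \<sigma> u v -` boundary_pullbacks \<sigma> u v)"
      by (rule inj_full_coding)
  qed (rule markov)
qed

end
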